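(* Let $2p\in\{2,4,6\}$ and let $U$ be the smooth solution of the half-line wave equation with Neumann boundary condition $$U_{tt}=U_{xx}+F,\quad x\in[0,\infty),\ t\ge0,\qquad U(x,0)=f^1(x),\ U_t(x,0)=f^2(x),\qquad U_x(0,t)=g(t),\qquad\|U(\cdot,t)\|_{L_2}<\infty,$$ where $F,f^1,f^2,g$ are compatible smooth functions with compact support. Let $u$ solve the SBP-SAT semi-discretization of order $2p$ with mesh size $h$, $$u_{tt}=Du+H^{-1}e_0\,(e_0^TSu-g)+F_g,\qquad u_j(0)=f^1(x_j),\ (u_j)_t(0)=f^2(x_j),$$ with $D,H,S$ as in the context, and let $\xi_j(t)=U(x_j,t)-u_j(t)$. Let $\epsilon$ be the part of the error due to the boundary truncation error. Then for every final time $t_f$, $$\sqrt{\int_0^{t_f}\|\epsilon(\cdot,t)\|_h^2dt}\le C h^{b},\qquad \sqrt{\int_0^{t_f}\|\xi(\cdot,t)\|_h^2dt}\le C h^{q}$$ for all sufficiently small $h$, with $C$ independent of $h$, where $b=2,\ q=2$ for $2p=2$; $b=4,\ q=4$ for $2p=4$; and $b=5,\ q=5$ for $2p=6$.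
   Context: Grid: $x_j=jh$, $j=0,1,2,\dots$; $u_j(t)\approx U(x_j,t)$; $(F_g)_j=F(x_j,t)$; $e_0=[1,0,0,\dots]^T$, $E_0=e_0e_0^T$; $\|v\|_h^2=h\sum_{j\ge0}|v_j|^2$, and errors satisfy $\|\cdot\|_h<\infty$. The SBP operator is $D=H^{-1}(-M-E_0S)$ with $H$ diagonal positive definite and $M$ symmetric positive semi-definite; only the first row of $S$ (a one-sided approximation of $\partial_x$ at $x=0$ of order $p+1$) enters. The error satisfies $\xi_{tt}=-H^{-1}M\xi+T$, with zero initial data, where $T$ is the truncation error; its first $m$ components ($m=1,4,6$ for $2p=2,4,6$) are $\mathcal O(h^p)$ and the others $\mathcal O(h^{2p})$. The boundary part $\epsilon$ is the solution of $\epsilon_{tt}=-H^{-1}M\epsilon+h^pT^B$ with zero initial data, where $h^pT^B$ consists of the (leading-order part of the) first $m$ components of $T$, all other components being zero. Operators (rows and columns numbered from $0$; unlisted entries of a listed row are zero; $D_+v_j=(v_{j+1}-v_j)/h$, $D_-v_j=(v_j-v_{j-1})/h$): $2p=2$: $H=h\,\mathrm{diag}(\tfrac12,1,1,\dots)$; first row of $S$: $\frac1h(-\tfrac32,2,-\tfrac12)$; row $0$ of $h^2D$: $(1,-2,1)$; $(Dv)_j=D_+D_-v_j$ for $j\ge1$. $2p=4$: $H=h\,\mathrm{diag}(\tfrac{17}{48},\tfrac{59}{48},\tfrac{43}{48},\tfrac{49}{48},1,1,\dots)$; first row of $S$: $\frac1h(-\tfrac{11}{6},3,-\tfrac32,\tfrac13)$;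 rows $0$–$3$ of $h^2D$: $(2,-5,4,-1)$; $(1,-2,1)$; $(-\tfrac4{43},\tfrac{59}{43},-\tfrac{110}{43},\tfrac{59}{43},-\tfrac4{43})$; $(-\tfrac1{49},0,\tfrac{59}{49},-\tfrac{118}{49},\tfrac{64}{49},-\tfrac4{49})$; $(Dv)_j=(D_+D_--\tfrac{h^2}{12}(D_+D_-)^2)v_j$ for $j\ge4$. $2p=6$: $H=h\,\mathrm{diag}(\tfrac{13649}{43200},\tfrac{12013}{8640},\tfrac{2711}{4320},\tfrac{5359}{4320},\tfrac{7877}{8640},\tfrac{43801}{43200},1,1,\dots)$; first row of $S$: $\frac1h(-\tfrac{25}{12},4,-3,\tfrac43,-\tfrac14)$; rows $0$–$5$ of $h^2D$: row 0: $(\tfrac{114170}{40947},-\tfrac{438107}{54596},\tfrac{336409}{40947},-\tfrac{276997}{81894},\tfrac{3747}{13649},\tfrac{21035}{163788})$; row 1: $(\tfrac{6173}{5860},-\tfrac{2066}{879},\tfrac{3283}{1758},-\tfrac{303}{293},\tfrac{2111}{3516},-\tfrac{601}{4395})$; row 2: $(-\tfrac{52391}{81330},\tfrac{134603}{32532},-\tfrac{21982}{2711},\tfrac{112915}{16266},-\tfrac{46969}{16266},\tfrac{30409}{54220})$; row 3: $(\tfrac{68603}{321540},-\tfrac{12423}{10718},\tfrac{112915}{32154},-\tfrac{75934}{16077},\tfrac{53369}{21436},-\tfrac{54899}{160770},\tfrac{48}{5359})$; row 4: $(-\tfrac{7053}{39385},\tfrac{86551}{94524},-\tfrac{46969}{23631},\tfrac{53369}{15754},-\tfrac{87904}{23631},\tfrac{820271}{472620},-\tfrac{1296}{7877},\tfrac{96}{7877})$;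 row 5: $(\tfrac{21035}{525612},-\tfrac{24641}{131403},\tfrac{30409}{87602},-\tfrac{54899}{131403},\tfrac{820271}{525612},-\tfrac{117600}{43801},\tfrac{64800}{43801},-\tfrac{6480}{43801},\tfrac{480}{43801})$; $(Dv)_j=(D_+D_--\tfrac{h^2}{12}(D_+D_-)^2+\tfrac{h^4}{90}(D_+D_-)^3)v_j$ for $j\ge6$. *)

theory Defs
  imports "HOL-Analysis.Analysis"
begin

text \<open>Derivatives at the boundary points are one-sided.\<close>

definition dpos :: "(real \<Rightarrow> real) \<Rightarrow> real \<Rightarrow> real" where
  "dpos f x = vector_derivative f (at x within {0..})"

definition dx :: "(real \<Rightarrow> real \<Rightarrow> real) \<Rightarrow> real \<Rightarrow> real \<Rightarrow> real" where
  "dx U = (\<lambda>x t. dpos (\<lambda>y. U y t) x)"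

definition dt :: "(real \<Rightarrow> real \<Rightarrow> real) \<Rightarrow> real \<Rightarrow> real \<Rightarrow> real" where
  "dt U = (\<lambda>x t. dpos (\<lambda>s. U x s) t)"

definition smooth_halfline :: "(real \<Rightarrow> real) \<Rightarrow> bool" where
  "smooth_halfline f \<longleftrightarrow> (\<forall>k. (dpos ^^ k) f differentiable_on {0..})"

definition smooth_quadrant :: "(real \<Rightarrow> real \<Rightarrow> real) \<Rightarrow> bool" where
  "smooth_quadrant U \<longleftrightarrow>
     (\<forall>i k. (\<lambda>z. ((dx ^^ i) ((dt ^^ k) U)) (fst z) (snd z)) differentiable_on ({0..} \<times> {0..}))"

definition compact_support_halfline :: "(real \<Rightarrow> real) \<Rightarrow> bool" where
  "compact_support_halfline f \<longleftrightarrow> bounded {x \<in> {0..}. f x \<noteq> 0}"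

definition compact_support_quadrant :: "(real \<Rightarrow> real \<Rightarrow> real) \<Rightarrow> bool" where
  "compact_support_quadrant F \<longleftrightarrow> bounded {(x, t) \<in> {0..} \<times> {0..}. F x t \<noteq> 0}"

text \<open>\<open>initial_dt F f1 f2 k\<close> is the \<open>k\<close>-th time derivative at time \<open>0\<close> which the data
  prescribe through the differential equation; the data are compatible if these derivatives
  satisfy the differentiated boundary conditions at the corner \<open>x = t = 0\<close>.\<close>

fun initial_dt :: "(real \<Rightarrow> real \<Rightarrow> real) \<Rightarrow> (real \<Rightarrow> real) \<Rightarrow> (real \<Rightarrow> real) \<Rightarrow> nat \<Rightarrow> real \<Rightarrow> real"
where
  "initial_dt F f1 f2 0 = f1"
| "initial_dt F f1 f2 (Suc 0) = f2"
| "initial_dt F f1 f2 (Suc (Suc k)) =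
     (\<lambda>x. dpos (dpos (initial_dt F f1 f2 k)) x + ((dt ^^ k) F) x 0)"

definition compatible_data ::
  "(real \<Rightarrow> real \<Rightarrow> real) \<Rightarrow> (real \<Rightarrow> real) \<Rightarrow> (real \<Rightarrow> real) \<Rightarrow> (real \<Rightarrow> real) \<Rightarrow> bool" where
  "compatible_data F f1 f2 g \<longleftrightarrow> (\<forall>k. dpos (initial_dt F f1 f2 k) 0 = ((dpos ^^ k) g) 0)"

definition wave_data ::
  "(real \<Rightarrow> real \<Rightarrow> real) \<Rightarrow> (real \<Rightarrow> real) \<Rightarrow> (real \<Rightarrow> real) \<Rightarrow> (real \<Rightarrow> real) \<Rightarrow> bool" where
  "wave_data F f1 f2 g \<longleftrightarrow>
     smooth_quadrant F \<and> smooth_halfline f1 \<and> smooth_halfline f2 \<and> smooth_halfline g \<and>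
     compact_support_quadrant F \<and> compact_support_halfline f1 \<and> compact_support_halfline f2 \<and>
     compact_support_halfline g \<and> compatible_data F f1 f2 g"

definition wave_solution ::
  "(real \<Rightarrow> real \<Rightarrow> real) \<Rightarrow> (real \<Rightarrow> real) \<Rightarrow> (real \<Rightarrow> real) \<Rightarrow> (real \<Rightarrow> real) \<Rightarrow>
   (real \<Rightarrow> real \<Rightarrow> real) \<Rightarrow> bool" where
  "wave_solution F f1 f2 g U \<longleftrightarrow>
     smooth_quadrant U \<and>
     (\<forall>x\<ge>0. \<forall>t\<ge>0. dt (dt U) x t = dx (dx U) x t + F x t) \<and>
     (\<forall>x\<ge>0. U x 0 = f1 x \<and> dt U x 0 = f2 x) \<and>
     (\<forall>t\<ge>0. dx U 0 t = g t) \<and>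
     (\<forall>t\<ge>0. set_integrable lborel {0..} (\<lambda>x. (U x t)\<^sup>2))"

text \<open>A grid function is a map from indices \<open>j\<close> (the point \<open>x\<^sub>j = j h\<close>) to reals. The operators have order \<open>2 * p\<close>. Only
  \<open>p = 1, 2, 3\<close> are meaningful; the tables below return the \<open>p = 3\<close> entries otherwise.\<close>

definition dplus :: "real \<Rightarrow> (nat \<Rightarrow> real) \<Rightarrow> nat \<Rightarrow> real" where
  "dplus h v j = (v (Suc j) - v j) / h"

text \<open>For \<open>j = 0\<close> the subtraction is truncated; \<open>sbp_D\<close> never uses that value.\<close>

definition dminus :: "real \<Rightarrow> (nat \<Rightarrow> real) \<Rightarrow> nat \<Rightarrow> real" where
  "dminus h v j = (v j - v (j - 1)) / h"

definition dpm :: "real \<Rightarrow> (nat \<Rightarrow> real) \<Rightarrow> nat \<Rightarrow> real" where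
  "dpm h v = dplus h (dminus h v)"

definition row_apply :: "real list \<Rightarrow> (nat \<Rightarrow> real) \<Rightarrow> real" where
  "row_apply r v = (\<Sum>k<length r. r ! k * v k)"

definition num_bdry :: "nat \<Rightarrow> nat" where
  "num_bdry p = (if p = 1 then 1 else if p = 2 then 4 else 6)"

definition H_weights :: "nat \<Rightarrow> real list" where
  "H_weights p =
    (if p = 1 then [1/2]
     else if p = 2 then [17/48, 59/48, 43/48, 49/48]
     else [13649/43200, 12013/8640, 2711/4320, 5359/4320, 7877/8640, 43801/43200])"

definition S_row :: "nat \<Rightarrow> real list" where
  "S_row p =
    (if p = 1 then [- (3/2), 2, - (1/2)]
     else if p = 2 then [- (11/6), 3, - (3/2), 1/3]
     else [- (25/12), 4, - 3, 4/3, - (1/4)])"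

definition D_rows :: "nat \<Rightarrow> real list list" where
  "D_rows p =
    (if p = 1 then
     [[1, - 2, 1]]
     else if p = 2 then
     [[2, - 5, 4, - 1],
      [1, - 2, 1],
      [- (4/43), 59/43, - (110/43), 59/43, - (4/43)],
      [- (1/49), 0, 59/49, - (118/49), 64/49, - (4/49)]]
     else
     [[114170/40947, - (438107/54596), 336409/40947, - (276997/81894), 3747/13649, 21035/163788],
      [6173/5860, - (2066/879), 3283/1758, - (303/293), 2111/3516, - (601/4395)],
      [- (52391/81330), 134603/32532, - (21982/2711), 112915/16266, - (46969/16266), 30409/54220],
      [68603/321540, - (12423/10718), 112915/32154, - (75934/16077), 53369/21436, - (54899/160770), 48/5359],
      [- (7053/39385), 86551/94524, - (46969/23631), 53369/15754, - (87904/23631), 820271/472620, - (1296/7877), 96/7877],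
      [21035/525612, - (24641/131403), 30409/87602, - (54899/131403), 820271/525612, - (117600/43801), 64800/43801, - (6480/43801), 480/43801]])"

text \<open>\<open>sbp_H\<close> is the diagonal of \<open>H\<close>, and \<open>sbp_S0 p h v\<close> is the component \<open>e\<^sub>0\<^sup>T S v\<close>.\<close>

definition sbp_H :: "nat \<Rightarrow> real \<Rightarrow> nat \<Rightarrow> real" where
  "sbp_H p h j = h * (if j < length (H_weights p) then H_weights p ! j else 1)"

definition sbp_S0 :: "nat \<Rightarrow> real \<Rightarrow> (nat \<Rightarrow> real) \<Rightarrow> real" where
  "sbp_S0 p h v = row_apply (S_row p) v / h"

definition sbp_D :: "nat \<Rightarrow> real \<Rightarrow> (nat \<Rightarrow> real) \<Rightarrow> nat \<Rightarrow> real" where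
  "sbp_D p h v j =
    (if j < num_bdry p then row_apply (D_rows p ! j) v / h\<^sup>2
     else if p = 1 then dpm h v j
     else if p = 2 then dpm h v j - h\<^sup>2 / 12 * (dpm h ^^ 2) v j
     else dpm h v j - h\<^sup>2 / 12 * (dpm h ^^ 2) v j + h ^ 4 / 90 * (dpm h ^^ 3) v j)"

text \<open>\<open>M\<close> is determined by \<open>D = H\<^sup>-\<^sup>1 (- M - E\<^sub>0 S)\<close>.\<close>

definition sbp_M :: "nat \<Rightarrow> real \<Rightarrow> (nat \<Rightarrow> real) \<Rightarrow> nat \<Rightarrow> real" where
  "sbp_M p h v j = - sbp_H p h j * sbp_D p h v j - (if j = 0 then sbp_S0 p h v else 0)"

definition finite_hnorm :: "(nat \<Rightarrow> real) \<Rightarrow> bool" where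
  "finite_hnorm v \<longleftrightarrow> summable (\<lambda>j. (v j)\<^sup>2)"

definition hnorm :: "real \<Rightarrow> (nat \<Rightarrow> real) \<Rightarrow> real" where
  "hnorm h v = sqrt (h * (\<Sum>j. (v j)\<^sup>2))"

text \<open>\<open>second_order_ivp rhs a b v\<close>: \<open>v\<^sub>t\<^sub>t = rhs t v\<close> for \<open>t \<ge> 0\<close>, \<open>v = a\<close> and \<open>v\<^sub>t = b\<close> at \<open>t = 0\<close>.\<close>

definition second_order_ivp ::
  "(real \<Rightarrow> (nat \<Rightarrow> real) \<Rightarrow> nat \<Rightarrow> real) \<Rightarrow> (nat \<Rightarrow> real) \<Rightarrow> (nat \<Rightarrow> real) \<Rightarrow>
   (real \<Rightarrow> nat \<Rightarrow> real) \<Rightarrow> bool" where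
  "second_order_ivp rhs a b v \<longleftrightarrow>
     (\<exists>w. \<forall>j. v 0 j = a j \<and> w 0 j = b j \<and>
       (\<forall>t\<ge>0. ((\<lambda>s. v s j) has_real_derivative w t j) (at t within {0..}) \<and>
              ((\<lambda>s. w s j) has_real_derivative rhs t (v t) j) (at t within {0..})))"

text \<open>\<open>D v + H\<^sup>-\<^sup>1 e\<^sub>0 (e\<^sub>0\<^sup>T S v - g) + F\<^sub>g\<close> at time \<open>t\<close>\<close>

definition sat_rhs ::
  "nat \<Rightarrow> real \<Rightarrow> (real \<Rightarrow> real \<Rightarrow> real) \<Rightarrow> (real \<Rightarrow> real) \<Rightarrow> real \<Rightarrow> (nat \<Rightarrow> real) \<Rightarrow> nat \<Rightarrow> real" where
  "sat_rhs p h F g t v j =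
     sbp_D p h v j + (if j = 0 then (sbp_S0 p h v - g t) / sbp_H p h 0 else 0) + F (real j * h) t"

definition sbp_sat_solution ::
  "nat \<Rightarrow> real \<Rightarrow> (real \<Rightarrow> real \<Rightarrow> real) \<Rightarrow> (real \<Rightarrow> real) \<Rightarrow> (real \<Rightarrow> real) \<Rightarrow> (real \<Rightarrow> real) \<Rightarrow>
   (real \<Rightarrow> nat \<Rightarrow> real) \<Rightarrow> bool" where
  "sbp_sat_solution p h F f1 f2 g u \<longleftrightarrow>
     second_order_ivp (sat_rhs p h F g) (\<lambda>j. f1 (real j * h)) (\<lambda>j. f2 (real j * h)) u"

definition grid_error ::
  "real \<Rightarrow> (real \<Rightarrow> real \<Rightarrow> real) \<Rightarrow> (real \<Rightarrow> nat \<Rightarrow> real) \<Rightarrow> real \<Rightarrow> nat \<Rightarrow> real" where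
  "grid_error h U u t j = U (real j * h) t - u t j"

text \<open>The truncation error \<open>T\<close> is the residual of \<open>U\<close> in the semi-discretization.\<close>

definition truncation_error ::
  "nat \<Rightarrow> (real \<Rightarrow> real \<Rightarrow> real) \<Rightarrow> (real \<Rightarrow> real) \<Rightarrow> (real \<Rightarrow> real \<Rightarrow> real) \<Rightarrow>
   real \<Rightarrow> real \<Rightarrow> nat \<Rightarrow> real" where
  "truncation_error p F g U h t j =
     dt (dt U) (real j * h) t - sat_rhs p h F g t (\<lambda>i. U (real i * h) t) j"

text \<open>Two readings of the boundary truncation error \<open>h\<^sup>p T\<^sup>B\<close>: the first components of \<open>T\<close>, or
  only their leading-order part, with \<open>T\<^sup>B\<close> the limit of \<open>T / h\<^sup>p\<close> as \<open>h\<close> tends to \<open>0\<close>.\<close>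

definition boundary_truncation ::
  "nat \<Rightarrow> (real \<Rightarrow> real \<Rightarrow> real) \<Rightarrow> (real \<Rightarrow> real) \<Rightarrow> (real \<Rightarrow> real \<Rightarrow> real) \<Rightarrow>
   real \<Rightarrow> real \<Rightarrow> nat \<Rightarrow> real" where
  "boundary_truncation p F g U h t j =
     (if j < num_bdry p then truncation_error p F g U h t j else 0)"

definition leading_boundary_truncation ::
  "nat \<Rightarrow> (real \<Rightarrow> real \<Rightarrow> real) \<Rightarrow> (real \<Rightarrow> real) \<Rightarrow> (real \<Rightarrow> real \<Rightarrow> real) \<Rightarrow>
   real \<Rightarrow> real \<Rightarrow> nat \<Rightarrow> real" where
  "leading_boundary_truncation p F g U h t j =
     (if j < num_bdry p
      then h ^ p * Lim (at_right 0) (\<lambda>k. truncation_error p F g U k t j / k ^ p) else 0)"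

text \<open>The part of the error driven by a forcing \<open>B\<close>: \<open>\<epsilon>\<^sub>t\<^sub>t = - H\<^sup>-\<^sup>1 M \<epsilon> + B\<close>, zero initial data.\<close>

definition error_part :: "nat \<Rightarrow> real \<Rightarrow> (real \<Rightarrow> nat \<Rightarrow> real) \<Rightarrow> (real \<Rightarrow> nat \<Rightarrow> real) \<Rightarrow> bool" where
  "error_part p h B \<epsilon> \<longleftrightarrow>
     second_order_ivp (\<lambda>t v j. - (sbp_M p h v j / sbp_H p h j) + B t j) (\<lambda>_. 0) (\<lambda>_. 0) \<epsilon>"

end

(* The error is estimated by the energy method, applied to its antiderivative in time, so that the
   energy controls the error itself. With unit mesh size M = B^T N B, where B is the forward
   difference and N is banded, symmetric and (after a diagonal scaling) strictly diagonally dominant;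
   this yields both the coercivity of the energy and, by Jacobi iteration, decaying solutions of
   M phi = H tau whenever H tau has mean zero. For p = 2, 3 the leading boundary truncation error has
   weighted mean zero because H is a quadrature of order 2 p, so that subtracting the boundary layer
   h^(p+2) phi removes it up to O(h^(p+5/2)). The remaining boundary truncation error of order h^s
   contributes h^(s+1), by integration by parts in time and a discrete Sobolev inequality, and the
   interior truncation error, supported on O(1/h) points by finite speed of propagation, contributes
   h^(2p). As solutions are only assumed to be square summable at every single time, the uniform
   boundedness that justifies the energy argument is itself derived, from Baire's theorem. *)

theory Submission
  imports Defs
begin

subsection \<open>Pointwise square summability implies boundedness\<close>

text \<open>The usual energy would measure the velocity and, after integration by parts in time,
  would call for the time derivative of the boundary forcing. With the antiderivative the kinetic
  term is the square sum of the error itself, and a forcing that is continuous in time is enough. A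
  forcing of size h^s at six points has discrete norm of order h^(s+1/2); the missing half power is
  the factor sqrt h in the boundary values of the antiderivative. For p = 2, 3 the corrected
  remainder has s = p + 1 and gives p + 2, which 2 p never undercuts. The other obstacle is the
  infinite grid. Summation by parts stopped at an index n leaves a flux near n, and no decay uniform
  in time is known; only the time integral of the flux is shown to vanish as n grows, which needs
  square sums bounded in time. The three operators share one abstract form with crude common
  constants, so that p enters the energy argument only through finite tables.\<close>

text \<open>Think of \<open>f\<close> as the norm of a solution at time \<open>t\<close>. On a
  portion of the bad set \<open>f\<close> is bounded by Baire, and the gaps of the bad set are
  filled by propagation. What matters is that \<open>gap\<close> bounds \<open>f\<close> by its two
  end values alone: the portion may have infinitely many gaps, and the bounds from
  \<open>extend\<close> are not uniform over them.\<close>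

lemma baire_locally_bounded:
  fixes f :: "real \<Rightarrow> real" and \<Phi> :: "real \<Rightarrow> real"
  assumes "\<delta> > 0"
    and closed_sub: "\<And>K. closed {t \<in> {\<alpha>..\<beta>}. f t \<le> K}"
    and extend: "\<And>a b. \<alpha> \<le> a \<Longrightarrow> a < b \<Longrightarrow> b \<le> \<beta> \<Longrightarrow>
        (\<And>a' b'. a < a' \<Longrightarrow> a' \<le> b' \<Longrightarrow> b' < b \<Longrightarrow> \<exists>K. \<forall>t\<in>{a'..b'}. f t \<le> K) \<Longrightarrow>
        \<exists>K. \<forall>t\<in>{a..b}. f t \<le> K"
    and gap: "\<And>a b K. \<alpha> \<le> a \<Longrightarrow> a \<le> b \<Longrightarrow> b \<le> \<beta> \<Longrightarrow> b - a \<le> \<delta> \<Longrightarrow>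
        \<exists>K'. \<forall>t\<in>{a..b}. f t \<le> K' \<Longrightarrow> f a \<le> K \<Longrightarrow> f b \<le> K \<Longrightarrow>
        \<forall>t\<in>{a..b}. f t \<le> \<Phi> K"
  shows "\<exists>K. \<forall>t\<in>{\<alpha>..\<beta>}. f t \<le> K"
proof -
  define bad where "bad = {t \<in> {\<alpha>..\<beta>}. \<forall>r>0. \<forall>K. \<exists>s\<in>{\<alpha>..\<beta>}. \<bar>s - t\<bar> < r \<and> f s > K}"
  have compact_bounded: "\<exists>K. \<forall>t\<in>{a..b}. f t \<le> K"
    if "\<alpha> \<le> a" "b \<le> \<beta>" "{a..b} \<inter> bad = {}" for a b
  proof -
    have "\<exists>r>0. \<exists>K. \<forall>s\<in>{\<alpha>..\<beta>}. \<bar>s - t\<bar> < r \<longrightarrow> f s \<le> K" if "t \<in> {a..b}" for t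
    proof -
      have "t \<in> {\<alpha>..\<beta>}" "t \<notin> bad"
        using that \<open>\<alpha> \<le> a\<close> \<open>b \<le> \<beta>\<close> \<open>{a..b} \<inter> bad = {}\<close> by auto
      then show ?thesis unfolding bad_def mem_Collect_eq by (meson not_less)
    qed
    then obtain r K where rK: "\<And>t. t \<in> {a..b} \<Longrightarrow> r t > 0"
      "\<And>t s. t \<in> {a..b} \<Longrightarrow> s \<in> {\<alpha>..\<beta>} \<Longrightarrow> \<bar>s - t\<bar> < r t \<Longrightarrow> f s \<le> K t"
      by metis
    have "{a..b} \<subseteq> (\<Union>t\<in>{a..b}. ball t (r t))" using rK(1) by force
    then obtain F where F: "F \<subseteq> {a..b}" "finite F" "{a..b} \<subseteq> (\<Union>t\<in>F. ball t (r t))"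
      using compactE_image[OF compact_Icc, of "{a..b}" "\<lambda>t. ball t (r t)" a b] by auto
    have "f t \<le> (\<Sum>u\<in>F. \<bar>K u\<bar>)" if t: "t \<in> {a..b}" for t
    proof -
      obtain u where u: "u \<in> F" "\<bar>t - u\<bar> < r u"
        using F(3) t by (auto simp: dist_real_def abs_minus_commute)
      then have "f t \<le> \<bar>K u\<bar>"
        using rK(2)[of u t] F(1) t that \<open>\<alpha> \<le> a\<close> \<open>b \<le> \<beta>\<close> by force
      also have "\<dots> \<le> (\<Sum>u\<in>F. \<bar>K u\<bar>)"
        using u(1) F(2) by (intro member_le_sum) auto
      finally show ?thesis .
    qed
    then show ?thesis by blast
  qed
  have "closed bad"
  proof -
    have "x \<in> bad" if x: "x \<in> closure bad" for x
    proof -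
      have xin: "x \<in> {\<alpha>..\<beta>}"
    proof -
      have "bad \<subseteq> {\<alpha>..\<beta>}" by (auto simp: bad_def)
      then show ?thesis using x closure_minimal[of bad "{\<alpha>..\<beta>}"] by blast
    qed
      have "\<exists>s\<in>{\<alpha>..\<beta>}. \<bar>s - x\<bar> < r \<and> f s > K" if "r > 0" for r K
      proof -
        obtain y where y: "y \<in> bad" "dist y x < r/2"
          using x \<open>r > 0\<close> unfolding closure_approachable by (meson half_gt_zero)
        then obtain s where "s\<in>{\<alpha>..\<beta>}" "\<bar>s - y\<bar> < r/2" "f s > K"
          using \<open>r > 0\<close> unfolding bad_def by (smt (verit) half_gt_zero mem_Collect_eq)
        moreover from this y have "\<bar>s - x\<bar> < r" unfolding dist_real_def by linarith
        ultimately show ?thesis by blast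
      qed
      then show ?thesis using xin unfolding bad_def by auto
    qed
    then show ?thesis using closure_subset_eq by blast
  qed
  have "bad = {}"
  proof (rule ccontr)
    assume "bad \<noteq> {}"
    define G where "G = (\<lambda>k::nat. {t \<in> bad. f t > real k})"
    have open_G: "openin (top_of_set bad) (G k)" for k
    proof -
      have "G k = bad - {t \<in> {\<alpha>..\<beta>}. f t \<le> real k}" unfolding G_def bad_def by auto
      then show ?thesis
        by (metis closed_sub open_Compl Diff_eq openin_open)
    qed
    have "(\<Inter>k. G k) = {}"
    proof -
      have "x \<notin> G (nat \<lceil>f x\<rceil>)" for x unfolding G_def by (auto simp: not_less real_nat_ceiling_ge)
      then show ?thesis by blast
    qed
    \<comment> \<open>The sets \<open>G k\<close> are relatively open in the closed set
      \<open>bad\<close> and have empty intersection, so they cannot all be dense in it. Near some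
      bad point, \<open>f\<close> is then at most \<open>k\<close> on the bad set.\<close>
    then have "\<exists>k. \<not> bad \<subseteq> closure (G k)"
      using Baire[OF \<open>closed bad\<close>, of "range G"] open_G \<open>bad \<noteq> {}\<close> by auto
    then obtain k x where x: "x \<in> bad" "x \<notin> closure (G k)" by auto
    then obtain r0 where r0: "r0 > 0" "\<And>y. y \<in> G k \<Longrightarrow> \<not> dist y x < r0"
      unfolding closure_approachable by auto
    \<comment> \<open>The window around \<open>x\<close> has length at most 2 r, hence at most
      \<delta>, so every gap inside it is short enough for \<open>gap\<close>.\<close>
    define r where "r = min r0 \<delta> / 4"
    have r: "r > 0" "r < r0" "2 * r \<le> \<delta>" using r0(1) \<open>\<delta> > 0\<close> by (auto simp: r_def)
    have fk: "f y \<le> real k" if "y \<in> bad" "\<bar>y - x\<bar> \<le> r" for y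
      using r0(2)[of y] that r unfolding G_def dist_real_def by force
    define lo hi where "lo = max \<alpha> (x - r)" and "hi = min \<beta> (x + r)"
    have xin: "x \<in> {\<alpha>..\<beta>}" using x(1) by (auto simp: bad_def)
    define S where "S = bad \<inter> {lo..hi}"
    have S: "compact S" "x \<in> S" "S \<noteq> {}"
      unfolding S_def using \<open>closed bad\<close> x xin r by (auto simp: lo_def hi_def intro: closed_Int_compact)
    have Sf: "f y \<le> real k" if "y \<in> S" for y
      using fk[of y] that by (auto simp: S_def lo_def hi_def abs_le_iff)
    have lo\<alpha>: "\<alpha> \<le> lo" "hi \<le> \<beta>" "lo \<le> x" "x \<le> hi" "hi - lo \<le> \<delta>"
      using xin r by (auto simp: lo_def hi_def)
    have free: "\<exists>K. \<forall>t\<in>{a..b}. f t \<le> K"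
      if "lo \<le> a" "a \<le> b" "b \<le> hi" "{a<..<b} \<inter> S = {}" for a b
    proof (cases "a = b")
      case True then show ?thesis by (intro exI[of _ "f a"]) auto
    next
      case False
      show ?thesis
      proof (rule extend)
        fix a' b' assume "a < a'" "a' \<le> b'" "b' < b"
        then have "{a'..b'} \<subseteq> {a<..<b} \<inter> {lo..hi}" using that by auto
        then have "{a'..b'} \<inter> bad = {}" using that(4) unfolding S_def by blast
        then show "\<exists>K. \<forall>t\<in>{a'..b'}. f t \<le> K"
          using that lo\<alpha> \<open>a < a'\<close> \<open>b' < b\<close> by (intro compact_bounded) auto
      qed (use that False lo\<alpha> in auto)
    qed
    obtain c where c: "c \<in> S" "\<And>y. y \<in> S \<Longrightarrow> c \<le> y"
      using compact_attains_inf[OF S(1,3)] by auto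
    obtain e where e: "e \<in> S" "\<And>y. y \<in> S \<Longrightarrow> y \<le> e"
      using compact_attains_sup[OF S(1,3)] by auto
    have ce: "lo \<le> c" "c \<le> x" "x \<le> e" "e \<le> hi" using c e S by (auto simp: S_def)
    obtain K1 where K1: "\<forall>t\<in>{lo..c}. f t \<le> K1"
      using free[of lo c] c ce lo\<alpha> by force
    obtain K2 where K2: "\<forall>t\<in>{e..hi}. f t \<le> K2"
      using free[of e hi] e ce lo\<alpha> by force
    \<comment> \<open>A time between \<open>c\<close> and \<open>e\<close> outside \<open>S\<close>
      lies in a gap whose end points belong to \<open>S\<close>; there \<open>f\<close> is at most
      \<open>k\<close>, so the same value \<open>\<Phi> (real k)\<close> serves for all
      gaps.\<close>
    have mid: "f t \<le> \<bar>\<Phi> (real k)\<bar> + real k" if t: "t \<in> {c..e}" for t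
    proof (cases "t \<in> S")
      case True then show ?thesis using Sf[OF True] by linarith
    next
      case False
      have cl: "compact (S \<inter> {..t})" "compact (S \<inter> {t..})"
        using S(1) by (auto intro: compact_Int_closed)
      obtain a where a: "a \<in> S" "a \<le> t" "\<And>y. y \<in> S \<Longrightarrow> y \<le> t \<Longrightarrow> y \<le> a"
        using compact_attains_sup[OF cl(1)] c t by fastforce
      obtain b where b: "b \<in> S" "t \<le> b" "\<And>y. y \<in> S \<Longrightarrow> t \<le> y \<Longrightarrow> b \<le> y"
        using compact_attains_inf[OF cl(2)] e t by fastforce
      have "{a<..<b} \<inter> S = {}" using a(3) b(3) by fastforce
      then have "\<exists>K. \<forall>t\<in>{a..b}. f t \<le> K"
        using a b by (intro free) (auto simp: S_def)
      then have "\<forall>t\<in>{a..b}. f t \<le> \<Phi> (real k)"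
        using a b lo\<alpha> by (intro gap Sf) (auto simp: S_def)
      then have "f t \<le> \<Phi> (real k)" using a(2) b(2) by simp
      then show ?thesis by linarith
    qed
    have "f t \<le> \<bar>K1\<bar> + \<bar>K2\<bar> + \<bar>\<Phi> (real k)\<bar> + real k" if tl: "t \<in> {lo..hi}" for t
    proof -
      consider "t \<in> {lo..c}" | "t \<in> {c..e}" | "t \<in> {e..hi}"
        using tl ce by (metis atLeastAtMost_iff linear)
      then show ?thesis using K1 K2 mid by cases fastforce+
    qed
    moreover obtain s where "s \<in> {\<alpha>..\<beta>}" "\<bar>s - x\<bar> < r"
        "f s > \<bar>K1\<bar> + \<bar>K2\<bar> + \<bar>\<Phi> (real k)\<bar> + real k"
      using x(1) r(1) unfolding bad_def by blast
    ultimately show False by (force simp: lo_def hi_def)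
  qed
  then show ?thesis using compact_bounded[of \<alpha> \<beta>] by auto
qed

section \<open>Taylor's formula for truncated square sums\<close>

lemma taylor2_bound:
  fixes y y' y'' :: "real \<Rightarrow> real"
  assumes "\<And>s. s \<in> {a..b} \<Longrightarrow> (y has_real_derivative y' s) (at s within {a..b})"
    and "\<And>s. s \<in> {a..b} \<Longrightarrow> (y' has_real_derivative y'' s) (at s within {a..b})"
    and "\<And>s. s \<in> {a..b} \<Longrightarrow> \<bar>y'' s\<bar> \<le> k"
    and "t \<in> {a..b}" "c \<in> {a..b}"
  shows "\<bar>y t - y c - (t - c) * y' c\<bar> \<le> k * (t - c)\<^sup>2"
proof -
  define g where "g = (\<lambda>i::nat. if i = 0 then y else if i = 1 then y' else y'')"
  have "norm (g 0 t - (\<Sum>i\<le>1. g i c * (t - c) ^ i / fact i)) \<le> k * norm (t - c) ^ Suc 1 / fact 1"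
  proof (rule field_Taylor)
    show "(g i has_real_derivative g (Suc i) x) (at x within {a..b})" if "x \<in> {a..b}" "i \<le> 1" for i x
      using that assms(1,2) by (cases i) (auto simp: g_def)
  qed (use assms in \<open>auto simp: g_def\<close>)
  moreover have "g 0 t - (\<Sum>i\<le>1. g i c * (t - c) ^ i / fact i) = y t - y c - (t - c) * y' c"
    by (simp add: g_def)
  ultimately show ?thesis by (simp add: power2_eq_square abs_mult)
qed

text \<open>Testing a vector against itself turns scalar estimates into norm estimates. It replaces
  vector-valued calculus throughout, since all derivatives are given componentwise.\<close>

lemma L2_set_leI:
  assumes "\<bar>\<Sum>j\<in>A. v j * v j\<bar> \<le> L2_set v A * K" "K \<ge> 0"
  shows "L2_set v A \<le> K"
proof (cases "L2_set v A = 0")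
  case False
  then have pos: "L2_set v A > 0" using L2_set_nonneg[of v A] by linarith
  have "L2_set v A * L2_set v A = (\<Sum>j\<in>A. v j * v j)"
    unfolding L2_set_def by (simp add: power2_eq_square sum_nonneg)
  then show ?thesis using assms pos by (metis abs_ge_self mult_le_cancel_left_pos order_trans)
qed (use assms in auto)

text \<open>The scalar formula is applied to the inner product of \<open>z s\<close> with the
  remainder at the fixed time \<open>t\<close>; that inner product at \<open>t\<close> reproduces
  the square of the remainder.\<close>

lemma L2_set_taylor2:
  fixes z w a :: "real \<Rightarrow> nat \<Rightarrow> real"
  assumes "\<And>j s. s \<in> {\<alpha>..\<beta>} \<Longrightarrow> ((\<lambda>s. z s j) has_real_derivative w s j) (at s within {\<alpha>..\<beta>})"
    and "\<And>j s. s \<in> {\<alpha>..\<beta>} \<Longrightarrow> ((\<lambda>s. w s j) has_real_derivative a s j) (at s within {\<alpha>..\<beta>})"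
    and k: "\<And>s. s \<in> {\<alpha>..\<beta>} \<Longrightarrow> L2_set (a s) {..<n} \<le> k"
    and t: "t \<in> {\<alpha>..\<beta>}" "c \<in> {\<alpha>..\<beta>}"
  shows "L2_set (\<lambda>j. z t j - z c j - (t - c) * w c j) {..<n::nat} \<le> k * (t - c)\<^sup>2"
proof (rule L2_set_leI)
  define v where "v = (\<lambda>j. z t j - z c j - (t - c) * w c j)"
  have "\<bar>(\<Sum>j<n. v j * z t j) - (\<Sum>j<n. v j * z c j) - (t - c) * (\<Sum>j<n. v j * w c j)\<bar>
      \<le> (L2_set v {..<n} * k) * (t - c)\<^sup>2"
  proof (rule taylor2_bound[where a=\<alpha> and b=\<beta>])
    show "((\<lambda>s. \<Sum>j<n. v j * z s j) has_real_derivative (\<Sum>j<n. v j * w s j)) (at s within {\<alpha>..\<beta>})"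
      if "s \<in> {\<alpha>..\<beta>}" for s
      using that by (intro DERIV_sum DERIV_cmult assms)
    show "((\<lambda>s. \<Sum>j<n. v j * w s j) has_real_derivative (\<Sum>j<n. v j * a s j)) (at s within {\<alpha>..\<beta>})"
      if "s \<in> {\<alpha>..\<beta>}" for s
      using that by (intro DERIV_sum DERIV_cmult assms)
    show "\<bar>\<Sum>j<n. v j * a s j\<bar> \<le> L2_set v {..<n} * k" if "s \<in> {\<alpha>..\<beta>}" for s
    proof -
      have "\<bar>\<Sum>j<n. v j * a s j\<bar> \<le> (\<Sum>j<n. \<bar>v j\<bar> * \<bar>a s j\<bar>)"
        by (rule order_trans[OF sum_abs]) (simp add: abs_mult)
      also have "\<dots> \<le> L2_set v {..<n} * L2_set (a s) {..<n}"
        by (rule L2_set_mult_ineq)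
      also have "\<dots> \<le> L2_set v {..<n} * k"
        by (intro mult_left_mono k that L2_set_nonneg)
      finally show ?thesis .
    qed
  qed (use t in auto)
  moreover have "(\<Sum>j<n. v j * z t j) - (\<Sum>j<n. v j * z c j) - (t - c) * (\<Sum>j<n. v j * w c j)
      = (\<Sum>j<n. v j * v j)"
    unfolding v_def sum_distrib_left sum_subtractf[symmetric] by (simp add: algebra_simps)
  ultimately show "\<bar>\<Sum>j<n. (z t j - z c j - (t - c) * w c j) * (z t j - z c j - (t - c) * w c j)\<bar>
      \<le> L2_set (\<lambda>j. z t j - z c j - (t - c) * w c j) {..<n} * (k * (t - c)\<^sup>2)"
    by (simp add: v_def mult.assoc)
  have "0 \<le> k" using k[OF t(1)] L2_set_nonneg[of "a t" "{..<n}"] by linarith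
  then show "0 \<le> k * (t - c)\<^sup>2" by simp
qed

lemma L2_set_le_hnorm: "finite_hnorm v \<Longrightarrow> L2_set v {..<n} \<le> hnorm 1 v"
  unfolding L2_set_def hnorm_def finite_hnorm_def by (auto intro: sum_le_suminf)

lemma hnorm_nonneg: "finite_hnorm v \<Longrightarrow> h \<ge> 0 \<Longrightarrow> hnorm h v \<ge> 0"
  unfolding hnorm_def finite_hnorm_def by (simp add: suminf_nonneg)

lemma hnorm_le_iff:
  assumes "finite_hnorm v" "K \<ge> 0"
  shows "hnorm 1 v \<le> K \<longleftrightarrow> (\<forall>n. L2_set v {..<n} \<le> K)"
proof
  assume *: "\<forall>n. L2_set v {..<n} \<le> K"
  have "(\<Sum>j. (v j)\<^sup>2) \<le> K\<^sup>2"
  proof (rule suminf_le_const)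
    show "(\<Sum>j<n. (v j)\<^sup>2) \<le> K\<^sup>2" for n
      using *[rule_format, of n] assms(2) unfolding L2_set_def by (simp add: real_sqrt_le_iff' sum_nonneg real_le_lsqrt sqrt_le_D)
  qed (use assms in \<open>auto simp: finite_hnorm_def\<close>)
  then show "hnorm 1 v \<le> K" using assms(2) unfolding hnorm_def by (simp add: real_le_lsqrt suminf_nonneg assms[unfolded finite_hnorm_def])
qed (use L2_set_le_hnorm[OF assms(1)] order_trans in blast)

lemma L2_set_scale: "L2_set (\<lambda>j. c * v j) A = \<bar>c\<bar> * L2_set v A"
  unfolding L2_set_def by (simp add: power_mult_distrib sum_distrib_left[symmetric] real_sqrt_mult)

text \<open>Square summability at each single time suffices: no uniformity in time is assumed. By Baire's
  theorem the norm is bounded on a portion of the set of bad times, and the equation propagates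
  bounds over the gaps of that set.\<close>

lemma pointwise_l2_imp_bounded:
  fixes z w a :: "real \<Rightarrow> nat \<Rightarrow> real"
  assumes z: "\<And>j s. s \<in> {\<alpha>..\<beta>} \<Longrightarrow> ((\<lambda>s. z s j) has_real_derivative w s j) (at s within {\<alpha>..\<beta>})"
    and w: "\<And>j s. s \<in> {\<alpha>..\<beta>} \<Longrightarrow> ((\<lambda>s. w s j) has_real_derivative a s j) (at s within {\<alpha>..\<beta>})"
    and fin: "\<And>s. s \<in> {\<alpha>..\<beta>} \<Longrightarrow> finite_hnorm (z s)"
    and a: "\<And>s n. s \<in> {\<alpha>..\<beta>} \<Longrightarrow> L2_set (a s) {..<n} \<le> L * hnorm 1 (z s) + R"
    and LR: "L > 0" "R \<ge> 0"
  shows "\<exists>K. \<forall>t\<in>{\<alpha>..\<beta>}. hnorm 1 (z t) \<le> K"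
proof -
  define f where "f = (\<lambda>t. hnorm 1 (z t))"
  \<comment> \<open>Over a time \<delta> the acceleration contributes at most a quarter of the
    supremum of the norm, which can then be absorbed on the left.\<close>
  define \<delta> where "\<delta> = min 1 (1 / (4 * L))"
  have \<delta>: "\<delta> > 0" "\<delta> \<le> 1" "4 * L * \<delta>\<^sup>2 \<le> 1"
  proof -
    have "0 < \<delta>" "\<delta> \<le> 1" using LR by (auto simp: \<delta>_def)
    then have "\<delta>\<^sup>2 \<le> \<delta>" by (simp add: power2_eq_square mult_left_le)
    then have "4 * L * \<delta>\<^sup>2 \<le> 4 * L * (1 / (4 * L))"
      using LR by (intro mult_left_mono) (auto simp: \<delta>_def)
    then show "4 * L * \<delta>\<^sup>2 \<le> 1" using LR by simp
  qed (use LR in \<open>auto simp: \<delta>_def\<close>)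
  have f0: "f s \<ge> 0" if "s \<in> {\<alpha>..\<beta>}" for s
    using hnorm_nonneg[OF fin[OF that]] by (simp add: f_def)
  have fL2: "L2_set (z s) {..<n} \<le> f s" if "s \<in> {\<alpha>..\<beta>}" for s n
    using L2_set_le_hnorm[OF fin[OF that]] by (simp add: f_def)
  have fI: "f s \<le> K" if "s \<in> {\<alpha>..\<beta>}" "\<And>n. L2_set (z s) {..<n} \<le> K" for s K
  proof -
    have "K \<ge> 0" using that(2)[of 0] by simp
    then show ?thesis using hnorm_le_iff[OF fin[OF that(1)]] that(2) by (simp add: f_def)
  qed
  have taylor: "L2_set (\<lambda>j. z t j - z c j - (t - c) * w c j) {..<n} \<le> (L * m + R) * (t - c)\<^sup>2"
    if "\<alpha> \<le> a1" "b1 \<le> \<beta>" "\<And>s. s \<in> {a1..b1} \<Longrightarrow> f s \<le> m" "t \<in> {a1..b1}" "c \<in> {a1..b1}" for a1 b1 m t c n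
  proof (rule L2_set_taylor2[where \<alpha>=a1 and \<beta>=b1])
    show "((\<lambda>s. z s j) has_real_derivative w s j) (at s within {a1..b1})" if "s \<in> {a1..b1}" for j s
      by (rule DERIV_subset[OF z]) (use \<open>\<alpha> \<le> a1\<close> \<open>b1 \<le> \<beta>\<close> that in auto)
    show "((\<lambda>s. w s j) has_real_derivative a s j) (at s within {a1..b1})" if "s \<in> {a1..b1}" for j s
      by (rule DERIV_subset[OF w]) (use \<open>\<alpha> \<le> a1\<close> \<open>b1 \<le> \<beta>\<close> that in auto)
    show "L2_set (a s) {..<n} \<le> L * m + R" if "s \<in> {a1..b1}" for s
    proof -
      have "L2_set (a s) {..<n} \<le> L * f s + R"
        using a[of s n] that \<open>\<alpha> \<le> a1\<close> \<open>b1 \<le> \<beta>\<close> by (simp add: f_def)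
      also have "\<dots> \<le> L * m + R"
        using LR \<open>\<And>s. s \<in> {a1..b1} \<Longrightarrow> f s \<le> m\<close>[OF that] by simp
      finally show ?thesis .
    qed
  qed (use that in auto)
  have "\<exists>K. \<forall>t\<in>{\<alpha>..\<beta>}. f t \<le> K"
  proof (rule baire_locally_bounded[OF \<delta>(1)])
    fix K
    \<comment> \<open>The norm is a supremum of truncated norms that are continuous in time, so it
      is lower semicontinuous; continuity itself is not known.\<close>
    have "{t \<in> {\<alpha>..\<beta>}. f t \<le> K} = (\<Inter>n. {t \<in> {\<alpha>..\<beta>}. L2_set (z t) {..<n} \<le> K})"
      using fL2 fI by (auto intro: order_trans)
    moreover have "closed {t \<in> {\<alpha>..\<beta>}. L2_set (z t) {..<n} \<le> K}" for n
    proof -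
      have "continuous_on {\<alpha>..\<beta>} (\<lambda>t. L2_set (z t) {..<n})"
        unfolding L2_set_def using z by (intro continuous_intros DERIV_continuous_on) auto
      then have "closed ({\<alpha>..\<beta>} \<inter> (\<lambda>t. L2_set (z t) {..<n}) -` {..K})"
        by (intro continuous_closed_preimage) auto
      then show ?thesis by (simp add: vimage_def Int_def)
    qed
    ultimately show "closed {t \<in> {\<alpha>..\<beta>}. f t \<le> K}" by (metis (no_types, lifting) closed_INT)
  next
    fix a1 b1 K assume ab: "\<alpha> \<le> a1" "a1 \<le> b1" "b1 \<le> \<beta>" "b1 - a1 \<le> \<delta>"
      and bd: "\<exists>K'. \<forall>t\<in>{a1..b1}. f t \<le> K'" and K: "f a1 \<le> K" "f b1 \<le> K"
    show "\<forall>t\<in>{a1..b1}. f t \<le> 2 * K + 2 * R"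
    proof (cases "a1 = b1")
      case True
      then show ?thesis using K f0[of a1] ab LR by auto
    next
      case False
      with ab have "a1 < b1" by simp
      define m where "m = Sup (f ` {a1..b1})"
      have bdd: "bdd_above (f ` {a1..b1})" using bd by (auto simp: bdd_above_def)
      have m: "f s \<le> m" if "s \<in> {a1..b1}" for s
        unfolding m_def using that bdd by (intro cSUP_upper) auto
      have m0: "m \<ge> 0" using m[of a1] f0[of a1] ab by auto
      have "f t \<le> K + (L * m + R) * \<delta>\<^sup>2" if t: "t \<in> {a1..b1}" for t
      proof (rule fI)
        fix n
        define l1 l2 where "l1 = (b1 - t) / (b1 - a1)" and "l2 = (t - a1) / (b1 - a1)"
        have lam: "l1 \<ge> 0" "l2 \<ge> 0" "l1 + l2 = 1" "l1 * (a1 - t) + l2 * (b1 - t) = 0"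
          using t \<open>a1 < b1\<close> by (auto simp: l1_def l2_def divide_simps) (auto simp: algebra_simps)
        define \<rho> where "\<rho> = (\<lambda>e j. z e j - z t j - (e - t) * w t j)"
        have \<rho>: "L2_set (\<rho> e) {..<n} \<le> (L * m + R) * \<delta>\<^sup>2" if e: "e \<in> {a1..b1}" for e
        proof -
          have "L2_set (\<rho> e) {..<n} \<le> (L * m + R) * (e - t)\<^sup>2"
            unfolding \<rho>_def using ab m t e by (intro taylor) auto
          also have "\<dots> \<le> (L * m + R) * \<delta>\<^sup>2"
            using e t ab LR m0 by (intro mult_left_mono power2_le_iff_abs_le[THEN iffD2]) auto
          finally show ?thesis .
        qed
        \<comment> \<open>The convex combination of the expansions at both ends is chosen so that
          the velocity at \<open>t\<close> drops out. No bound on the velocity is available.\<close>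
        have zt: "z t j = l1 * z a1 j + l2 * z b1 j + (- l1 * \<rho> a1 j + - l2 * \<rho> b1 j)" for j
        proof -
          have "l1 * z a1 j + l2 * z b1 j + (- l1 * \<rho> a1 j + - l2 * \<rho> b1 j)
            = (l1 + l2) * z t j + (l1 * (a1 - t) + l2 * (b1 - t)) * w t j"
            by (simp add: \<rho>_def algebra_simps)
          then show ?thesis using lam by simp
        qed
        have "L2_set (z t) {..<n} \<le> (l1 * L2_set (z a1) {..<n} + l2 * L2_set (z b1) {..<n})
          + (l1 * L2_set (\<rho> a1) {..<n} + l2 * L2_set (\<rho> b1) {..<n})"
        proof -
          have "L2_set (z t) {..<n} = L2_set (\<lambda>j. (l1 * z a1 j + l2 * z b1 j) + (- l1 * \<rho> a1 j + - l2 * \<rho> b1 j)) {..<n}"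
            by (rule L2_set_cong[OF refl zt])
          also have "\<dots> \<le> (L2_set (\<lambda>j. l1 * z a1 j) {..<n} + L2_set (\<lambda>j. l2 * z b1 j) {..<n})
             + (L2_set (\<lambda>j. - l1 * \<rho> a1 j) {..<n} + L2_set (\<lambda>j. - l2 * \<rho> b1 j) {..<n})"
            by (intro order_trans[OF L2_set_triangle_ineq] add_mono L2_set_triangle_ineq)
          finally show ?thesis unfolding L2_set_scale using lam by simp
        qed
        also have "\<dots> \<le> (l1 * K + l2 * K) + (l1 * ((L * m + R) * \<delta>\<^sup>2) + l2 * ((L * m + R) * \<delta>\<^sup>2))"
          using lam ab K \<rho> fL2[of a1 n] fL2[of b1 n] by (intro add_mono mult_left_mono) (auto intro: order_trans)
        also have "\<dots> = (l1 + l2) * (K + (L * m + R) * \<delta>\<^sup>2)" by (simp add: algebra_simps)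
        finally show "L2_set (z t) {..<n} \<le> K + (L * m + R) * \<delta>\<^sup>2" using lam by simp
      qed (use ab t in auto)
      then have "m \<le> K + (L * m + R) * \<delta>\<^sup>2"
        using ab by (subst m_def) (intro cSUP_least, auto)
      \<comment> \<open>The absorption of m / 4 is legitimate because \<open>m\<close> is finite by
        \<open>bd\<close>; the resulting bound no longer depends on how large the bound in
        \<open>bd\<close> was.\<close>
      also have "\<dots> \<le> K + m / 4 + R"
      proof -
        have "(L * m) * \<delta>\<^sup>2 \<le> m / 4" using mult_right_mono[OF \<delta>(3) m0] by (simp add: algebra_simps)
        moreover have "R * \<delta>\<^sup>2 \<le> R" using \<delta> LR by (simp add: mult_left_le power_le_one)
        ultimately show ?thesis by (simp add: algebra_simps)
      qed
      finally have "m \<le> 2 * K + 2 * R" using LR m0 K f0[of a1] ab by simp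
      then show ?thesis using m by force
    qed
  next
    fix a1 b1 assume ab: "\<alpha> \<le> a1" "a1 < b1" "b1 \<le> \<beta>"
      and bd: "\<And>a' b'. a1 < a' \<Longrightarrow> a' \<le> b' \<Longrightarrow> b' < b1 \<Longrightarrow> \<exists>K. \<forall>t\<in>{a'..b'}. f t \<le> K"
    define r where "r = min \<delta> ((b1 - a1) / 4)"
    have "r \<le> (b1 - a1) / 4" unfolding r_def by (rule min.cobounded2)
    then have "4 * r \<le> b1 - a1" by (simp add: field_simps)
    moreover have "r > 0" "r \<le> \<delta>" using \<delta> ab by (auto simp: r_def)
    ultimately have r: "r > 0" "r \<le> \<delta>" "4 * r \<le> b1 - a1" by auto
    \<comment> \<open>Near an end of the open interval the solution is extrapolated linearly from
      two inner times \<open>c\<close> and \<open>e\<close>. The velocity at \<open>c\<close> is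
      eliminated between two expansions, and as \<open>t\<close> is no farther from \<open>c\<close>
      than \<open>e\<close> is, the factor \<open>q\<close> is at most 1 in modulus. The result
      depends on the norm between \<open>c\<close> and \<open>e\<close> only and is uniform up to
      the end point.\<close>
    have extrapolate: "\<exists>K. \<forall>t\<in>S. f t \<le> K"
      if ce: "a1 < c" "c < b1" "a1 < e" "e < b1" "\<bar>c - e\<bar> = r"
        and S: "\<And>t. t \<in> S \<Longrightarrow> a1 < t \<and> t < b1 \<and> \<bar>t - c\<bar> \<le> r" for S c e
    proof -
      obtain m0 where m0: "\<And>s. s \<in> {min c e..max c e} \<Longrightarrow> f s \<le> m0"
      proof -
        have "a1 < min c e" "min c e \<le> max c e" "max c e < b1" using ce by auto
        from bd[OF this] show ?thesis using that by blast
      qed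
      have m00: "m0 \<ge> 0" using m0[of c] f0[of c] ab ce by auto
      have "f t \<le> 8 * m0 + 4 * R" if tS: "t \<in> S" for t
      proof -
        define lo hi where "lo = min t (min c e)" and "hi = max t (max c e)"
        have lohi: "a1 < lo" "lo \<le> hi" "hi < b1" "t \<in> {lo..hi}" "c \<in> {lo..hi}" "e \<in> {lo..hi}"
          using S[OF tS] ce by (auto simp: lo_def hi_def)
        have bdl: "bdd_above (f ` {lo..hi})"
          using bd[of lo hi] lohi by (auto simp: bdd_above_def)
        define m where "m = Sup (f ` {lo..hi})"
        have m: "f s \<le> m" if "s \<in> {lo..hi}" for s
          unfolding m_def using that bdl by (intro cSUP_upper) auto
        have m_0: "m \<ge> 0" using m[of c] f0[of c] ab ce lohi by auto
        have bnd: "f s \<le> 3 * m0 + 2 * ((L * m + R) * \<delta>\<^sup>2)" if s: "s \<in> {lo..hi}" for s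
        proof (cases "s \<in> {min c e..max c e}")
          case True
          then show ?thesis using m0[of s] m00 m_0 LR \<delta> by (auto intro: add_increasing2)
        next
          case False
          with s S[OF tS] ce have sc: "\<bar>s - c\<bar> \<le> r" by (auto simp: lo_def hi_def)
          show ?thesis
          proof (rule fI)
            fix n
            define \<rho> where "\<rho> = (\<lambda>x j. z x j - z c j - (x - c) * w c j)"
            have \<rho>: "L2_set (\<rho> x) {..<n} \<le> (L * m + R) * \<delta>\<^sup>2" if x: "x \<in> {lo..hi}" "\<bar>x - c\<bar> \<le> r" for x
            proof -
              have "L2_set (\<rho> x) {..<n} \<le> (L * m + R) * (x - c)\<^sup>2"
                unfolding \<rho>_def using ab m x lohi by (intro taylor[of lo hi]) auto
              also have "\<dots> \<le> (L * m + R) * \<delta>\<^sup>2"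
                using x r LR m_0 \<delta> by (intro mult_left_mono power2_le_iff_abs_le[THEN iffD2]) auto
              finally show ?thesis .
            qed
            define q where "q = (s - c) / (e - c)"
            have ec: "e - c \<noteq> 0" "\<bar>e - c\<bar> = r" using ce r by auto
            have q: "\<bar>q\<bar> \<le> 1" using sc ec r by (simp add: q_def divide_le_eq_1)
            have zs: "z s j = z c j + (q * z e j + - q * z c j) + (- q * \<rho> e j + \<rho> s j)" for j
            proof -
              have "q * (e - c) = s - c" using ec by (simp add: q_def)
              then have "q * (e - c) * w c j = (s - c) * w c j" by simp
              then show ?thesis by (simp add: \<rho>_def algebra_simps)
            qed
            have "L2_set (z s) {..<n} = L2_set (\<lambda>j. (z c j + (q * z e j + - q * z c j)) + (- q * \<rho> e j + \<rho> s j)) {..<n}"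
              by (rule L2_set_cong[OF refl zs])
            also have "\<dots> \<le> (L2_set (z c) {..<n} + (L2_set (\<lambda>j. q * z e j) {..<n} + L2_set (\<lambda>j. - q * z c j) {..<n}))
               + (L2_set (\<lambda>j. - q * \<rho> e j) {..<n} + L2_set (\<rho> s) {..<n})"
              by (intro order_trans[OF L2_set_triangle_ineq] add_mono order_refl)
            also have "\<dots> \<le> (m0 + (m0 + m0)) + ((L * m + R) * \<delta>\<^sup>2 + (L * m + R) * \<delta>\<^sup>2)"
            proof -
              have c1: "L2_set (z x) {..<n} \<le> m0" if "x = c \<or> x = e" for x
                using fL2[of x n] m0[of x] that ce ab by auto
              have c2: "\<bar>q\<bar> * x \<le> y" if "0 \<le> x" "x \<le> y" for x y
                using q that mult_left_le_one_le[of x "\<bar>q\<bar>"] by linarith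
              show ?thesis unfolding L2_set_scale abs_minus_cancel
                using \<rho>[of e] \<rho>[of s] s sc ec lohi c1
                by (intro add_mono c2 L2_set_nonneg) auto
            qed
            finally show "L2_set (z s) {..<n} \<le> 3 * m0 + 2 * ((L * m + R) * \<delta>\<^sup>2)" by simp
          qed (use s lohi ab in auto)
        qed
        have "m \<le> 3 * m0 + 2 * ((L * m + R) * \<delta>\<^sup>2)"
          using lohi bnd by (subst m_def) (intro cSUP_least, auto)
        also have "\<dots> \<le> 3 * m0 + m / 2 + 2 * R"
        proof -
          have "(L * m) * \<delta>\<^sup>2 \<le> m / 4" using mult_right_mono[OF \<delta>(3) m_0] by (simp add: algebra_simps)
          moreover have "R * \<delta>\<^sup>2 \<le> R" using \<delta> LR by (simp add: mult_left_le power_le_one)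
          ultimately show ?thesis by (simp add: algebra_simps)
        qed
        finally have "m \<le> 6 * m0 + 4 * R" by simp
        then show ?thesis using m[of t] lohi m00 by linarith
      qed
      then show ?thesis by blast
    qed
    obtain K1 where K1: "\<And>t. t \<in> {a1<..a1 + r} \<Longrightarrow> f t \<le> K1"
    proof -
      have "\<exists>K. \<forall>t\<in>{a1<..a1 + r}. f t \<le> K"
        by (rule extrapolate[of "a1 + r" "a1 + 2 * r"]) (use r in auto)
      then show ?thesis using that by blast
    qed
    obtain K2 where K2: "\<And>t. t \<in> {b1 - r..<b1} \<Longrightarrow> f t \<le> K2"
    proof -
      have "\<exists>K. \<forall>t\<in>{b1 - r..<b1}. f t \<le> K"
        by (rule extrapolate[of "b1 - r" "b1 - 2 * r"]) (use r in auto)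
      then show ?thesis using that by blast
    qed
    obtain K3 where K3: "\<And>t. t \<in> {a1 + r..b1 - r} \<Longrightarrow> f t \<le> K3"
    proof -
      have "\<exists>K. \<forall>t\<in>{a1 + r..b1 - r}. f t \<le> K" by (rule bd) (use r in auto)
      then show ?thesis using that by blast
    qed
    have "f t \<le> Max {f a1, f b1, K1, K2, K3}" if tl: "t \<in> {a1..b1}" for t
    proof -
      consider "t = a1" | "t = b1" | "t \<in> {a1<..a1 + r}" | "t \<in> {b1 - r..<b1}" | "t \<in> {a1 + r..b1 - r}"
        using tl r by (metis atLeastAtMost_iff atLeastLessThan_iff greaterThanAtMost_iff linorder_le_less_linear order_le_less)
      then show ?thesis by cases (auto simp: le_max_iff_disj K1 K2 K3)
    qed
    then show "\<exists>K. \<forall>t\<in>{a1..b1}. f t \<le> K" by blast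
  qed
  then show ?thesis by (simp add: f_def)
qed

subsection \<open>Banded forms and the energy estimate\<close>

definition diff :: "(nat \<Rightarrow> real) \<Rightarrow> nat \<Rightarrow> real" where
  "diff u j = u (Suc j) - u j"

lemma L2_set_mono_lessThan: "a \<le> b \<Longrightarrow> L2_set x {..<a} \<le> L2_set x {..<b::nat}"
  unfolding L2_set_def by (intro real_sqrt_le_mono sum_mono2) auto

lemma L2_set_diff_le: "L2_set (diff u) {..<n} \<le> 2 * L2_set u {..<Suc n}"
proof -
  have "L2_set (diff u) {..<n} \<le> L2_set (\<lambda>j. u (Suc j)) {..<n} + L2_set (\<lambda>j. - u j) {..<n}"
    unfolding diff_def using L2_set_triangle_ineq[of "\<lambda>j. u (Suc j)" "\<lambda>j. - u j" "{..<n}"] by simp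
  also have "L2_set (\<lambda>j. - u j) {..<n} = L2_set u {..<n}" by (simp add: L2_set_def)
  also have "L2_set (\<lambda>j. u (Suc j)) {..<n} \<le> L2_set u {..<Suc n}"
    unfolding L2_set_def by (intro real_sqrt_le_mono) (simp add: sum.lessThan_Suc_shift del: sum.lessThan_Suc)
  also have "L2_set u {..<n} \<le> L2_set u {..<Suc n}" by (rule L2_set_mono_lessThan) simp
  finally show ?thesis by simp
qed

section \<open>Symmetric banded forms\<close>

text \<open>The matrix \<open>N\<close> is the middle factor of \<open>M\<close>,
  \<open>\<omega>\<close> is the diagonal of \<open>H\<close> for unit mesh size, and
  \<open>d\<close> is the diagonal scaling. The band width comes from the 5 by 5 corner block for p
  = 3. The decay of \<open>d\<close> is what makes the correctors decay.\<close>

locale banded_form =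
  fixes N :: "nat \<Rightarrow> nat \<Rightarrow> real" and \<omega> d :: "nat \<Rightarrow> real"
  assumes sym: "N i k = N k i"
    and band: "i + 5 \<le> k \<Longrightarrow> N i k = 0"
    and bound: "\<bar>N i k\<bar> \<le> 3"
    and weight_ge: "1/4 \<le> \<omega> j" and weight_le: "\<omega> j \<le> 2"
    and d_pos: "d j > 0"
    and d_decay: "d j \<le> 16 * (1/2) ^ j"
    and dominant: "(\<Sum>k\<in>{..<i+5} - {i}. \<bar>N i k\<bar> * d k) \<le> (N i i - 1/50) * d i"
begin

text \<open>The cut at i + 5 loses nothing: by \<open>band\<close> the sum contains every nonzero
  entry of row \<open>i\<close>, so that no series are needed.\<close>

definition op :: "(nat \<Rightarrow> real) \<Rightarrow> nat \<Rightarrow> real" where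
  "op x i = (\<Sum>k<i+5. N i k * x k)"

text \<open>This is the transposed forward difference of \<open>N\<close> applied to the forward
  difference. There is no difference to the left of index 0, which is the discrete Neumann
  condition.\<close>

definition M :: "(nat \<Rightarrow> real) \<Rightarrow> nat \<Rightarrow> real" where
  "M u j = (if j = 0 then 0 else op (diff u) (j - 1)) - op (diff u) j"

definition q :: "nat \<Rightarrow> (nat \<Rightarrow> real) \<Rightarrow> (nat \<Rightarrow> real) \<Rightarrow> real" where
  "q n x y = (\<Sum>i<n. \<Sum>k<n. N i k * x i * y k)"

lemma nonzero_imp_near: "N i k \<noteq> 0 \<Longrightarrow> k < i + 5 \<and> i < k + 5"
  using band[of i k] band[of k i] sym[of i k] by (metis not_le)

lemma band': "i + 5 \<le> k \<Longrightarrow> N k i = 0"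
  using band[of i k] sym[of i k] by simp

lemma q_sym: "q n x y = q n y x"
  unfolding q_def by (subst sum.swap) (simp add: sym mult.commute mult.left_commute)

text \<open>The product of two entries is split by Young's inequality with weights d k / d i and d i
  / d k. By symmetry both halves collect the same weighted row sums, which \<open>dominant\<close>
  bounds by the diagonal minus 1/50. Every truncation inherits the bound with the same
  constant.\<close>

lemma q_ge: "q n x x \<ge> 1/50 * (\<Sum>i<n. (x i)\<^sup>2)"
proof -
  define off where "off = (\<lambda>i k. if i = k then 0 else \<bar>N i k\<bar>)"
  have off_sym: "off i k = off k i" for i k by (simp add: off_def sym)
  have off0: "off i k \<ge> 0" for i k by (simp add: off_def)
  have dom: "(\<Sum>k<n. off i k * d k) \<le> (N i i - 1/50) * d i" for i
  proof -
    have "(\<Sum>k<n. off i k * d k) \<le> (\<Sum>k<max n (i+5). off i k * d k)"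
      by (intro sum_mono2 mult_nonneg_nonneg off0 less_imp_le[OF d_pos]) auto
    also have "\<dots> = (\<Sum>k\<in>{..<i+5} - {i}. \<bar>N i k\<bar> * d k)"
      by (rule sum.mono_neutral_cong_right) (auto simp: off_def dest: nonzero_imp_near)
    also have "\<dots> \<le> (N i i - 1/50) * d i" by (rule dominant)
    finally show ?thesis .
  qed
  have young: "\<bar>x i * x k\<bar> \<le> (d k / d i * (x i)\<^sup>2 + d i / d k * (x k)\<^sup>2) / 2" for i k
  proof -
    have "0 \<le> (d k * \<bar>x i\<bar> - d i * \<bar>x k\<bar>)\<^sup>2 / (d i * d k)"
      using d_pos by (simp add: less_imp_le)
    also have "\<dots> = d k / d i * (x i)\<^sup>2 + d i / d k * (x k)\<^sup>2 - 2 * \<bar>x i * x k\<bar>"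
      using d_pos[of i] d_pos[of k] by (simp add: field_simps power2_eq_square abs_mult)
    finally show ?thesis by simp
  qed
  have "(\<Sum>i<n. \<Sum>k<n. off i k * \<bar>x i * x k\<bar>) \<le>
      (\<Sum>i<n. \<Sum>k<n. off i k * ((d k / d i * (x i)\<^sup>2 + d i / d k * (x k)\<^sup>2) / 2))"
    by (intro sum_mono mult_left_mono young off0)
  also have "\<dots> = (\<Sum>i<n. \<Sum>k<n. off i k * (d k / d i * (x i)\<^sup>2)) / 2 +
      (\<Sum>i<n. \<Sum>k<n. off i k * (d i / d k * (x k)\<^sup>2)) / 2"
    by (simp add: sum_divide_distrib sum.distrib[symmetric] algebra_simps add_divide_distrib)
  also have "(\<Sum>i<n. \<Sum>k<n. off i k * (d i / d k * (x k)\<^sup>2)) =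
      (\<Sum>i<n. \<Sum>k<n. off i k * (d k / d i * (x i)\<^sup>2))"
    by (subst sum.swap) (simp add: off_sym)
  also have "(\<Sum>i<n. \<Sum>k<n. off i k * (d k / d i * (x i)\<^sup>2)) / 2 +
      (\<Sum>i<n. \<Sum>k<n. off i k * (d k / d i * (x i)\<^sup>2)) / 2 =
      (\<Sum>i<n. (\<Sum>k<n. off i k * d k) * ((x i)\<^sup>2 / d i))"
    by (simp add: sum_distrib_right sum_distrib_left mult_ac)
  also have "\<dots> \<le> (\<Sum>i<n. ((N i i - 1/50) * d i) * ((x i)\<^sup>2 / d i))"
    by (intro sum_mono mult_right_mono dom divide_nonneg_pos d_pos) auto
  also have "\<dots> = (\<Sum>i<n. (N i i - 1/50) * (x i)\<^sup>2)"
    using d_pos by (intro sum.cong refl) (simp add: less_imp_neq[symmetric])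
  finally have 1: "(\<Sum>i<n. \<Sum>k<n. off i k * \<bar>x i * x k\<bar>) \<le> (\<Sum>i<n. (N i i - 1/50) * (x i)\<^sup>2)" .
  have "(\<Sum>i<n. N i i * (x i)\<^sup>2) - (\<Sum>i<n. \<Sum>k<n. off i k * \<bar>x i * x k\<bar>)
      = (\<Sum>i<n. \<Sum>k<n. (if i = k then N i i * (x i)\<^sup>2 else 0) - off i k * \<bar>x i * x k\<bar>)"
    by (simp add: sum_subtractf)
  also have "\<dots> \<le> q n x x"
    unfolding q_def
  proof (intro sum_mono)
    fix i k
    show "(if i = k then N i i * (x i)\<^sup>2 else 0) - off i k * \<bar>x i * x k\<bar> \<le> N i k * x i * x k"
      using abs_ge_minus_self[of "N i k * (x i * x k)"]
      by (auto simp: off_def abs_mult power2_eq_square mult_ac)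
  qed
  finally have "(\<Sum>i<n. N i i * (x i)\<^sup>2) - (\<Sum>i<n. (N i i - 1/50) * (x i)\<^sup>2) \<le> q n x x"
    using 1 by linarith
  then show ?thesis
    by (simp add: sum_subtractf[symmetric] algebra_simps sum_distrib_left)
qed

lemma M_by_parts:
  "(\<Sum>j<Suc n. u j * M v j) = (\<Sum>i<Suc n. diff u i * op (diff v) i) - u (Suc n) * op (diff v) n"
proof (induction n)
  case 0 show ?case by (simp add: M_def diff_def[of u] algebra_simps)
next
  case (Suc n)
  have "(\<Sum>j<Suc (Suc n). u j * M v j) = (\<Sum>j<Suc n. u j * M v j) + u (Suc n) * M v (Suc n)" by simp
  also have "\<dots> = (\<Sum>i<Suc n. diff u i * op (diff v) i) - u (Suc n) * op (diff v) n
       + u (Suc n) * (op (diff v) n - op (diff v) (Suc n))"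
    unfolding Suc by (simp add: M_def)
  also have "\<dots> = (\<Sum>i<Suc (Suc n). diff u i * op (diff v) i) - u (Suc (Suc n)) * op (diff v) (Suc n)"
    by (simp add: diff_def[of u] algebra_simps)
  finally show ?case .
qed

lemma op_split:
  assumes "i < n"
  shows "op y i = (\<Sum>k<n. N i k * y k) + (\<Sum>k\<in>{n..<i+5}. N i k * y k)"
proof (cases "n \<le> i + 5")
  case True
  have split: "{..<i+5} = {..<n} \<union> {n..<i+5}" using True by auto
  show ?thesis unfolding op_def by (subst split, rule sum.union_disjoint) auto
next
  case False
  have "(\<Sum>k<n. N i k * y k) = (\<Sum>k<i+5. N i k * y k)"
    using False by (intro sum.mono_neutral_right) (auto simp: band)
  then show ?thesis using False by (simp add: op_def)
qed

text \<open>The window n - 5, ..., n + 6 contains all grid values that meet the cut at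
  \<open>n\<close>, by band width and differences.\<close>

definition local_size :: "nat \<Rightarrow> (nat \<Rightarrow> real) \<Rightarrow> (nat \<Rightarrow> real) \<Rightarrow> real" where
  "local_size n u v = (\<Sum>i<12. (u (n - 5 + i))\<^sup>2 + (v (n - 5 + i))\<^sup>2)"

text \<open>Stopping the sum at \<open>n\<close> leaves the boundary term of the summation by parts
  and the entries of \<open>N\<close> that couple rows up to \<open>n\<close> with columns beyond.
  The former involves nine entries and costs 54; the latter comes from four rows with at most four
  entries each and costs 192.\<close>

lemma flux_bound:
  assumes "n \<ge> 5"
  shows "\<bar>(\<Sum>j<Suc n. u j * M v j) - q (Suc n) (diff u) (diff v)\<bar> \<le> 250 * local_size n u v"
proof -
  define S where "S = local_size n u v"
  define s where "s = sqrt S"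
  have S0: "S \<ge> 0" unfolding S_def local_size_def by (intro sum_nonneg) auto
  have s0: "s \<ge> 0" "s * s = S" using S0 by (auto simp: s_def)
  have uv: "\<bar>u a\<bar> \<le> s \<and> \<bar>v a\<bar> \<le> s" if "a \<ge> n - 5" "a \<le> n + 6" for a
  proof -
    have "(u a)\<^sup>2 + (v a)\<^sup>2 \<le> S"
      unfolding S_def local_size_def using assms that
      by (intro order_trans[OF _ member_le_sum[of "a - (n - 5)"]]) auto
    then have "(u a)\<^sup>2 \<le> S" "(v a)\<^sup>2 \<le> S" by (smt (verit) zero_le_power2)+
    then show ?thesis unfolding s_def by (metis real_sqrt_abs real_sqrt_le_iff)
  qed
  have duv: "\<bar>diff u a\<bar> \<le> 2 * s" "\<bar>diff v a\<bar> \<le> 2 * s" if "a \<ge> n - 5" "a \<le> n + 5" for a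
    using uv[of a] uv[of "Suc a"] that unfolding diff_def by auto
  define e where "e = (\<lambda>i. \<Sum>k\<in>{Suc n..<i+5}. N i k * diff v k)"
  have e: "\<bar>e i\<bar> \<le> 24 * s" if "i \<le> n" for i
  proof -
    have "\<bar>e i\<bar> \<le> (\<Sum>k\<in>{Suc n..<i+5}. \<bar>N i k * diff v k\<bar>)" unfolding e_def by (rule sum_abs)
    also have "\<dots> \<le> (\<Sum>k\<in>{Suc n..<i+5}. 6 * s)"
    proof (rule sum_mono)
      fix k assume "k \<in> {Suc n..<i+5}"
      then have "\<bar>N i k\<bar> * \<bar>diff v k\<bar> \<le> 3 * (2 * s)"
        using that s0 by (intro mult_mono bound duv) auto
      then show "\<bar>N i k * diff v k\<bar> \<le> 6 * s" by (simp add: abs_mult)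
    qed
    also have "\<dots> = real (i + 5 - Suc n) * (6 * s)" by simp
    also have "\<dots> \<le> 4 * (6 * s)" using that s0 by (intro mult_right_mono) auto
    finally show ?thesis by simp
  qed
  have opn: "\<bar>op (diff v) n\<bar> \<le> 54 * s"
  proof -
    have "op (diff v) n = (\<Sum>k\<in>{n-4..<n+5}. N n k * diff v k)"
      unfolding op_def by (intro sum.mono_neutral_right) (auto intro!: band')
    also have "\<bar>\<dots>\<bar> \<le> (\<Sum>k\<in>{n-4..<n+5}. \<bar>N n k * diff v k\<bar>)" by (rule sum_abs)
    also have "\<dots> \<le> (\<Sum>k\<in>{n-4..<n+5}. 6 * s)"
    proof (rule sum_mono)
      fix k assume "k \<in> {n-4..<n+5}"
      then have "\<bar>N n k\<bar> * \<bar>diff v k\<bar> \<le> 3 * (2 * s)"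
        using s0 by (intro mult_mono bound duv) auto
      then show "\<bar>N n k * diff v k\<bar> \<le> 6 * s" by (simp add: abs_mult)
    qed
    also have "\<dots> = 54 * s" using assms by (simp add: of_nat_diff)
    finally show ?thesis .
  qed
  have "(\<Sum>i<Suc n. diff u i * op (diff v) i) = q (Suc n) (diff u) (diff v) + (\<Sum>i<Suc n. diff u i * e i)"
    unfolding q_def e_def sum.distrib[symmetric]
    by (intro sum.cong refl, subst op_split[of _ "Suc n"])
       (auto simp: sum_distrib_left algebra_simps)
  then have eq: "(\<Sum>j<Suc n. u j * M v j) - q (Suc n) (diff u) (diff v)
      = (\<Sum>i<Suc n. diff u i * e i) - u (Suc n) * op (diff v) n"
    using M_by_parts by simp
  have "(\<Sum>i<Suc n. diff u i * e i) = (\<Sum>i\<in>{n-3..n}. diff u i * e i)"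
    using assms by (intro sum.mono_neutral_right) (auto simp: e_def)
  also have "\<bar>\<dots>\<bar> \<le> (\<Sum>i\<in>{n-3..n}. \<bar>diff u i * e i\<bar>)" by (rule sum_abs)
  also have "\<dots> \<le> (\<Sum>i\<in>{n-3..n}. 2 * s * (24 * s))"
    unfolding abs_mult using s0 by (intro sum_mono mult_mono duv e) auto
  also have "\<dots> = 192 * S" using assms s0 by (simp add: of_nat_diff mult.assoc)
  finally have b1: "\<bar>\<Sum>i<Suc n. diff u i * e i\<bar> \<le> 192 * S" .
  have "\<bar>u (Suc n) * op (diff v) n\<bar> \<le> s * (54 * s)"
    unfolding abs_mult using uv[of "Suc n"] s0 opn by (intro mult_mono) auto
  also have "\<dots> = 54 * S" using s0 by simp
  finally have b2: "\<bar>u (Suc n) * op (diff v) n\<bar> \<le> 54 * S" .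
  show ?thesis unfolding eq S_def[symmetric] using b1 b2 S0 by linarith
qed

lemma op_has_derivative:
  assumes "\<And>j. ((\<lambda>s. v s j) has_real_derivative v' j) (at x within A)"
  shows "((\<lambda>s. op (diff (v s)) i) has_real_derivative op (diff v') i) (at x within A)"
  unfolding op_def diff_def by (intro DERIV_sum DERIV_cmult DERIV_diff assms)

lemma M_has_derivative:
  assumes "\<And>j. ((\<lambda>s. v s j) has_real_derivative v' j) (at x within A)"
  shows "((\<lambda>s. M (v s) i) has_real_derivative M v' i) (at x within A)"
  unfolding M_def by (cases "i = 0") (auto intro!: DERIV_diff op_has_derivative assms DERIV_minus)

lemma q_has_derivative:
  assumes "\<And>j. ((\<lambda>s. v s j) has_real_derivative v' s0 j) (at s0 within A)"
  shows "((\<lambda>s. q n (diff (v s)) (diff (v s))) has_real_derivative 2 * q n (diff (v' s0)) (diff (v s0))) (at s0 within A)"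
proof -
  have "((\<lambda>s. q n (diff (v s)) (diff (v s))) has_real_derivative
     (\<Sum>i<n. \<Sum>k<n. N i k * diff (v' s0) i * diff (v s0) k + diff (v' s0) k * (N i k * diff (v s0) i))) (at s0 within A)"
    unfolding q_def diff_def
    by (intro DERIV_sum DERIV_mult DERIV_cmult DERIV_diff assms)
  also have "(\<Sum>i<n. \<Sum>k<n. N i k * diff (v' s0) i * diff (v s0) k + diff (v' s0) k * (N i k * diff (v s0) i))
     = q n (diff (v' s0)) (diff (v s0)) + q n (diff (v s0)) (diff (v' s0))"
    unfolding q_def by (simp add: sum.distrib mult_ac)
  finally show ?thesis by (simp add: q_sym[of n "diff (v s0)"])
qed

text \<open>Schur's test: nine entries of size at most 3 bound the absolute row and column sums by
  27. The forward difference and its transpose each cost a factor 2. The truncation grows from n to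
  n + 6 because of the stencil.\<close>

lemma M_L2_bound: "L2_set (M u) {..<n} \<le> 200 * L2_set u {..<n + 6}"
proof -
  define U where "U = L2_set u {..<n + 6}"
  have op_row: "(op x i)\<^sup>2 \<le> 27 * (\<Sum>k<i+5. \<bar>N i k\<bar> * (x k)\<^sup>2)" for x i
  proof -
    have absN: "(\<Sum>k<i+5. \<bar>N i k\<bar>) \<le> 27"
    proof -
      have "(\<Sum>k<i+5. \<bar>N i k\<bar>) = (\<Sum>k\<in>{i-4..<i+5}. \<bar>N i k\<bar>)"
        by (intro sum.mono_neutral_right) (auto intro!: band')
      also have "\<dots> \<le> (\<Sum>k\<in>{i-4..<i+5}. 3)" by (intro sum_mono bound)
      also have "\<dots> \<le> 27" by simp
      finally show ?thesis .
    qed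
    have "(op x i)\<^sup>2 \<le> (\<Sum>k<i+5. sqrt \<bar>N i k\<bar> * (sqrt \<bar>N i k\<bar> * \<bar>x k\<bar>))\<^sup>2"
    proof (rule abs_le_square_iff[THEN iffD1])
      have "\<bar>op x i\<bar> \<le> (\<Sum>k<i+5. sqrt \<bar>N i k\<bar> * (sqrt \<bar>N i k\<bar> * \<bar>x k\<bar>))"
        unfolding op_def by (rule order_trans[OF sum_abs]) (simp add: abs_mult flip: mult.assoc)
      then show "\<bar>op x i\<bar> \<le> \<bar>\<Sum>k<i+5. sqrt \<bar>N i k\<bar> * (sqrt \<bar>N i k\<bar> * \<bar>x k\<bar>)\<bar>" by linarith
    qed
    also have "\<dots> \<le> (\<Sum>k<i+5. (sqrt \<bar>N i k\<bar>)\<^sup>2) * (\<Sum>k<i+5. (sqrt \<bar>N i k\<bar> * \<bar>x k\<bar>)\<^sup>2)"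
      by (rule Cauchy_Schwarz_ineq_sum)
    also have "\<dots> = (\<Sum>k<i+5. \<bar>N i k\<bar>) * (\<Sum>k<i+5. \<bar>N i k\<bar> * (x k)\<^sup>2)"
      by (simp add: power_mult_distrib)
    also have "\<dots> \<le> 27 * (\<Sum>k<i+5. \<bar>N i k\<bar> * (x k)\<^sup>2)"
      using absN by (intro mult_right_mono sum_nonneg) auto
    finally show ?thesis .
  qed
  have op_L2: "L2_set (op x) {..<n} \<le> 27 * L2_set x {..<n + 4}" for x n
  proof -
    have col: "(\<Sum>i<n. \<bar>N i k\<bar>) \<le> 27" for k
    proof -
      have "(\<Sum>i<n. \<bar>N i k\<bar>) = (\<Sum>i\<in>{k-4..<k+5} \<inter> {..<n}. \<bar>N i k\<bar>)"
        by (intro sum.mono_neutral_right) (auto dest: nonzero_imp_near)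
      also have "\<dots> \<le> (\<Sum>i\<in>{k-4..<k+5}. \<bar>N i k\<bar>)" by (intro sum_mono2) auto
      also have "\<dots> \<le> (\<Sum>i\<in>{k-4..<k+5}. 3)" by (intro sum_mono bound)
      also have "\<dots> \<le> 27" by simp
      finally show ?thesis .
    qed
    have "(\<Sum>i<n. (op x i)\<^sup>2) \<le> (\<Sum>i<n. 27 * (\<Sum>k<n+4. \<bar>N i k\<bar> * (x k)\<^sup>2))"
      by (intro sum_mono order_trans[OF op_row] mult_left_mono sum_mono2) auto
    also have "\<dots> = 27 * (\<Sum>k<n+4. (\<Sum>i<n. \<bar>N i k\<bar>) * (x k)\<^sup>2)"
      by (subst sum_distrib_right, subst sum.swap) (simp add: sum_distrib_left)
    also have "\<dots> \<le> 27 * (\<Sum>k<n+4. 27 * (x k)\<^sup>2)"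
      by (intro mult_left_mono sum_mono mult_right_mono col) auto
    also have "\<dots> = (27 * L2_set x {..<n+4})\<^sup>2"
      unfolding L2_set_def by (simp add: power_mult_distrib sum_nonneg sum_distrib_left)
    finally show ?thesis
      unfolding L2_set_def[of "op x"] by (intro real_le_lsqrt) (auto intro: sum_nonneg L2_set_nonneg)
  qed
  have down: "L2_set (\<lambda>j. if j = 0 then 0 else x (j - 1)) {..<a} \<le> L2_set x {..<a}" for x :: "nat \<Rightarrow> real" and a
  proof (cases a)
    case (Suc b)
    have "(\<Sum>j<Suc b. (if j = 0 then 0 else x (j - 1))\<^sup>2) = (\<Sum>j<b. (x j)\<^sup>2)"
      by (subst sum.lessThan_Suc_shift) simp
    also have "\<dots> \<le> (\<Sum>j<Suc b. (x j)\<^sup>2)" by simp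
    finally show ?thesis unfolding L2_set_def Suc by (rule real_sqrt_le_mono)
  qed simp
  have diffb: "L2_set (diff u) {..<n+4} \<le> 2 * U"
    using L2_set_diff_le[of u "n + 4"] L2_set_mono_lessThan[of "Suc (n + 4)" "n + 6" u] by (simp add: U_def)
  have "L2_set (M u) {..<n} \<le> L2_set (\<lambda>j. if j = 0 then 0 else op (diff u) (j - 1)) {..<n} + L2_set (\<lambda>j. - op (diff u) j) {..<n}"
    unfolding M_def using L2_set_triangle_ineq[of "\<lambda>j. if j = 0 then 0 else op (diff u) (j - 1)" "\<lambda>j. - op (diff u) j" "{..<n}"] by simp
  also have "L2_set (\<lambda>j. - op (diff u) j) {..<n} = L2_set (op (diff u)) {..<n}" by (simp add: L2_set_def)
  also have "L2_set (\<lambda>j. if j = 0 then 0 else op (diff u) (j - 1)) {..<n} \<le> L2_set (op (diff u)) {..<n}"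
    by (rule down)
  also have "L2_set (op (diff u)) {..<n} \<le> 27 * L2_set (diff u) {..<n+4}" by (rule op_L2)
  finally have "L2_set (M u) {..<n} \<le> 54 * L2_set (diff u) {..<n+4}" by simp
  also have "\<dots> \<le> 54 * (2 * U)" using diffb by simp
  also have "\<dots> \<le> 200 * U" using L2_set_nonneg[of u "{..<n+6}"] by (simp add: U_def)
  finally show ?thesis by (simp add: U_def)
qed

end

section \<open>Time integrals and the discrete Sobolev inequality\<close>

lemma sum_sq_eq_L2: "(\<Sum>j\<in>A. (x j)\<^sup>2) = (L2_set x A)\<^sup>2"
  unfolding L2_set_def by (simp add: sum_nonneg)

lemma L2_set_integral:
  fixes v :: "real \<Rightarrow> nat \<Rightarrow> real"
  assumes "t \<ge> 0" and cont: "\<And>j. continuous_on {0..t} (\<lambda>s. v s j)"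
    and K: "\<And>s. s \<in> {0..t} \<Longrightarrow> L2_set (v s) {..<n} \<le> K"
  shows "L2_set (\<lambda>j. integral {0..t} (\<lambda>s. v s j)) {..<n} \<le> t * K"
proof (rule L2_set_leI)
  define I where "I = (\<lambda>j. integral {0..t} (\<lambda>s. v s j))"
  have int: "(\<lambda>s. v s j) integrable_on {0..t}" for j
    by (rule integrable_continuous_interval[OF cont])
  have "(\<Sum>j<n. I j * I j) = integral {0..t} (\<lambda>s. \<Sum>j<n. I j * v s j)"
    by (simp add: integral_sum integrable_on_mult_right int I_def)
  also have "\<bar>\<dots>\<bar> \<le> (L2_set I {..<n} * K) * (t - 0)"
    unfolding real_norm_def[symmetric]
  proof (rule integral_bound)
    show "continuous_on {0..t} (\<lambda>s. \<Sum>j<n. I j * v s j)" by (intro continuous_intros cont)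
    fix s assume s: "s \<in> {0..t}"
    have "\<bar>\<Sum>j<n. I j * v s j\<bar> \<le> (\<Sum>j<n. \<bar>I j\<bar> * \<bar>v s j\<bar>)"
      by (rule order_trans[OF sum_abs]) (simp add: abs_mult)
    also have "\<dots> \<le> L2_set I {..<n} * L2_set (v s) {..<n}" by (rule L2_set_mult_ineq)
    also have "\<dots> \<le> L2_set I {..<n} * K" by (intro mult_left_mono K s L2_set_nonneg)
    finally show "norm (\<Sum>j<n. I j * v s j) \<le> L2_set I {..<n} * K" by simp
  qed (use assms in auto)
  finally show "\<bar>\<Sum>j<n. integral {0..t} (\<lambda>s. v s j) * integral {0..t} (\<lambda>s. v s j)\<bar>
      \<le> L2_set (\<lambda>j. integral {0..t} (\<lambda>s. v s j)) {..<n} * (t * K)"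
    by (simp add: I_def mult_ac)
  have "0 \<le> K" using order_trans[OF L2_set_nonneg K[of 0]] assms(1) by simp
  then show "0 \<le> t * K" using assms(1) by simp
qed

lemma le_add_of_square_le:
  fixes m a b :: real
  assumes "m\<^sup>2 \<le> a\<^sup>2 + b * m" "a \<ge> 0" "b \<ge> 0"
  shows "m \<le> a + b"
proof (rule ccontr)
  assume "\<not> m \<le> a + b"
  then have m: "m > a + b" by simp
  then have "m * m > m * (a + b)" using assms by (intro mult_strict_left_mono) auto
  moreover have "m * a \<ge> a * a" using m assms by (intro mult_right_mono) auto
  ultimately show False using assms(1) by (simp add: power2_eq_square algebra_simps)
qed

text \<open>Discrete Sobolev inequality: the square is telescoped to infinity, each step factors
  into a difference and a sum of neighbours, and Cauchy-Schwarz applies. With differences of order h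
  and square sum of order 1 the value is of order sqrt h.\<close>

lemma sq_bounded_by_tail:
  assumes "(\<lambda>k. y k) \<longlonglongrightarrow> 0" and D: "\<And>n. L2_set (diff y) {..<n} \<le> D" and Y: "\<And>n. L2_set y {..<n} \<le> Y"
  shows "(y j)\<^sup>2 \<le> 2 * D * Y"
proof -
  have D0: "D \<ge> 0" using D[of 0] by simp
  have "(y j)\<^sup>2 \<le> 2 * D * Y + (y (j + K))\<^sup>2" for K
  proof -
    have "(y j)\<^sup>2 - (y (j + K))\<^sup>2 = (\<Sum>k\<in>{j..<j+K}. (y k)\<^sup>2 - (y (Suc k))\<^sup>2)"
      by (induction K) auto
    also have "\<dots> \<le> (\<Sum>k\<in>{j..<j+K}. \<bar>diff y k\<bar> * \<bar>y k\<bar> + \<bar>diff y k\<bar> * \<bar>y (Suc k)\<bar>)"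
    proof (rule sum_mono)
      fix k
      have "(y k)\<^sup>2 - (y (Suc k))\<^sup>2 = - (diff y k * y k) - diff y k * y (Suc k)"
        by (simp add: diff_def power2_eq_square algebra_simps)
      also have "\<dots> \<le> \<bar>diff y k\<bar> * \<bar>y k\<bar> + \<bar>diff y k\<bar> * \<bar>y (Suc k)\<bar>"
        unfolding abs_mult[symmetric] by linarith
      finally show "(y k)\<^sup>2 - (y (Suc k))\<^sup>2 \<le> \<bar>diff y k\<bar> * \<bar>y k\<bar> + \<bar>diff y k\<bar> * \<bar>y (Suc k)\<bar>" .
    qed
    also have "\<dots> \<le> (\<Sum>k<j+K. \<bar>diff y k\<bar> * \<bar>y k\<bar> + \<bar>diff y k\<bar> * \<bar>y (Suc k)\<bar>)"
      by (rule sum_mono2) auto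
    also have "\<dots> = (\<Sum>k<j+K. \<bar>diff y k\<bar> * \<bar>y k\<bar>) + (\<Sum>k<j+K. \<bar>diff y k\<bar> * \<bar>y (Suc k)\<bar>)"
      by (rule sum.distrib)
    also have "\<dots> \<le> D * Y + D * Y"
    proof (rule add_mono)
      show "(\<Sum>k<j+K. \<bar>diff y k\<bar> * \<bar>y k\<bar>) \<le> D * Y"
        using D0 by (intro order_trans[OF L2_set_mult_ineq] mult_mono D Y L2_set_nonneg)
      have "L2_set (\<lambda>k. y (Suc k)) {..<j+K} \<le> L2_set y {..<Suc (j+K)}"
        unfolding L2_set_def by (intro real_sqrt_le_mono) (simp add: sum.lessThan_Suc_shift del: sum.lessThan_Suc)
      then have "L2_set (\<lambda>k. y (Suc k)) {..<j+K} \<le> Y" using Y order_trans by blast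
      then show "(\<Sum>k<j+K. \<bar>diff y k\<bar> * \<bar>y (Suc k)\<bar>) \<le> D * Y"
        using D0 by (intro order_trans[OF L2_set_mult_ineq] mult_mono D L2_set_nonneg)
    qed
    finally show ?thesis by simp
  qed
  moreover have "(\<lambda>K. 2 * D * Y + (y (j + K))\<^sup>2) \<longlonglongrightarrow> 2 * D * Y + 0\<^sup>2"
    using assms(1) by (intro tendsto_intros) (simp add: LIMSEQ_ignore_initial_segment add.commute[of j])
  ultimately show ?thesis using LIMSEQ_le_const[of _ "2 * D * Y" "(y j)\<^sup>2"] by auto
qed

lemma L2_bounded_imp_null:
  assumes "\<And>n. L2_set y {..<n} \<le> K"
  shows "(\<lambda>k. y k :: real) \<longlonglongrightarrow> 0"
proof -
  have "summable (\<lambda>k. (y k)\<^sup>2)"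
  proof (rule summableI_nonneg_bounded)
    show "(\<Sum>k<n. (y k)\<^sup>2) \<le> K\<^sup>2" for n
      unfolding sum_sq_eq_L2 using assms[of n] L2_set_nonneg by (intro power_mono) auto
  qed auto
  then have "(\<lambda>k. (y k)\<^sup>2) \<longlonglongrightarrow> 0" by (rule summable_LIMSEQ_zero)
  then have "(\<lambda>k. sqrt ((y k)\<^sup>2)) \<longlonglongrightarrow> sqrt 0" by (rule tendsto_real_sqrt)
  then show ?thesis by (simp add: tendsto_rabs_zero_iff)
qed

context banded_form
begin

text \<open>The energy is that of the antiderivative \<open>\<eta>\<close> of the solution, so that it controls the solution
  itself. Forcing at the six boundary points is integrated by parts in time and then acts only
  on \<open>\<eta>\<close> at these points, where the discrete Sobolev inequality gains a factor \<open>sqrt h\<close>.\<close>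

theorem energy_estimate:
  fixes z w f r :: "real \<Rightarrow> nat \<Rightarrow> real"
  assumes h: "h > 0" and T: "T \<ge> 0"
    and z: "\<And>j t. t \<in> {0..T} \<Longrightarrow> ((\<lambda>s. z s j) has_real_derivative w t j) (at t within {0..T})"
    and w: "\<And>j t. t \<in> {0..T} \<Longrightarrow> ((\<lambda>s. w s j) has_real_derivative
        - (M (z t) j / (h\<^sup>2 * \<omega> j)) + f t j + r t j) (at t within {0..T})"
    and f_cont: "\<And>j. continuous_on {0..T} (\<lambda>t. f t j)"
    and r_cont: "\<And>j. continuous_on {0..T} (\<lambda>t. r t j)"
    and f_le: "\<And>t n. t \<in> {0..T} \<Longrightarrow> L2_set (f t) {..<n} \<le> F"
    and r_0: "\<And>t j. j \<ge> 6 \<Longrightarrow> r t j = 0"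
    and r_le: "\<And>t j. t \<in> {0..T} \<Longrightarrow> \<bar>r t j\<bar> \<le> \<rho>"
    and A0: "\<And>n. L2_set (z 0) {..<n} \<le> A0" and A1: "\<And>n. L2_set (w 0) {..<n} \<le> A1"
    and Z: "\<And>t n. t \<in> {0..T} \<Longrightarrow> L2_set (z t) {..<n} \<le> Z"
    and t: "t \<in> {0..T}"
  shows "L2_set (z t) {..<n} \<le> 3 * (A0 + 6 * T * (A1 + T * F) + 192 * T * sqrt (T * h) * \<rho>)"
proof -
  have T0: "0 \<in> {0..T}" using T by simp
  have F0: "F \<ge> 0" using f_le[OF T0, of 0] by simp
  have rho0: "\<rho> \<ge> 0" using r_le[OF T0, of 0] by linarith
  have A00: "A0 \<ge> 0" using A0[of 0] by simp
  have A10: "A1 \<ge> 0" using A1[of 0] by simp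
  have Z0: "Z \<ge> 0" using Z[OF T0, of 0] by simp
  have \<omega>0: "\<omega> j > 0" for j using weight_ge[of j] by linarith
  have z_cont: "continuous_on {0..T} (\<lambda>t. z t j)" for j
    by (rule DERIV_continuous_on[OF z])
  define \<eta> where "\<eta> = (\<lambda>t j. integral {0..t} (\<lambda>s. z s j))"
  define fi where "fi = (\<lambda>t j. integral {0..t} (\<lambda>s. f s j))"
  define ri where "ri = (\<lambda>t j. integral {0..t} (\<lambda>s. r s j))"
  have \<eta>': "((\<lambda>s. \<eta> s j) has_real_derivative z t j) (at t within {0..T})" if "t \<in> {0..T}" for t j
    unfolding \<eta>_def by (rule integral_has_real_derivative[OF z_cont that])
  have fi': "((\<lambda>s. fi s j) has_real_derivative f t j) (at t within {0..T})" if "t \<in> {0..T}" for t j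
    unfolding fi_def by (rule integral_has_real_derivative[OF f_cont that])
  have ri': "((\<lambda>s. ri s j) has_real_derivative r t j) (at t within {0..T})" if "t \<in> {0..T}" for t j
    unfolding ri_def by (rule integral_has_real_derivative[OF r_cont that])
  have \<eta>_cont: "continuous_on {0..T} (\<lambda>t. \<eta> t j)" for j by (rule DERIV_continuous_on[OF \<eta>'])
  have fi_cont: "continuous_on {0..T} (\<lambda>t. fi t j)" for j by (rule DERIV_continuous_on[OF fi'])
  have ri_cont: "continuous_on {0..T} (\<lambda>t. ri t j)" for j by (rule DERIV_continuous_on[OF ri'])
  have zero: "\<eta> 0 j = 0" "fi 0 j = 0" "ri 0 j = 0" for j by (auto simp: \<eta>_def fi_def ri_def)
  \<comment> \<open>The equation integrated once in time: \<open>\<eta>\<close> solves the same wave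
    equation, with the initial velocity and the antiderivatives of the forcings on the
    right.\<close>
  have w_eq: "w t j = w 0 j - M (\<eta> t) j / (h\<^sup>2 * \<omega> j) + fi t j + ri t j" if t: "t \<in> {0..T}" for t j
  proof -
    define e where "e = (\<lambda>t. w t j - (- (M (\<eta> t) j / (h\<^sup>2 * \<omega> j)) + fi t j + ri t j))"
    have "(e has_real_derivative 0) (at s within {0..T})" if s: "s \<in> {0..T}" for s
    proof -
      have "(e has_real_derivative (- (M (z s) j / (h\<^sup>2 * \<omega> j)) + f s j + r s j)
          - (- (M (z s) j / (h\<^sup>2 * \<omega> j)) + f s j + r s j)) (at s within {0..T})"
        unfolding e_def
        by (intro DERIV_diff DERIV_add DERIV_minus DERIV_cdivide M_has_derivative w \<eta>' fi' ri' s)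
      then show ?thesis by simp
    qed
    then obtain c where c: "\<And>s. s \<in> {0..T} \<Longrightarrow> e s = c"
      using has_field_derivative_zero_constant[of "{0..T}" e] by auto
    have "M (\<eta> 0) j = 0"
      using zero by (simp add: M_def op_def diff_def)
    then have "e 0 = w 0 j" by (simp add: e_def zero)
    then have "e t = w 0 j" using c[OF t] c[OF T0] by simp
    then show ?thesis by (simp add: e_def)
  qed
  have L2_int: "L2_set (\<lambda>j. integral {0..t} (\<lambda>s. v s j)) {..<n} \<le> T * K"
    if "t \<in> {0..T}" "\<And>j. continuous_on {0..T} (\<lambda>s. v s j)" "\<And>s. s \<in> {0..T} \<Longrightarrow> L2_set (v s) {..<n} \<le> K" "K \<ge> 0"
    for t v and n :: nat and K
  proof -
    have "L2_set (\<lambda>j. integral {0..t} (\<lambda>s. v s j)) {..<n} \<le> t * K"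
    proof (rule L2_set_integral)
      show "continuous_on {0..t} (\<lambda>s. v s j)" for j
        using that(1) by (intro continuous_on_subset[OF that(2)]) auto
    qed (use that in auto)
    also have "\<dots> \<le> T * K" using that by (intro mult_right_mono) auto
    finally show ?thesis .
  qed
  have fi_L2: "L2_set (fi t) {..<n} \<le> T * F" if "t \<in> {0..T}" for t n
    unfolding fi_def by (rule L2_int[OF that f_cont f_le F0])
  define G where "G = A1 + T * F"
  define g where "g = (\<lambda>t j. w 0 j + fi t j)"
  have g_L2: "L2_set (g t) {..<n} \<le> G" if "t \<in> {0..T}" for t n
    unfolding g_def G_def by (rule order_trans[OF L2_set_triangle_ineq add_mono[OF A1 fi_L2[OF that]]])
  have G0: "G \<ge> 0" using A10 F0 T by (simp add: G_def)
  have ri_le: "\<bar>ri t j\<bar> \<le> T * \<rho>" if t: "t \<in> {0..T}" for t j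
  proof -
    have "norm (integral {0..t} (\<lambda>s. r s j)) \<le> \<rho> * (t - 0)"
      using t r_le by (intro integral_bound continuous_on_subset[OF r_cont]) auto
    also have "\<dots> \<le> T * \<rho>" using mult_right_mono[of t T \<rho>] t rho0 by (simp add: mult.commute)
    finally show ?thesis by (simp add: ri_def)
  qed
  have ri_0: "ri t j = 0" if "j \<ge> 6" for t j using that by (simp add: ri_def r_0)

  \<comment> \<open>The lower bound of the energy: 1/8 is half of the least weight 1/4, and 1/100 is
    half of the coercivity constant 1/50.\<close>
  define val where "val = (\<lambda>t n. (L2_set (z t) {..<n})\<^sup>2 / 8 + (L2_set (diff (\<eta> t)) {..<n})\<^sup>2 / (100 * h\<^sup>2))"
  define V where "V = {val t n | t n. t \<in> {0..T}}"
  define m where "m = sqrt (Sup V)"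
  have \<eta>_L2: "L2_set (\<eta> t) {..<n} \<le> T * K"
    if "t \<in> {0..T}" "\<And>s n. s \<in> {0..T} \<Longrightarrow> L2_set (z s) {..<n} \<le> K" for t n K
  proof -
    have "K \<ge> 0" using that(2)[OF T0, of 0] by simp
    then show ?thesis unfolding \<eta>_def by (intro L2_int z_cont that)
  qed
  have val0: "val t n \<ge> 0" for t n by (simp add: val_def)
  \<comment> \<open>Only here and in the summability of \<open>\<beta>\<close> does the qualitative
    bound \<open>Z\<close> enter. It makes the supremum finite and does not appear in the
    estimate.\<close>
  have V_bdd: "bdd_above V"
  proof -
    have "val t n \<le> Z\<^sup>2 / 8 + (2 * (T * Z))\<^sup>2 / (100 * h\<^sup>2)" if "t \<in> {0..T}" for t n
      unfolding val_def
    proof (intro add_mono divide_right_mono power_mono)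
      show "L2_set (diff (\<eta> t)) {..<n} \<le> 2 * (T * Z)"
        using \<eta>_L2[OF that Z, of "Suc n"] L2_set_diff_le[of "\<eta> t" n] by simp
    qed (use Z that in \<open>auto simp: L2_set_nonneg\<close>)
    then show ?thesis unfolding V_def bdd_above_def by blast
  qed
  have val_le: "val t n \<le> Sup V" if "t \<in> {0..T}" for t n
    using that V_bdd by (intro cSup_upper) (auto simp: V_def)
  have SupV0: "Sup V \<ge> 0" using val_le[OF T0, of 0] val0[of 0 0] by linarith
  have m0: "m \<ge> 0" "m\<^sup>2 = Sup V" using SupV0 by (auto simp: m_def)
  have z_m: "L2_set (z t) {..<n} \<le> 3 * m" if "t \<in> {0..T}" for t n
  proof (rule power2_le_imp_le)
    have "(L2_set (z t) {..<n})\<^sup>2 / 8 \<le> val t n" by (simp add: val_def)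
    then have "(L2_set (z t) {..<n})\<^sup>2 \<le> 8 * m\<^sup>2" using val_le[OF that, of n] m0 by simp
    also have "\<dots> \<le> (3 * m)\<^sup>2" by (simp add: power_mult_distrib)
    finally show "(L2_set (z t) {..<n})\<^sup>2 \<le> (3 * m)\<^sup>2" .
  qed (use m0 in auto)
  have d_m: "L2_set (diff (\<eta> t)) {..<n} \<le> 10 * h * m" if "t \<in> {0..T}" for t n
  proof (rule power2_le_imp_le)
    have "(L2_set (diff (\<eta> t)) {..<n})\<^sup>2 / (100 * h\<^sup>2) \<le> val t n" by (simp add: val_def)
    also have "\<dots> \<le> m\<^sup>2" using val_le[OF that, of n] m0 by simp
    finally show "(L2_set (diff (\<eta> t)) {..<n})\<^sup>2 \<le> (10 * h * m)\<^sup>2"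
      using h by (simp add: power_mult_distrib field_simps)
  qed (use m0 h in auto)
  have \<eta>_m: "L2_set (\<eta> t) {..<n} \<le> T * (3 * m)" if "t \<in> {0..T}" for t n
    by (rule \<eta>_L2[OF that z_m])
  \<comment> \<open>From the Sobolev inequality with differences 10 h m and square sum 3 T m: twice
    their product is 60 T h m squared, rounded up to a square.\<close>
  define \<mu> where "\<mu> = 8 * sqrt (T * h) * m"
  have mu0: "\<mu> \<ge> 0" using T h m0 by (simp add: \<mu>_def)
  have \<eta>_pt: "\<bar>\<eta> t j\<bar> \<le> \<mu>" if t: "t \<in> {0..T}" for t j
  proof -
    have "(\<eta> t j)\<^sup>2 \<le> 2 * (10 * h * m) * (T * (3 * m))"
      by (rule sq_bounded_by_tail[OF L2_bounded_imp_null[OF \<eta>_m] d_m \<eta>_m]) (use t in auto)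
    also have "\<dots> = 60 * (T * h * m\<^sup>2)" by (simp add: power2_eq_square)
    also have "\<dots> \<le> 64 * (T * h * m\<^sup>2)" using T h by (intro mult_right_mono) auto
    also have "\<dots> = \<mu>\<^sup>2" using T h by (simp add: \<mu>_def power_mult_distrib)
    finally show ?thesis using mu0 by (metis abs_le_square_iff abs_of_nonneg)
  qed

  \<comment> \<open>The integrated square sums form a convergent series over the grid index, so
    twelve consecutive terms, which make up the integrated flux, tend to 0. Pointwise in time no
    such uniform decay is at hand.\<close>
  define \<beta> where "\<beta> = (\<lambda>k. integral {0..T} (\<lambda>s. (z s k)\<^sup>2 + (\<eta> s k)\<^sup>2))"
  define S where "S = (\<lambda>n s. local_size n (z s) (\<eta> s))"
  have S_cont: "continuous_on {0..T} (S n)" for n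
    unfolding S_def local_size_def by (intro continuous_intros z_cont \<eta>_cont)
  have S0: "S n s \<ge> 0" for n s unfolding S_def local_size_def by (intro sum_nonneg) auto
  have sq_int: "(\<lambda>s. (z s k)\<^sup>2 + (\<eta> s k)\<^sup>2) integrable_on {0..T}" for k
    by (intro integrable_continuous_interval continuous_intros z_cont \<eta>_cont)
  have "summable \<beta>"
  proof (rule summableI_nonneg_bounded)
    show "0 \<le> \<beta> k" for k unfolding \<beta>_def by (intro integral_nonneg sq_int) auto
    show "(\<Sum>k<n. \<beta> k) \<le> integral {0..T} (\<lambda>s. Z\<^sup>2 + (T * Z)\<^sup>2)" for n
    proof -
      have "(\<Sum>k<n. \<beta> k) = integral {0..T} (\<lambda>s. \<Sum>k<n. (z s k)\<^sup>2 + (\<eta> s k)\<^sup>2)"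
        unfolding \<beta>_def by (intro integral_sum[symmetric] sq_int) auto
      also have "\<dots> \<le> integral {0..T} (\<lambda>s. Z\<^sup>2 + (T * Z)\<^sup>2)"
      proof (rule integral_le)
        fix s assume s: "s \<in> {0..T}"
        show "(\<Sum>k<n. (z s k)\<^sup>2 + (\<eta> s k)\<^sup>2) \<le> Z\<^sup>2 + (T * Z)\<^sup>2"
          unfolding sum.distrib sum_sq_eq_L2 using s
          by (intro add_mono power_mono Z \<eta>_L2 L2_set_nonneg)
      qed (auto intro!: integrable_sum sq_int)
      finally show ?thesis .
    qed
  qed
  then have beta0: "\<beta> \<longlonglongrightarrow> 0" by (rule summable_LIMSEQ_zero)
  have S_int: "integral {0..T} (S n) = (\<Sum>i<12. \<beta> (n - 5 + i))" for n
    unfolding S_def local_size_def \<beta>_def by (intro integral_sum sq_int) auto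
  have S_lim: "(\<lambda>n. integral {0..T} (S n)) \<longlonglongrightarrow> 0"
  proof -
    have "(\<lambda>n. \<beta> (n - 5 + i)) \<longlonglongrightarrow> 0" for i
    proof (rule LIMSEQ_offset[of _ 5])
      show "(\<lambda>n. \<beta> (n + 5 - 5 + i)) \<longlonglongrightarrow> 0"
        using LIMSEQ_ignore_initial_segment[OF beta0, of i] by simp
    qed
    then have "(\<lambda>n. \<Sum>i<12. \<beta> (n - 5 + i)) \<longlonglongrightarrow> (\<Sum>i<12::nat. 0)" by (intro tendsto_sum) auto
    then show ?thesis by (simp add: S_int)
  qed

  have step: "val t n \<le> A0\<^sup>2 + T * (6 * m * G + 12 * \<mu> * \<rho>) + 12 * \<mu> * (T * \<rho>)
      + 250 / h\<^sup>2 * integral {0..T} (S n)" if t: "t \<in> {0..T}" and n: "n \<ge> 6" for t n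
  proof -
    \<comment> \<open>The cross term removes the pairing of \<open>z\<close> with \<open>ri\<close>
      from the derivative and puts the pairing of \<open>\<eta>\<close> with \<open>r\<close> in its
      place. At time 0 both the potential and the cross term vanish because \<open>\<eta>\<close>
      does.\<close>
    define E where "E = (\<lambda>t. (\<Sum>j<Suc n. \<omega> j * (z t j)\<^sup>2) / 2 + q (Suc n) (diff (\<eta> t)) (diff (\<eta> t)) / (2 * h\<^sup>2)
        - (\<Sum>j<Suc n. \<omega> j * (\<eta> t j * ri t j)))"
    define E' where "E' = (\<lambda>t. (\<Sum>j<Suc n. \<omega> j * (2 * z t j * w t j)) / 2 + 2 * q (Suc n) (diff (z t)) (diff (\<eta> t)) / (2 * h\<^sup>2)
        - (\<Sum>j<Suc n. \<omega> j * (z t j * ri t j + r t j * \<eta> t j)))"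
    have E': "(E has_real_derivative E' s) (at s within {0..T})" if s: "s \<in> {0..T}" for s
    proof -
      have sq: "((\<lambda>s. (z s j)\<^sup>2) has_real_derivative 2 * z s j * w s j) (at s within {0..T})" for j
        using DERIV_power[OF z[OF s, of j], of 2] by (simp add: mult_ac)
      show ?thesis unfolding E_def E'_def
        by (intro DERIV_diff DERIV_add DERIV_cdivide DERIV_sum DERIV_cmult sq q_has_derivative DERIV_mult \<eta>' ri' s)
    qed
    have small: "\<bar>\<Sum>j<Suc n. \<omega> j * (x j * y j)\<bar> \<le> 12 * (a * b)"
      if "\<And>j. \<bar>x j\<bar> \<le> a" "\<And>j. \<bar>y j\<bar> \<le> b" "\<And>j. j \<ge> 6 \<Longrightarrow> y j = 0" for x y a b
    proof -
      have "(\<Sum>j<Suc n. \<omega> j * (x j * y j)) = (\<Sum>j<6. \<omega> j * (x j * y j))"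
        using n that(3) by (intro sum.mono_neutral_right) auto
      also have "\<bar>\<dots>\<bar> \<le> (\<Sum>j<6. \<bar>\<omega> j * (x j * y j)\<bar>)" by (rule sum_abs)
      also have "\<dots> \<le> (\<Sum>j<6::nat. 2 * (a * b))"
      proof (rule sum_mono)
        fix j
        have "\<bar>\<omega> j\<bar> \<le> 2" using weight_le[of j] \<omega>0[of j] by linarith
        then show "\<bar>\<omega> j * (x j * y j)\<bar> \<le> 2 * (a * b)" unfolding abs_mult
          using that(1)[of j] that(2)[of j] by (intro mult_mono) auto
      qed
      finally show ?thesis by simp
    qed
    have E'_le: "E' s \<le> (6 * m * G + 12 * \<mu> * \<rho>) + 250 / h\<^sup>2 * S n s" if s: "s \<in> {0..T}" for s
    proof -
      have "(\<Sum>j<Suc n. \<omega> j * (2 * z s j * w s j)) / 2 = (\<Sum>j<Suc n. \<omega> j * (z s j * g s j))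
          + (\<Sum>j<Suc n. \<omega> j * (z s j * ri s j)) - (\<Sum>j<Suc n. z s j * M (\<eta> s) j) / h\<^sup>2"
      proof -
        have "\<omega> j * (2 * z s j * w s j) / 2 = \<omega> j * (z s j * g s j) + \<omega> j * (z s j * ri s j) - z s j * M (\<eta> s) j / h\<^sup>2" for j
          using \<omega>0[of j] h unfolding w_eq[OF s] g_def by (simp add: field_simps)
        then show ?thesis by (simp only: sum_divide_distrib sum.distrib[symmetric] sum_subtractf[symmetric])
      qed
      moreover have "(\<Sum>j<Suc n. \<omega> j * (z s j * ri s j + r s j * \<eta> s j))
          = (\<Sum>j<Suc n. \<omega> j * (z s j * ri s j)) + (\<Sum>j<Suc n. \<omega> j * (\<eta> s j * r s j))"
        by (simp only: sum.distrib[symmetric] distrib_left mult.commute[of "r s _"])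
      moreover have "2 * q (Suc n) (diff (z s)) (diff (\<eta> s)) / (2 * h\<^sup>2) = q (Suc n) (diff (z s)) (diff (\<eta> s)) / h\<^sup>2"
        by simp
      ultimately have E'_eq: "E' s = (\<Sum>j<Suc n. \<omega> j * (z s j * g s j)) - (\<Sum>j<Suc n. \<omega> j * (\<eta> s j * r s j))
          - ((\<Sum>j<Suc n. z s j * M (\<eta> s) j) - q (Suc n) (diff (z s)) (diff (\<eta> s))) / h\<^sup>2"
        unfolding E'_def by (simp only: diff_divide_distrib)
      have "(\<Sum>j<Suc n. \<omega> j * (z s j * g s j)) \<le> (\<Sum>j<Suc n. 2 * (\<bar>z s j\<bar> * \<bar>g s j\<bar>))"
      proof (rule sum_mono)
        fix j
        have "\<omega> j * (z s j * g s j) \<le> \<omega> j * \<bar>z s j * g s j\<bar>" using \<omega>0[of j] by (intro mult_left_mono) auto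
        also have "\<dots> \<le> 2 * \<bar>z s j * g s j\<bar>" using weight_le[of j] by (intro mult_right_mono) auto
        finally show "\<omega> j * (z s j * g s j) \<le> 2 * (\<bar>z s j\<bar> * \<bar>g s j\<bar>)" by (simp add: abs_mult)
      qed
      also have "\<dots> = 2 * (\<Sum>j<Suc n. \<bar>z s j\<bar> * \<bar>g s j\<bar>)" by (simp only: sum_distrib_left)
      also have "\<dots> \<le> 2 * (L2_set (z s) {..<Suc n} * L2_set (g s) {..<Suc n})"
        by (intro mult_left_mono L2_set_mult_ineq) auto
      also have "\<dots> \<le> 2 * (3 * m * G)"
        using s m0 by (intro mult_left_mono mult_mono z_m g_L2 L2_set_nonneg) auto
      finally have 1: "(\<Sum>j<Suc n. \<omega> j * (z s j * g s j)) \<le> 6 * m * G" by simp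
      have 2: "\<bar>\<Sum>j<Suc n. \<omega> j * (\<eta> s j * r s j)\<bar> \<le> 12 * (\<mu> * \<rho>)"
        using s by (intro small \<eta>_pt r_le r_0)
      have "\<bar>(\<Sum>j<Suc n. z s j * M (\<eta> s) j) - q (Suc n) (diff (z s)) (diff (\<eta> s))\<bar> \<le> 250 * S n s"
        unfolding S_def using n by (intro flux_bound) simp
      then have 3: "\<bar>((\<Sum>j<Suc n. z s j * M (\<eta> s) j) - q (Suc n) (diff (z s)) (diff (\<eta> s))) / h\<^sup>2\<bar> \<le> 250 * S n s / h\<^sup>2"
        using h by (simp add: abs_divide divide_right_mono)
      have "E' s \<le> 6 * m * G + 12 * (\<mu> * \<rho>) + 250 * S n s / h\<^sup>2"
        unfolding E'_eq using add_mono[OF 1 add_mono[OF abs_le_D2[OF 2] abs_le_D2[OF 3]]]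
        by (simp only: diff_conv_add_uminus add.assoc)
      then show ?thesis by simp
    qed
    have "E t - E 0 \<le> integral {0..t} (\<lambda>s. (6 * m * G + 12 * \<mu> * \<rho>) + 250 / h\<^sup>2 * S n s)"
    proof (rule has_integral_le)
      show "(E' has_integral E t - E 0) {0..t}"
      proof (rule fundamental_theorem_of_calculus)
        fix s assume "s \<in> {0..t}"
        then show "(E has_vector_derivative E' s) (at s within {0..t})"
          using t E'[of s] unfolding has_real_derivative_iff_has_vector_derivative
          by (auto intro: has_vector_derivative_within_subset)
      qed (use t in auto)
      show "((\<lambda>s. (6 * m * G + 12 * \<mu> * \<rho>) + 250 / h\<^sup>2 * S n s) has_integral
          integral {0..t} (\<lambda>s. (6 * m * G + 12 * \<mu> * \<rho>) + 250 / h\<^sup>2 * S n s)) {0..t}"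
        using t h by (intro integrable_integral integrable_continuous_interval continuous_intros
            continuous_on_subset[OF S_cont]) auto
    qed (use E'_le t in auto)
    also have "\<dots> \<le> integral {0..T} (\<lambda>s. (6 * m * G + 12 * \<mu> * \<rho>) + 250 / h\<^sup>2 * S n s)"
    proof (rule integral_subset_le)
      show "(\<lambda>s. (6 * m * G + 12 * \<mu> * \<rho>) + 250 / h\<^sup>2 * S n s) integrable_on {0..t}"
        using t h by (intro integrable_continuous_interval continuous_intros continuous_on_subset[OF S_cont]) auto
      show "(\<lambda>s. (6 * m * G + 12 * \<mu> * \<rho>) + 250 / h\<^sup>2 * S n s) integrable_on {0..T}"
        using h by (intro integrable_continuous_interval continuous_intros S_cont) auto
    qed (use t S0 m0 G0 mu0 rho0 in auto)
    also have "\<dots> = T * (6 * m * G + 12 * \<mu> * \<rho>) + 250 / h\<^sup>2 * integral {0..T} (S n)"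
      using T h by (subst integral_add) (auto intro!: integrable_continuous_interval continuous_intros S_cont)
    finally have E_le: "E t \<le> E 0 + T * (6 * m * G + 12 * \<mu> * \<rho>) + 250 / h\<^sup>2 * integral {0..T} (S n)" by simp
    have "E 0 = (\<Sum>j<Suc n. \<omega> j * (z 0 j)\<^sup>2) / 2"
      by (simp add: E_def zero q_def diff_def)
    also have "\<dots> \<le> (\<Sum>j<Suc n. 2 * (z 0 j)\<^sup>2) / 2"
      by (intro divide_right_mono sum_mono mult_right_mono weight_le) auto
    also have "\<dots> = (L2_set (z 0) {..<Suc n})\<^sup>2"
      by (simp only: sum_distrib_left[symmetric] sum_sq_eq_L2)
    also have "\<dots> \<le> A0\<^sup>2" by (intro power_mono A0 L2_set_nonneg)
    finally have E0: "E 0 \<le> A0\<^sup>2" .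
    have "val t n \<le> E t + 12 * (\<mu> * (T * \<rho>))"
    proof -
      have "\<bar>\<Sum>j<Suc n. \<omega> j * (\<eta> t j * ri t j)\<bar> \<le> 12 * (\<mu> * (T * \<rho>))"
        using t by (intro small \<eta>_pt ri_le ri_0)
      moreover have "(L2_set (z t) {..<n})\<^sup>2 / 8 \<le> (\<Sum>j<Suc n. \<omega> j * (z t j)\<^sup>2) / 2"
      proof -
        have "(L2_set (z t) {..<n})\<^sup>2 = (\<Sum>j<n. (z t j)\<^sup>2)" by (simp only: sum_sq_eq_L2)
        also have "\<dots> \<le> (\<Sum>j<Suc n. (z t j)\<^sup>2)" by simp
        also have "\<dots> \<le> (\<Sum>j<Suc n. 4 * (\<omega> j * (z t j)\<^sup>2))"
        proof (rule sum_mono)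
          fix j
          have "1 * (z t j)\<^sup>2 \<le> (4 * \<omega> j) * (z t j)\<^sup>2" using weight_ge[of j] by (intro mult_right_mono) auto
          then show "(z t j)\<^sup>2 \<le> 4 * (\<omega> j * (z t j)\<^sup>2)" by simp
        qed
        also have "\<dots> = 4 * (\<Sum>j<Suc n. \<omega> j * (z t j)\<^sup>2)" by (simp only: sum_distrib_left)
        finally show ?thesis by simp
      qed
      moreover have "(L2_set (diff (\<eta> t)) {..<n})\<^sup>2 / (100 * h\<^sup>2) \<le> q (Suc n) (diff (\<eta> t)) (diff (\<eta> t)) / (2 * h\<^sup>2)"
      proof -
        have "(L2_set (diff (\<eta> t)) {..<n})\<^sup>2 = (\<Sum>i<n. (diff (\<eta> t) i)\<^sup>2)" by (simp only: sum_sq_eq_L2)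
        also have "\<dots> \<le> (\<Sum>i<Suc n. (diff (\<eta> t) i)\<^sup>2)" by simp
        finally have "(L2_set (diff (\<eta> t)) {..<n})\<^sup>2 / 50 \<le> q (Suc n) (diff (\<eta> t)) (diff (\<eta> t))"
          using q_ge[of "diff (\<eta> t)" "Suc n"] by linarith
        then have "(L2_set (diff (\<eta> t)) {..<n})\<^sup>2 / 50 / (2 * h\<^sup>2) \<le> q (Suc n) (diff (\<eta> t)) (diff (\<eta> t)) / (2 * h\<^sup>2)"
          using h by (intro divide_right_mono) auto
        then show ?thesis by simp
      qed
      ultimately show ?thesis unfolding val_def E_def by linarith
    qed
    then show ?thesis using E_le E0 by simp
  qed
  \<comment> \<open>The boundary forcing enters twice with 12 T \<mu> \<rho>, through the derivative
    of the energy and through its cross term; together with the factor 8 in \<open>\<mu>\<close>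
    this makes 192.\<close>
  define b where "b = 6 * T * G + 192 * T * sqrt (T * h) * \<rho>"
  have b0: "b \<ge> 0" using T G0 rho0 h by (simp add: b_def)
  \<comment> \<open>The energy inequality at a large truncation \<open>k\<close> dominates
    \<open>val t n\<close> by monotonicity; then \<open>k\<close> tends to infinity and the flux
    disappears. The supremum \<open>m\<close> now satisfies a quadratic inequality.\<close>
  have val_b: "val t n \<le> A0\<^sup>2 + b * m" if t: "t \<in> {0..T}" for t n
  proof -
    have "val t n \<le> val t k" if "n \<le> k" for k
      unfolding val_def by (intro add_mono divide_right_mono power_mono L2_set_mono_lessThan that L2_set_nonneg) auto
    then have "\<exists>N. \<forall>k\<ge>N. val t n \<le> A0\<^sup>2 + T * (6 * m * G + 12 * \<mu> * \<rho>) + 12 * \<mu> * (T * \<rho>)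
      + 250 / h\<^sup>2 * integral {0..T} (S k)"
      using step[OF t] by (intro exI[of _ "max n 6"]) (auto intro: order_trans)
    moreover have "(\<lambda>k. A0\<^sup>2 + T * (6 * m * G + 12 * \<mu> * \<rho>) + 12 * \<mu> * (T * \<rho>)
      + 250 / h\<^sup>2 * integral {0..T} (S k)) \<longlonglongrightarrow> A0\<^sup>2 + T * (6 * m * G + 12 * \<mu> * \<rho>) + 12 * \<mu> * (T * \<rho>) + 250 / h\<^sup>2 * 0"
      by (intro tendsto_intros S_lim)
    ultimately have "val t n \<le> A0\<^sup>2 + T * (6 * m * G + 12 * \<mu> * \<rho>) + 12 * \<mu> * (T * \<rho>) + 250 / h\<^sup>2 * 0"
      using LIMSEQ_le_const by blast
    also have "\<dots> = A0\<^sup>2 + b * m" by (simp add: b_def \<mu>_def algebra_simps)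
    finally show ?thesis .
  qed
  have "m\<^sup>2 \<le> A0\<^sup>2 + b * m"
    unfolding m0(2)
  proof (rule cSup_least)
    show "V \<noteq> {}" using T0 by (auto simp: V_def)
  qed (use val_b in \<open>auto simp: V_def\<close>)
  then have "m \<le> A0 + b" using A00 b0 by (rule le_add_of_square_le)
  then show ?thesis using z_m[OF t, of n] by (simp add: b_def G_def)
qed

subsection \<open>Boundary correctors and the concrete operators\<close>

lemma N_diag: "1/50 \<le> N i i"
proof -
  have "0 \<le> (\<Sum>k\<in>{..<i+5} - {i}. \<bar>N i k\<bar> * d k)"
    by (intro sum_nonneg mult_nonneg_nonneg less_imp_le[OF d_pos]) auto
  then have "0 \<le> (N i i - 1/50) * d i" using dominant order_trans by blast
  then show ?thesis using d_pos[of i] by (simp add: zero_le_mult_iff)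
qed

text \<open>Weighted diagonal dominance makes the Jacobi iteration a contraction.\<close>

lemma op_solvable:
  assumes "\<And>i. i \<ge> 5 \<Longrightarrow> \<sigma> i = 0"
  shows "\<exists>x K. op x = \<sigma> \<and> (\<forall>i. \<bar>x i\<bar> \<le> K * (1/2) ^ i)"
proof -
  \<comment> \<open>The unknown is rescaled to x = d y, so that the row sums with weights
    \<open>d\<close> become ordinary sup-norm bounds.\<close>
  define J where "J = (\<lambda>y i. (\<sigma> i - (\<Sum>k\<in>{..<i+5} - {i}. N i k * d k * y k)) / (N i i * d i))"
  have Nd: "N i i * d i > 0" for i using N_diag[of i] d_pos[of i] by simp
  \<comment> \<open>As diagonal entries are at most 3, the margin 1/50 is at least 1/150 of the
    diagonal, whence the factor 149/150. Accordingly the ball of radius 150 B is invariant under the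
    iteration.\<close>
  have contr: "\<bar>\<Sum>k\<in>{..<i+5} - {i}. N i k * d k * y k\<bar> \<le> (149/150 * K) * (N i i * d i)"
    if "\<And>k. \<bar>y k\<bar> \<le> K" for y K i
  proof -
    have K: "K \<ge> 0" using that[of 0] by linarith
    have "\<bar>\<Sum>k\<in>{..<i+5} - {i}. N i k * d k * y k\<bar> \<le> (\<Sum>k\<in>{..<i+5} - {i}. \<bar>N i k * d k * y k\<bar>)"
      by (rule sum_abs)
    also have "\<dots> \<le> (\<Sum>k\<in>{..<i+5} - {i}. \<bar>N i k\<bar> * d k * K)"
    proof (rule sum_mono)
      fix k
      have "0 \<le> \<bar>N i k\<bar> * d k" using d_pos[of k] by simp
      then show "\<bar>N i k * d k * y k\<bar> \<le> \<bar>N i k\<bar> * d k * K"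
        unfolding abs_mult using d_pos[of k] by (simp add: mult_left_mono[OF that])
    qed
    also have "\<dots> = (\<Sum>k\<in>{..<i+5} - {i}. \<bar>N i k\<bar> * d k) * K" by (simp add: sum_distrib_right)
    also have "\<dots> \<le> (N i i - 1/50) * d i * K" using dominant K by (intro mult_right_mono)
    also have "\<dots> \<le> (149/150 * N i i) * d i * K"
      using bound[of i i] d_pos[of i] K by (intro mult_right_mono) auto
    finally show ?thesis by (simp add: mult_ac)
  qed
  have J_diff: "\<bar>J y i - J y' i\<bar> \<le> 149/150 * K" if "\<And>k. \<bar>y k - y' k\<bar> \<le> K" for y y' K i
  proof -
    have "J y i - J y' i = - (\<Sum>k\<in>{..<i+5} - {i}. N i k * d k * (y k - y' k)) / (N i i * d i)"
      unfolding J_def by (simp add: diff_divide_distrib[symmetric] sum_subtractf right_diff_distrib)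
    then show ?thesis using contr[of "\<lambda>k. y k - y' k" K i] that Nd[of i]
      by (simp add: abs_divide pos_divide_le_eq)
  qed
  define B where "B = (\<Sum>i<5. \<bar>\<sigma> i / (N i i * d i)\<bar>)"
  have B: "\<bar>\<sigma> i / (N i i * d i)\<bar> \<le> B" for i
  proof (cases "i < 5")
    case True then show ?thesis unfolding B_def by (intro member_le_sum) auto
  next
    case False
    have "0 \<le> B" unfolding B_def by (intro sum_nonneg) auto
    then show ?thesis using False assms[of i] by simp
  qed
  have B0: "B \<ge> 0" using B[of 0] by linarith
  define Y where "Y = (\<lambda>n. (J ^^ n) (\<lambda>_. 0))"
  have Y_Suc: "Y (Suc n) = J (Y n)" for n by (simp add: Y_def)
  have Y_le: "\<bar>Y n i\<bar> \<le> 150 * B" for n i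
  proof (induction n arbitrary: i)
    case (Suc n)
    have "J (Y n) i = \<sigma> i / (N i i * d i) - (\<Sum>k\<in>{..<i+5} - {i}. N i k * d k * Y n k) / (N i i * d i)"
      by (simp add: J_def diff_divide_distrib)
    moreover have "\<bar>(\<Sum>k\<in>{..<i+5} - {i}. N i k * d k * Y n k) / (N i i * d i)\<bar> \<le> 149/150 * (150 * B)"
      using contr[OF Suc, of i] Nd[of i] by (simp add: abs_divide pos_divide_le_eq)
    ultimately show ?case using B[of i] unfolding Y_Suc by linarith
  qed (simp add: Y_def B0)
  have Y_diff: "\<bar>Y (Suc n) i - Y n i\<bar> \<le> (150 * B) * (149/150) ^ n" for n i
  proof (induction n arbitrary: i)
    case 0
    show ?case using Y_le[of 1 i] by (simp add: Y_def)
  next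
    case (Suc n)
    have "\<bar>J (Y (Suc n)) i - J (Y n) i\<bar> \<le> 149/150 * ((150 * B) * (149/150) ^ n)"
      by (rule J_diff) (rule Suc)
    then show ?case by (simp add: Y_Suc mult_ac)
  qed
  have "convergent (\<lambda>n. Y n i)" for i
  proof -
    have "summable (\<lambda>n. (150 * B) * (149/150::real) ^ n)" by (intro summable_mult summable_geometric) auto
    then have "summable (\<lambda>n. Y (Suc n) i - Y n i)"
      by (rule summable_comparison_test'[where N = 0]) (use Y_diff in auto)
    then have "convergent (\<lambda>n. \<Sum>k<n. Y (Suc k) i - Y k i)" by (simp add: summable_iff_convergent)
    then have "convergent (\<lambda>n. Y n i - Y 0 i)" by (simp only: sum_lessThan_telescope[of "\<lambda>n. Y n i"])
    then show ?thesis by (simp add: convergent_diff_const_right_iff)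
  qed
  then obtain y where y_lim: "\<And>i. (\<lambda>n. Y n i) \<longlonglongrightarrow> y i" unfolding convergent_def by metis
  have y_le: "\<bar>y i\<bar> \<le> 150 * B" for i
    using LIMSEQ_le_const2[OF tendsto_rabs[OF y_lim[of i]]] Y_le by blast
  have y: "J y i = y i" for i
  proof (rule LIMSEQ_unique)
    show "(\<lambda>n. Y (Suc n) i) \<longlonglongrightarrow> J y i" unfolding Y_Suc J_def
      using Nd[of i] by (intro tendsto_intros y_lim) auto
    show "(\<lambda>n. Y (Suc n) i) \<longlonglongrightarrow> y i" using y_lim[of i] by (rule LIMSEQ_Suc)
  qed
  define x where "x = (\<lambda>i. d i * y i)"
  have "op x i = \<sigma> i" for i
  proof -
    have "N i i * x i = \<sigma> i - (\<Sum>k\<in>{..<i+5} - {i}. N i k * x k)"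
    proof -
      have "(N i i * d i) * J (y) i = \<sigma> i - (\<Sum>k\<in>{..<i+5} - {i}. N i k * d k * y k)"
        using N_diag[of i] d_pos[of i] by (auto simp: J_def)
      then show ?thesis unfolding y by (simp add: x_def mult.assoc)
    qed
    moreover have "op x i = N i i * x i + (\<Sum>k\<in>{..<i+5} - {i}. N i k * x k)"
      unfolding op_def by (subst sum.remove[of _ i]) auto
    ultimately show ?thesis by simp
  qed
  moreover have "\<bar>x i\<bar> \<le> (16 * (150 * B)) * (1/2) ^ i" for i
  proof -
    have "\<bar>x i\<bar> = d i * \<bar>y i\<bar>" using d_pos[of i] by (simp add: x_def abs_mult)
    also have "\<dots> \<le> (16 * (1/2) ^ i) * (150 * B)"
      by (intro mult_mono d_decay y_le) auto
    finally show ?thesis by (simp add: mult_ac)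
  qed
  ultimately show ?thesis by blast
qed

text \<open>The equation is summed once: the flux \<open>op (diff \<phi>)\<close> must be minus the
  partial sums of \<open>\<omega> j * \<tau> j\<close>. These vanish from index 5 on exactly because
  of the mean condition, so the flux equation has a decaying solution.\<close>

lemma corrector_exists:
  assumes \<tau>0: "\<And>j. j \<ge> 6 \<Longrightarrow> \<tau> j = 0" and orth: "(\<Sum>j<6. \<omega> j * \<tau> j) = 0"
  shows "\<exists>\<phi> K. (\<forall>j. M \<phi> j = \<omega> j * \<tau> j) \<and> (\<forall>n. L2_set \<phi> {..<n} \<le> K)"
proof -
  define \<sigma> where "\<sigma> = (\<lambda>i. - (\<Sum>j<Suc i. \<omega> j * \<tau> j))"
  have "\<sigma> i = 0" if "i \<ge> 5" for i
  proof -
    have "(\<Sum>j<Suc i. \<omega> j * \<tau> j) = (\<Sum>j<6. \<omega> j * \<tau> j)"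
      using that by (intro sum.mono_neutral_right) (auto simp: \<tau>0)
    then show ?thesis using orth by (simp add: \<sigma>_def)
  qed
  then obtain x K where x: "op x = \<sigma>" "\<And>i. \<bar>x i\<bar> \<le> K * (1/2) ^ i" using op_solvable by blast
  have geo: "(\<lambda>i. K * (1/2) ^ (i + j)) sums (2 * K * (1/2) ^ j)" for j
    using sums_mult[OF geometric_sums[of "1/2::real"], of "K * (1/2) ^ j"] by (simp add: power_add mult_ac)
  have sumx: "summable (\<lambda>i. \<bar>x (i + j)\<bar>)" for j
    by (rule summable_comparison_test'[OF sums_summable[OF geo[of j]]]) (simp add: x(2))
  \<comment> \<open>The differences are summed from infinity rather than from 0, which fixes the
    additive constant so that \<open>\<phi>\<close> decays geometrically.\<close>
  define \<phi> where "\<phi> = (\<lambda>j. - (\<Sum>i. x (i + j)))"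
  have diff_phi: "diff \<phi> j = x j" for j
    using suminf_split_head[OF summable_rabs_cancel[OF sumx[of j]]] by (simp add: \<phi>_def diff_def)
  have phi_le: "\<bar>\<phi> j\<bar> \<le> 2 * K * (1/2) ^ j" for j
  proof -
    have "\<bar>\<phi> j\<bar> \<le> (\<Sum>i. \<bar>x (i + j)\<bar>)" unfolding \<phi>_def using summable_rabs[OF sumx[of j]] by simp
    also have "\<dots> \<le> (\<Sum>i. K * (1/2) ^ (i + j))"
      by (intro suminf_le sumx sums_summable[OF geo] x(2))
    also have "\<dots> = 2 * K * (1/2) ^ j" using geo[of j] by (rule sums_unique[symmetric])
    finally show ?thesis .
  qed
  have K0: "K \<ge> 0" using x(2)[of 0] by simp
  have "M \<phi> j = \<omega> j * \<tau> j" for j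
  proof -
    have "op (diff \<phi>) = \<sigma>" using diff_phi x(1) by (metis ext)
    then show ?thesis unfolding M_def by (cases j) (auto simp: \<sigma>_def)
  qed
  moreover have "L2_set \<phi> {..<n} \<le> 4 * K" for n
  proof -
    have "L2_set \<phi> {..<n} \<le> (\<Sum>j<n. \<bar>\<phi> j\<bar>)" by (rule L2_set_le_sum_abs)
    also have "\<dots> \<le> (\<Sum>j<n. 2 * K * (1/2) ^ j)" by (intro sum_mono phi_le)
    also have "\<dots> \<le> (\<Sum>j. 2 * K * (1/2) ^ j)" using K0 by (intro sum_le_suminf) auto
    also have "\<dots> = 4 * K" by (simp add: suminf_mult suminf_geometric)
    finally show ?thesis .
  qed
  ultimately show ?thesis by blast
qed

end

section \<open>The three operators in factored form\<close>

text \<open>With truncated subtraction, (i - k) + (k - i) is the distance of \<open>i\<close> and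
  \<open>k\<close>.\<close>

definition toeplitz :: "real list \<Rightarrow> nat \<Rightarrow> nat \<Rightarrow> real" where
  "toeplitz c i k = (let n = (i - k) + (k - i) in if n < length c then c ! n else 0)"

text \<open>The corner of \<open>N\<close>. The factorization leaves no choice: entry (i, k) of
  \<open>N\<close> is the sum of all entries (j, l) of \<open>M\<close> with j at most i and l at
  most k. For instance for p = 2 the first entry is 11/6 - 2 * 17/48 = 9/8.\<close>

definition sbp_block :: "nat \<Rightarrow> real list list" where
  "sbp_block p =
    (if p = 1 then []
     else if p = 2 then
       [[9/8, - (5/48), - (1/48)],
        [- (5/48), 9/8, - (1/48)],
        [- (1/48), - (1/48), 9/8]]
     else
       [[15583/12960, - (135959/518400), 4907/34560, - (63601/518400), 4207/103680],
        [- (135959/518400), 133147/86400, - (7033/10800), 27059/51840, - (25843/172800)],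
        [4907/34560, - (7033/10800), 12931/5760, - (2533/2700), 1399/6912],
        [- (63601/518400), 27059/51840, - (2533/2700), 450449/259200, - (108911/518400)],
        [4207/103680, - (25843/172800), 1399/6912, - (108911/518400), 37/30]])"

text \<open>In the interior one second difference is split off from the operator. What remains is 1
  - s/12 + s^2/90, cut after p terms, with s the second difference; its coefficients are listed from
  the diagonal outwards.\<close>

definition sbp_symbol :: "nat \<Rightarrow> real list" where
  "sbp_symbol p = (if p = 1 then [1] else if p = 2 then [7/6, - (1/12)] else [37/30, - (23/180), 1/90])"

definition sbp_N :: "nat \<Rightarrow> nat \<Rightarrow> nat \<Rightarrow> real" where
  "sbp_N p i k =
    (if i < length (sbp_block p) \<and> k < length (sbp_block p) then sbp_block p ! i ! k
     else toeplitz (sbp_symbol p) i k)"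

definition sbp_weight :: "nat \<Rightarrow> nat \<Rightarrow> real" where
  "sbp_weight p j = (if j < length (H_weights p) then H_weights p ! j else 1)"

text \<open>Weights for diagonal dominance: without the entry \<open>22/25\<close> it fails in two rows for \<open>p = 3\<close>.\<close>

definition dominance_weight :: "nat \<Rightarrow> real" where
  "dominance_weight i = (if i < 4 then [1, 1, 22/25, 1] ! i else (1/2) ^ (i - 4))"

lemma toeplitz_sym: "toeplitz c i k = toeplitz c k i"
  by (simp add: toeplitz_def add.commute)

lemma length_sbp_block: "length (sbp_block p) \<le> 5"
  by (simp add: sbp_block_def)

lemma sbp_N_sym: "sbp_N p i k = sbp_N p k i"
proof -
  have "\<forall>i<length (sbp_block p). \<forall>k<length (sbp_block p). sbp_block p ! i ! k = sbp_block p ! k ! i"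
    by (simp add: sbp_block_def All_less_Suc)
  then show ?thesis by (auto simp: sbp_N_def toeplitz_sym[of _ i k])
qed

lemma sbp_N_band: "i + 5 \<le> k \<Longrightarrow> sbp_N p i k = 0"
  using length_sbp_block[of p] by (auto simp: sbp_N_def toeplitz_def Let_def sbp_symbol_def)

lemma sbp_N_bound: "\<bar>sbp_N p i k\<bar> \<le> 3"
proof -
  have "\<forall>i<length (sbp_block p). \<forall>k<length (sbp_block p). \<bar>sbp_block p ! i ! k\<bar> \<le> 3"
    by (simp add: sbp_block_def All_less_Suc)
  moreover have "\<forall>i<length (sbp_symbol p). \<bar>sbp_symbol p ! i\<bar> \<le> 3"
    by (simp add: sbp_symbol_def All_less_Suc)
  ultimately show ?thesis by (auto simp: sbp_N_def toeplitz_def Let_def)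
qed

lemma sbp_weight_bounds: "1/4 \<le> sbp_weight p j" "sbp_weight p j \<le> 2"
proof -
  have "\<forall>j<length (H_weights p). 1/4 \<le> H_weights p ! j \<and> H_weights p ! j \<le> 2"
    by (simp add: H_weights_def All_less_Suc)
  then show "1/4 \<le> sbp_weight p j" "sbp_weight p j \<le> 2" by (auto simp: sbp_weight_def)
qed

lemma dominance_weight_small: "\<forall>j<4. 0 < dominance_weight j \<and> dominance_weight j \<le> 16 * (1/2) ^ j"
  by (simp add: dominance_weight_def All_less_Suc eval_nat_numeral)

lemma dominance_weight_pos: "dominance_weight j > 0"
  using dominance_weight_small by (cases "j < 4") (auto simp: dominance_weight_def)

lemma dominance_weight_decay: "dominance_weight j \<le> 16 * (1/2) ^ j"
proof (cases "j < 4")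
  case False
  then obtain k where "j = 4 + k" by (metis le_Suc_ex not_less)
  then show ?thesis by (simp add: dominance_weight_def power_add power_divide)
qed (use dominance_weight_small in auto)

lemma sum_near_diagonal:
  fixes f :: "nat \<Rightarrow> real"
  assumes "\<And>k. k + 2 < i \<or> i + 2 < k \<Longrightarrow> f k = 0" "i \<ge> 2"
  shows "(\<Sum>k<i+5. f k) = f (i-2) + f (i-1) + f i + f (i+1) + f (i+2)"
proof -
  have "(\<Sum>k<i+5. f k) = (\<Sum>k\<in>{i-2, i-1, i, i+1, i+2}. f k)"
  proof (rule sum.mono_neutral_right)
    show "\<forall>k\<in>{..<i+5} - {i-2, i-1, i, i+1, i+2}. f k = 0"
    proof
      fix k assume "k \<in> {..<i+5} - {i-2, i-1, i, i+1, i+2}"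
      then have "k + 2 < i \<or> i + 2 < k" using assms(2) by auto
      then show "f k = 0" by (rule assms(1))
    qed
  qed (use assms(2) in auto)
  also have "\<dots> = f (i-2) + f (i-1) + f i + f (i+1) + f (i+2)"
  proof -
    obtain m where "i = Suc (Suc m)" using assms(2) by (metis add_2_eq_Suc le_Suc_ex)
    then show ?thesis by simp
  qed
  finally show ?thesis .
qed

lemma sbp_N_interior_0:
  assumes "k + 2 < i \<or> i + 2 < k" "i \<ge> 5"
  shows "sbp_N p i k = 0"
  using assms length_sbp_block[of p] by (auto simp: sbp_N_def toeplitz_def Let_def sbp_symbol_def)

lemmas sbp_table_simps = lessThan_nat_numeral sbp_N_def sbp_block_def sbp_symbol_def toeplitz_def
  dominance_weight_def power_divide

lemma sbp_N_dominant:
  "(\<Sum>k\<in>{..<i+5} - {i}. \<bar>sbp_N p i k\<bar> * dominance_weight k) \<le> (sbp_N p i i - 1/50) * dominance_weight i"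
proof -
  have eq: "(\<Sum>k\<in>{..<i+5} - {i}. \<bar>sbp_N p i k\<bar> * dominance_weight k)
      = (\<Sum>k<i+5. if k = i then 0 else \<bar>sbp_N p i k\<bar> * dominance_weight k)"
    by (rule sum.mono_neutral_cong_left) auto
  have p: "p = 1 \<or> p = 2 \<or> p \<noteq> 1 \<and> p \<noteq> 2" by blast
  show ?thesis
  \<comment> \<open>From row 6 on the two neighbours on either side have index at least 4, where the
    weights are purely geometric and the entries Toeplitz, so one computation covers all these
    rows.\<close>
  proof (cases "i < 6")
    case True
    then consider "i = 0" | "i = 1" | "i = 2" | "i = 3" | "i = 4" | "i = 5" by linarith
    then have "(\<Sum>k<i+5. if k = i then 0 else \<bar>sbp_N p i k\<bar> * dominance_weight k)
        \<le> (sbp_N p i i - 1/50) * dominance_weight i" (is ?goal)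
    proof cases
      case 1 show ?goal
        using p by (elim disjE) (simp_all add: 1 sbp_table_simps)
    next
      case 2 show ?goal
        using p by (elim disjE) (simp_all add: 2 sbp_table_simps)
    next
      case 3 show ?goal
        using p by (elim disjE) (simp_all add: 3 sbp_table_simps)
    next
      case 4 show ?goal
        using p by (elim disjE) (simp_all add: 4 sbp_table_simps)
    next
      case 5 show ?goal
        using p by (elim disjE) (simp_all add: 5 sbp_table_simps)
    next
      case 6 show ?goal
        using p by (elim disjE) (simp_all add: 6 sbp_table_simps)
    qed
    then show ?thesis unfolding eq .
  next
    case False
    then obtain m where m: "i = 6 + m" by (metis le_Suc_ex not_less)
    show ?thesis unfolding eq
      by (subst sum_near_diagonal)
         (use m sbp_N_interior_0[of _ i] in \<open>auto simp: sbp_N_def sbp_block_def sbp_symbol_def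
            toeplitz_def dominance_weight_def Let_def power_add power2_eq_square power3_eq_cube power4_eq_xxxx\<close>)
  qed
qed

interpretation sbp: banded_form "sbp_N p" "sbp_weight p" dominance_weight for p
  by unfold_locales
     (rule sbp_N_sym sbp_N_band sbp_N_bound sbp_weight_bounds dominance_weight_pos
       dominance_weight_decay sbp_N_dominant; assumption?)+

lemma dpm_scale: "dpm h v = (\<lambda>j. dpm 1 v j / h\<^sup>2)"
  by (rule ext) (simp add: dpm_def dplus_def dminus_def power2_eq_square diff_divide_distrib add_divide_distrib)

lemma dpm_divide: "dpm 1 (\<lambda>j. v j / c) = (\<lambda>j. dpm 1 v j / c)"
  by (rule ext) (simp add: dpm_def dplus_def dminus_def diff_divide_distrib add_divide_distrib)

lemma dpm_funpow_scale: "(dpm h ^^ n) v = (\<lambda>j. (dpm 1 ^^ n) v j / (h\<^sup>2) ^ n)"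
proof (induction n)
  case (Suc n)
  have "(dpm h ^^ Suc n) v = dpm h (\<lambda>j. (dpm 1 ^^ n) v j / (h\<^sup>2) ^ n)" using Suc by simp
  also have "\<dots> = (\<lambda>j. dpm 1 (\<lambda>j. (dpm 1 ^^ n) v j / (h\<^sup>2) ^ n) j / h\<^sup>2)" by (rule dpm_scale)
  finally show ?case by (simp add: dpm_divide mult.commute)
qed simp

lemma sbp_D_scale: "h > 0 \<Longrightarrow> sbp_D p h v j = sbp_D p 1 v j / h\<^sup>2"
  unfolding sbp_D_def dpm_funpow_scale[where h=h] dpm_scale[where h=h]
  by (simp add: diff_divide_distrib add_divide_distrib power2_eq_square power3_eq_cube power4_eq_xxxx)

lemma sbp_S0_scale: "sbp_S0 p h v = sbp_S0 p 1 v / h"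
  by (simp add: sbp_S0_def)

lemma sbp_H_eq: "sbp_H p h j = h * sbp_weight p j"
  by (simp add: sbp_H_def sbp_weight_def)

lemma sbp_weight_pos: "sbp_weight p j > 0"
  using sbp_weight_bounds(1)[of p j] by linarith

text \<open>\<open>M\<close> scales like 1/h and \<open>H\<close> like h, so the mesh size enters
  the evolution only through the factor h squared.\<close>

lemma sbp_M_scale: "h > 0 \<Longrightarrow> sbp_M p h v j / sbp_H p h j = sbp_M p 1 v j / (h\<^sup>2 * sbp_weight p j)"
proof -
  assume h: "h > 0"
  have "sbp_M p h v j = sbp_M p 1 v j / h"
    unfolding sbp_M_def sbp_H_eq sbp_D_scale[OF h] sbp_S0_scale[of p h]
    using h by (simp add: diff_divide_distrib power2_eq_square)
  then show ?thesis using h by (simp add: sbp_H_eq power2_eq_square mult_ac)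
qed

definition sbp_stencil :: "nat \<Rightarrow> real list" where
  "sbp_stencil p =
    (if p = 1 then [1, - 2, 1]
     else if p = 2 then [- (1/12), 4/3, - (5/2), 4/3, - (1/12)]
     else [1/90, - (3/20), 3/2, - (49/18), 3/2, - (3/20), 1/90])"

lemma dpm_1: "j \<ge> 1 \<Longrightarrow> dpm 1 v j = v (j + 1) - 2 * v j + v (j - 1)"
  by (simp add: dpm_def dplus_def dminus_def)

lemma dpm_1_2: "j \<ge> 2 \<Longrightarrow> (dpm 1 ^^ 2) v j = v (j + 2) - 4 * v (j + 1) + 6 * v j - 4 * v (j - 1) + v (j - 2)"
proof -
  assume "j \<ge> 2"
  then obtain i where "j = Suc (Suc i)" by (metis add_2_eq_Suc le_Suc_ex)
  then show ?thesis by (simp add: numeral_2_eq_2 dpm_1)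
qed

lemma dpm_1_3:
  "j \<ge> 3 \<Longrightarrow> (dpm 1 ^^ 3) v j =
    v (j + 3) - 6 * v (j + 2) + 15 * v (j + 1) - 20 * v j + 15 * v (j - 1) - 6 * v (j - 2) + v (j - 3)"
proof -
  assume "j \<ge> 3"
  then obtain i where i: "j = Suc (Suc (Suc i))" by (metis Suc_le_D numeral_3_eq_3 Suc_le_mono)
  have "(dpm 1 ^^ 3) v j = (dpm 1 ^^ 2) (dpm 1 v) j" by (simp add: eval_nat_numeral)
  also have "\<dots> = v (j + 3) - 6 * v (j + 2) + 15 * v (j + 1) - 20 * v j + 15 * v (j - 1) - 6 * v (j - 2) + v (j - 3)"
    using i by (simp add: dpm_1_2 dpm_1 eval_nat_numeral)
  finally show ?thesis .
qed

lemma sbp_D_interior: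
  assumes "p \<in> {1, 2, 3}" "j \<ge> num_bdry p"
  shows "sbp_D p 1 v j = row_apply (sbp_stencil p) (\<lambda>k. v (j - p + k))"
proof -
  consider "p = 1" "j \<ge> 1" | "p = 2" "j \<ge> 4" | "p = 3" "j \<ge> 6"
    using assms by (auto simp: num_bdry_def)
  then show ?thesis
  proof cases
    case 1
    then obtain i where "j = Suc i" by (metis Suc_le_D One_nat_def)
    then show ?thesis using 1
      by (simp add: sbp_D_def num_bdry_def sbp_stencil_def row_apply_def dpm_1 numeral_3_eq_3)
  next
    case 2
    then obtain i where i: "j = 4 + i" by (metis le_Suc_ex)
    have "sbp_D p 1 v j = dpm 1 v j - 1/12 * (dpm 1 ^^ 2) v j"
      using 2 by (simp add: sbp_D_def num_bdry_def)
    then show ?thesis unfolding i using 2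
      by (simp add: sbp_stencil_def row_apply_def dpm_1 dpm_1_2 eval_nat_numeral field_simps)
  next
    case 3
    then obtain i where i: "j = 6 + i" by (metis le_Suc_ex)
    have "sbp_D p 1 v j = dpm 1 v j - 1/12 * (dpm 1 ^^ 2) v j + 1/90 * (dpm 1 ^^ 3) v j"
      using 3 by (simp add: sbp_D_def num_bdry_def)
    then show ?thesis unfolding i using 3
      by (simp add: sbp_stencil_def row_apply_def dpm_1 dpm_1_2 dpm_1_3 eval_nat_numeral field_simps)
  qed
qed

lemma op_interior:
  assumes "i \<ge> 5"
  shows "sbp.op p x i = sbp_N p i (i-2) * x (i-2) + sbp_N p i (i-1) * x (i-1) + sbp_N p i i * x i
    + sbp_N p i (i+1) * x (i+1) + sbp_N p i (i+2) * x (i+2)"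
  unfolding sbp.op_def using assms by (intro sum_near_diagonal) (auto simp: sbp_N_interior_0)

lemmas sbp_row_simps = sbp_M_def sbp_D_def sbp_H_def sbp_S0_def num_bdry_def H_weights_def D_rows_def
  S_row_def dpm_1 dpm_1_2 sbp.M_def sbp.op_def sbp_N_def sbp_block_def sbp_symbol_def toeplitz_def
  row_apply_def lessThan_nat_numeral diff_def

text \<open>Six is the largest number of boundary rows among the three operators. From there on both
  fluxes in \<open>M\<close> come from rows of \<open>N\<close> outside the corner block, and the
  identity is one between interior stencils; the six rows before are compared entry by
  entry.\<close>

lemma sbp_M_eq:
  assumes p: "p \<in> {1, 2, 3}"
  shows "sbp_M p 1 v j = sbp.M p v j"
proof (cases "j < 6")
  case False
  then obtain i where i: "j = 6 + i" by (metis le_Suc_ex not_less)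
  have D: "sbp_D p 1 v j = row_apply (sbp_stencil p) (\<lambda>k. v (j - p + k))"
    using False p by (intro sbp_D_interior) (auto simp: num_bdry_def)
  have w: "sbp_H p 1 j = 1" using False by (simp add: sbp_H_def H_weights_def)
  show ?thesis
    using p unfolding sbp_M_def D w sbp.M_def unfolding i
    by (elim insertE emptyE)
       (simp_all add: op_interior sbp_N_def sbp_block_def sbp_symbol_def toeplitz_def sbp_stencil_def
         row_apply_def diff_def Let_def eval_nat_numeral field_simps)
next
  case True
  then consider "j = 0" | "j = 1" | "j = 2" | "j = 3" | "j = 4" | "j = 5" by linarith
  then show ?thesis
  proof cases
    case 1 show ?thesis
      using p by (elim insertE emptyE)
        (simp_all add: 1 sbp_row_simps,
         simp_all add: eval_nat_numeral field_simps)
  next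
    case 2 show ?thesis
      using p by (elim insertE emptyE)
        (simp_all add: 2 sbp_row_simps,
         simp_all add: eval_nat_numeral field_simps)
  next
    case 3 show ?thesis
      using p by (elim insertE emptyE)
        (simp_all add: 3 sbp_row_simps,
         simp_all add: eval_nat_numeral field_simps)
  next
    case 4 show ?thesis
      using p by (elim insertE emptyE)
        (simp_all add: 4 sbp_row_simps,
         simp_all add: eval_nat_numeral field_simps)
  next
    case 5 show ?thesis
      using p by (elim insertE emptyE)
        (simp_all add: 5 sbp_row_simps,
         simp_all add: eval_nat_numeral field_simps)
  next
    case 6 show ?thesis
      using p by (elim insertE emptyE)
        (simp_all add: 6 sbp_row_simps,
         simp_all add: eval_nat_numeral field_simps)
  qed
qed

section \<open>The general bound for a part of the error\<close>

lemma L2_set_mono_abs: "(\<And>j. \<bar>x j\<bar> \<le> \<bar>y j\<bar>) \<Longrightarrow> L2_set x A \<le> L2_set y A"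
  unfolding L2_set_def by (intro real_sqrt_le_mono sum_mono) (simp add: abs_le_square_iff)

lemma hnorm_scale: "hnorm h v = sqrt h * hnorm 1 v"
  by (simp add: hnorm_def real_sqrt_mult)

text \<open>Only single components are known to be continuous in time. Integrability of the squared
  norm is therefore obtained by monotone convergence from the truncated sums; without it the
  integral would be 0 by default and the bound void.\<close>

lemma hnorm_integral_bound:
  fixes v :: "real \<Rightarrow> nat \<Rightarrow> real"
  assumes h: "h > 0" and T: "T \<ge> 0"
    and cont: "\<And>j. continuous_on {0..T} (\<lambda>t. v t j)"
    and fin: "\<And>t. t \<in> {0..T} \<Longrightarrow> finite_hnorm (v t)"
    and K: "\<And>t. t \<in> {0..T} \<Longrightarrow> hnorm h (v t) \<le> K"
  shows "(\<lambda>t. (hnorm h (v t))\<^sup>2) integrable_on {0..T}"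
    and "sqrt (integral {0..T} (\<lambda>t. (hnorm h (v t))\<^sup>2)) \<le> sqrt T * K"
proof -
  have sq: "(hnorm h (v t))\<^sup>2 = h * (\<Sum>j. (v t j)\<^sup>2)" if "t \<in> {0..T}" for t
    using fin[OF that] h unfolding hnorm_def finite_hnorm_def by (simp add: suminf_nonneg)
  have nn: "hnorm h (v t) \<ge> 0" if "t \<in> {0..T}" for t using hnorm_nonneg[OF fin[OF that]] h by simp
  have le: "h * (\<Sum>j<n. (v t j)\<^sup>2) \<le> K\<^sup>2" if t: "t \<in> {0..T}" for t n
  proof -
    have "h * (\<Sum>j<n. (v t j)\<^sup>2) \<le> (hnorm h (v t))\<^sup>2"
      unfolding sq[OF t] using fin[OF t] h unfolding finite_hnorm_def
      by (intro mult_left_mono sum_le_suminf) auto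
    also have "\<dots> \<le> K\<^sup>2" using K[OF t] nn[OF t] by (rule power_mono)
    finally show ?thesis .
  qed
  have int: "(\<lambda>t. h * (\<Sum>j<n. (v t j)\<^sup>2)) integrable_on {0..T}" for n
    by (intro integrable_continuous_interval continuous_intros cont)
  have "(\<lambda>t. (hnorm h (v t))\<^sup>2) integrable_on {0..T} \<and>
     ((\<lambda>n. integral {0..T} (\<lambda>t. h * (\<Sum>j<n. (v t j)\<^sup>2))) \<longlonglongrightarrow> integral {0..T} (\<lambda>t. (hnorm h (v t))\<^sup>2))"
  proof (rule monotone_convergence_increasing[OF int])
    show "h * (\<Sum>j<n. (v t j)\<^sup>2) \<le> h * (\<Sum>j<Suc n. (v t j)\<^sup>2)" for n t
      using h by simp
    show "(\<lambda>n. h * (\<Sum>j<n. (v t j)\<^sup>2)) \<longlonglongrightarrow> (hnorm h (v t))\<^sup>2" if "t \<in> {0..T}" for t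
      unfolding sq[OF that] using fin[OF that] unfolding finite_hnorm_def
      by (intro tendsto_intros summable_LIMSEQ)
    show "bounded (range (\<lambda>n. integral {0..T} (\<lambda>t. h * (\<Sum>j<n. (v t j)\<^sup>2))))"
    proof (rule boundedI)
      fix x assume "x \<in> range (\<lambda>n. integral {0..T} (\<lambda>t. h * (\<Sum>j<n. (v t j)\<^sup>2)))"
      then obtain n where x: "x = integral {0..T} (\<lambda>t. h * (\<Sum>j<n. (v t j)\<^sup>2))" by auto
      have "norm x \<le> integral {0..T} (\<lambda>t. K\<^sup>2)"
        unfolding x by (rule integral_norm_bound_integral[OF int]) (use le h in \<open>auto simp: sum_nonneg\<close>)
      then show "norm x \<le> integral {0..T} (\<lambda>t. K\<^sup>2)" .
    qed
  qed
  then show I: "(\<lambda>t. (hnorm h (v t))\<^sup>2) integrable_on {0..T}" by simp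
  have "0 \<in> {0..T}" using T by simp
  then have K0: "K \<ge> 0" using K nn order_trans by blast
  have "integral {0..T} (\<lambda>t. (hnorm h (v t))\<^sup>2) \<le> integral {0..T} (\<lambda>t. K\<^sup>2)"
    using I K nn by (intro integral_le power_mono) auto
  also have "\<dots> = T * K\<^sup>2" using T by simp
  finally have "sqrt (integral {0..T} (\<lambda>t. (hnorm h (v t))\<^sup>2)) \<le> sqrt (T * K\<^sup>2)" by (rule real_sqrt_le_mono)
  then show "sqrt (integral {0..T} (\<lambda>t. (hnorm h (v t))\<^sup>2)) \<le> sqrt T * K"
    using K0 by (simp add: real_sqrt_mult)
qed

lemma weighted_sum_le_product:
  fixes a b e :: real
  assumes "a \<ge> 0" "b \<ge> 0" "e \<ge> 0" "x \<ge> 0" "y \<ge> 0" "z \<ge> 0"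
  shows "a * x + e * z + b * y \<le> (a + b + e) * (x + y + z)"
proof -
  have "0 \<le> a * y + a * z + b * x + b * z + e * x + e * y"
    using assms by (intro add_nonneg_nonneg mult_nonneg_nonneg)
  then show ?thesis by (simp add: algebra_simps)
qed

text \<open>The part \<open>\<alpha> c(t) \<tau>\<close> of the boundary forcing with vanishing weighted mean is the image of
  the decaying grid function \<open>h\<^sup>2 \<alpha> c(t) \<phi>\<close> up to terms of the size of that function; it therefore
  gains two powers of \<open>h\<close>, whereas the remaining boundary forcing \<open>r\<close> gains one.\<close>

theorem error_part_bound:
  fixes \<tau> :: "nat \<Rightarrow> real" and p :: nat and T :: real
  assumes p: "p \<in> {1, 2, 3}" and T: "T \<ge> 0"
    and \<tau>_0: "\<And>j. j \<ge> 6 \<Longrightarrow> \<tau> j = 0" and orth: "(\<Sum>j<6. sbp_weight p j * \<tau> j) = 0"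
  obtains C where "C \<ge> 0"
    and "\<And>h \<epsilon> B r f c c' c'' \<alpha> K \<rho> \<iota>. 0 < h \<Longrightarrow> 0 \<le> \<alpha> \<Longrightarrow> error_part p h B \<epsilon> \<Longrightarrow>
      \<forall>t\<ge>0. finite_hnorm (\<epsilon> t) \<Longrightarrow>
      (\<And>t j. t \<in> {0..T} \<Longrightarrow> B t j = \<alpha> * c t * \<tau> j + r t j + f t j) \<Longrightarrow>
      (\<And>t. t \<in> {0..T} \<Longrightarrow> (c has_real_derivative c' t) (at t within {0..T})) \<Longrightarrow>
      (\<And>t. t \<in> {0..T} \<Longrightarrow> (c' has_real_derivative c'' t) (at t within {0..T})) \<Longrightarrow>
      (\<And>t. t \<in> {0..T} \<Longrightarrow> \<bar>c t\<bar> \<le> K) \<Longrightarrow> (\<And>t. t \<in> {0..T} \<Longrightarrow> \<bar>c' t\<bar> \<le> K) \<Longrightarrow>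
      (\<And>t. t \<in> {0..T} \<Longrightarrow> \<bar>c'' t\<bar> \<le> K) \<Longrightarrow> continuous_on {0..T} c'' \<Longrightarrow>
      (\<And>j. continuous_on {0..T} (\<lambda>t. r t j)) \<Longrightarrow> (\<And>j. continuous_on {0..T} (\<lambda>t. f t j)) \<Longrightarrow>
      (\<And>t j. j \<ge> 6 \<Longrightarrow> r t j = 0) \<Longrightarrow> (\<And>t j. t \<in> {0..T} \<Longrightarrow> \<bar>r t j\<bar> \<le> \<rho>) \<Longrightarrow>
      (\<And>t n. t \<in> {0..T} \<Longrightarrow> L2_set (f t) {..<n} \<le> \<iota>) \<Longrightarrow>
      (\<lambda>t. (hnorm h (\<epsilon> t))\<^sup>2) integrable_on {0..T} \<and>
      sqrt (integral {0..T} (\<lambda>t. (hnorm h (\<epsilon> t))\<^sup>2)) \<le> C * (\<alpha> * K * h\<^sup>2 * sqrt h + h * \<rho> + sqrt h * \<iota>)"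
proof -
  obtain \<phi> \<Phi> where \<phi>: "\<And>j. sbp.M p \<phi> j = sbp_weight p j * \<tau> j" and \<Phi>: "\<And>n. L2_set \<phi> {..<n} \<le> \<Phi>"
    using sbp.corrector_exists[of \<tau> p] \<tau>_0 orth by blast
  have \<Phi>0: "\<Phi> \<ge> 0" using \<Phi>[of 0] by simp
  have "sbp.op p (diff (\<lambda>j. u j - a * \<phi> j)) i = sbp.op p (diff u) i - a * sbp.op p (diff \<phi>) i" for u a i
    unfolding sbp.op_def sum_distrib_left sum_subtractf[symmetric]
    by (rule sum.cong) (auto simp: diff_def algebra_simps)
  then have M_lin: "sbp.M p (\<lambda>j. u j - a * \<phi> j) j = sbp.M p u j - a * sbp.M p \<phi> j" for u a j
    by (simp add: sbp.M_def algebra_simps)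
  define C where "C = sqrt T * ((4 + 18 * T + 18 * T\<^sup>2) * \<Phi> + 576 * T * sqrt T + 18 * T\<^sup>2)"
  have C0: "C \<ge> 0" using T \<Phi>0 by (simp add: C_def)
  have main: "(\<lambda>t. (hnorm h (\<epsilon> t))\<^sup>2) integrable_on {0..T} \<and>
      sqrt (integral {0..T} (\<lambda>t. (hnorm h (\<epsilon> t))\<^sup>2)) \<le> C * (\<alpha> * K * h\<^sup>2 * sqrt h + h * \<rho> + sqrt h * \<iota>)"
    if h: "0 < h" and \<alpha>: "0 \<le> \<alpha>" and err: "error_part p h B \<epsilon>" and fin: "\<forall>t\<ge>0. finite_hnorm (\<epsilon> t)"
      and B: "\<And>t j. t \<in> {0..T} \<Longrightarrow> B t j = \<alpha> * c t * \<tau> j + r t j + f t j"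
      and c: "\<And>t. t \<in> {0..T} \<Longrightarrow> (c has_real_derivative c' t) (at t within {0..T})"
         "\<And>t. t \<in> {0..T} \<Longrightarrow> (c' has_real_derivative c'' t) (at t within {0..T})"
      and cK: "\<And>t. t \<in> {0..T} \<Longrightarrow> \<bar>c t\<bar> \<le> K" "\<And>t. t \<in> {0..T} \<Longrightarrow> \<bar>c' t\<bar> \<le> K" "\<And>t. t \<in> {0..T} \<Longrightarrow> \<bar>c'' t\<bar> \<le> K"
      and c''_cont: "continuous_on {0..T} c''"
      and r_cont: "\<And>j. continuous_on {0..T} (\<lambda>t. r t j)" and f_cont: "\<And>j. continuous_on {0..T} (\<lambda>t. f t j)"
      and r0: "\<And>t j. j \<ge> 6 \<Longrightarrow> r t j = 0" and \<rho>: "\<And>t j. t \<in> {0..T} \<Longrightarrow> \<bar>r t j\<bar> \<le> \<rho>"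
      and \<iota>: "\<And>t n. t \<in> {0..T} \<Longrightarrow> L2_set (f t) {..<n} \<le> \<iota>"
    for h \<epsilon> B r f c c' c'' \<alpha> K \<rho> \<iota>
  proof -
    obtain w where w: "\<And>j. \<epsilon> 0 j = 0" "\<And>j. w 0 j = 0"
      "\<And>t j. t \<ge> 0 \<Longrightarrow> ((\<lambda>s. \<epsilon> s j) has_real_derivative w t j) (at t within {0..})"
      "\<And>t j. t \<ge> 0 \<Longrightarrow> ((\<lambda>s. w s j) has_real_derivative - (sbp_M p h (\<epsilon> t) j / sbp_H p h j) + B t j) (at t within {0..})"
      using err unfolding error_part_def second_order_ivp_def by metis
    define k where "k = h\<^sup>2 * \<alpha>"
    have k0: "k \<ge> 0" using \<alpha> by (simp add: k_def)
    have T0: "0 \<in> {0..T}" using T by simp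
    have K0: "K \<ge> 0" using cK(1)[OF T0] by linarith
    have rho0: "\<rho> \<ge> 0" using \<rho>[OF T0, of 0] by linarith
    have iota0: "\<iota> \<ge> 0" using \<iota>[OF T0, of 0] by simp
    \<comment> \<open>Subtracting the corrector spoils the zero initial data, which is why the
      energy estimate admits initial values of \<open>z\<close> and its velocity.\<close>
    define z where "z = (\<lambda>t j. \<epsilon> t j - k * c t * \<phi> j)"
    define z' where "z' = (\<lambda>t j. w t j - k * c' t * \<phi> j)"
    \<comment> \<open>Since \<open>\<phi>\<close> does not depend on time, the corrector leaves only
      its second time derivative as a new forcing, of the size of the corrector itself.\<close>
    define F where "F = (\<lambda>t j. f t j - k * c'' t * \<phi> j)"
    have z: "((\<lambda>s. z s j) has_real_derivative z' t j) (at t within {0..T})" if t: "t \<in> {0..T}" for t j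
      unfolding z_def z'_def using t
      by (intro DERIV_diff DERIV_cmult_right DERIV_cmult c DERIV_subset[OF w(3)]) auto
    have z': "((\<lambda>s. z' s j) has_real_derivative - (sbp.M p (z t) j / (h\<^sup>2 * sbp_weight p j)) + F t j + r t j) (at t within {0..T})"
      if t: "t \<in> {0..T}" for t j
    proof -
      have "((\<lambda>s. z' s j) has_real_derivative (- (sbp_M p h (\<epsilon> t) j / sbp_H p h j) + B t j) - k * c'' t * \<phi> j) (at t within {0..T})"
        unfolding z'_def using t
        by (intro DERIV_diff DERIV_cmult_right DERIV_cmult c DERIV_subset[OF w(4)]) auto
      moreover have "sbp_M p h (\<epsilon> t) j / sbp_H p h j = sbp.M p (z t) j / (h\<^sup>2 * sbp_weight p j) + \<alpha> * c t * \<tau> j"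
        unfolding sbp_M_scale[OF h] sbp_M_eq[OF p] z_def M_lin \<phi> k_def
        using h sbp_weight_pos[of p j] by (simp add: field_simps)
      ultimately show ?thesis using B[OF t, of j] by (simp add: F_def algebra_simps)
    qed
    have k_phi: "L2_set (\<lambda>j. k * x * \<phi> j) {..<n} \<le> k * K * \<Phi>" if "\<bar>x\<bar> \<le> K" for x n
    proof -
      have "L2_set (\<lambda>j. k * x * \<phi> j) {..<n} = k * \<bar>x\<bar> * L2_set \<phi> {..<n}"
        using k0 by (simp add: L2_set_scale abs_mult)
      also have "\<dots> \<le> k * K * \<Phi>"
        using k0 K0 that \<Phi> by (intro mult_mono) (auto simp: L2_set_nonneg)
      finally show ?thesis .
    qed
    have sub: "L2_set (\<lambda>j. u j - v j) {..<n} \<le> L2_set u {..<n} + L2_set v {..<n}" for u v :: "nat \<Rightarrow> real" and n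
      using L2_set_triangle_ineq[of u "\<lambda>j. - v j" "{..<n}"] by (simp add: L2_set_def)
    have F_L2: "L2_set (F t) {..<n} \<le> \<iota> + k * K * \<Phi>" if "t \<in> {0..T}" for t n
      unfolding F_def by (rule order_trans[OF sub add_mono[OF \<iota>[OF that] k_phi[OF cK(3)[OF that]]]])
    have z_fin: "finite_hnorm (z t)" if t: "t \<in> {0..T}" for t
    proof -
      have "L2_set (z t) {..<n} \<le> hnorm 1 (\<epsilon> t) + k * K * \<Phi>" for n
        unfolding z_def
        by (rule order_trans[OF sub add_mono[OF L2_set_le_hnorm k_phi]]) (use t fin cK in auto)
      then have bd: "(\<Sum>j<n. (z t j)\<^sup>2) \<le> (hnorm 1 (\<epsilon> t) + k * K * \<Phi>)\<^sup>2" for n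
        unfolding sum_sq_eq_L2 by (intro power_mono L2_set_nonneg)
      show ?thesis unfolding finite_hnorm_def
        by (rule summableI_nonneg_bounded[OF _ bd]) auto
    qed
    have r_L2: "L2_set (r t) {..<n} \<le> 6 * \<rho>" if t: "t \<in> {0..T}" for t n
    proof -
      have "L2_set (r t) {..<n} \<le> (\<Sum>j<n. \<bar>r t j\<bar>)" by (rule L2_set_le_sum_abs)
      also have "\<dots> \<le> (\<Sum>j<max n 6. \<bar>r t j\<bar>)" by (intro sum_mono2) auto
      also have "\<dots> = (\<Sum>j<6. \<bar>r t j\<bar>)" by (intro sum.mono_neutral_right) (auto simp: r0)
      also have "\<dots> \<le> (\<Sum>j<6::nat. \<rho>)" by (intro sum_mono \<rho> t)
      finally show ?thesis by simp
    qed
    \<comment> \<open>The acceleration is bounded by the norm with the constant 800 = 4 * 200, from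
      the least weight and the operator bound, over h squared. That this is useless for small h does
      no harm: \<open>Z\<close> is needed for finiteness only.\<close>
    obtain Z where Z: "\<forall>t\<in>{0..T}. hnorm 1 (z t) \<le> Z"
    proof -
      have "\<exists>Z. \<forall>t\<in>{0..T}. hnorm 1 (z t) \<le> Z"
      proof (rule pointwise_l2_imp_bounded[OF z z' z_fin])
        show "L2_set (\<lambda>j. - (sbp.M p (z t) j / (h\<^sup>2 * sbp_weight p j)) + F t j + r t j) {..<n}
            \<le> (800 / h\<^sup>2) * hnorm 1 (z t) + (\<iota> + k * K * \<Phi> + 6 * \<rho>)" if t: "t \<in> {0..T}" for t n
        proof -
          have "L2_set (\<lambda>j. - (sbp.M p (z t) j / (h\<^sup>2 * sbp_weight p j))) {..<n} \<le> L2_set (\<lambda>j. (4 / h\<^sup>2) * sbp.M p (z t) j) {..<n}"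
          proof (rule L2_set_mono_abs)
            fix j
            have "1 / sbp_weight p j \<le> 4" using sbp_weight_bounds(1)[of p j] by (simp add: field_simps)
            then have "1 / sbp_weight p j * (\<bar>sbp.M p (z t) j\<bar> / h\<^sup>2) \<le> 4 * (\<bar>sbp.M p (z t) j\<bar> / h\<^sup>2)"
              by (intro mult_right_mono) auto
            then show "\<bar>- (sbp.M p (z t) j / (h\<^sup>2 * sbp_weight p j))\<bar> \<le> \<bar>4 / h\<^sup>2 * sbp.M p (z t) j\<bar>"
              using sbp_weight_pos[of p j] by (simp add: abs_mult abs_divide mult.commute[of "h\<^sup>2"])
          qed
          also have "\<dots> = (4 / h\<^sup>2) * L2_set (sbp.M p (z t)) {..<n}" unfolding L2_set_scale by simp
          also have "\<dots> \<le> (4 / h\<^sup>2) * (200 * hnorm 1 (z t))"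
            by (intro mult_left_mono order_trans[OF sbp.M_L2_bound] L2_set_le_hnorm z_fin t) auto
          finally have 1: "L2_set (\<lambda>j. - (sbp.M p (z t) j / (h\<^sup>2 * sbp_weight p j))) {..<n} \<le> (800 / h\<^sup>2) * hnorm 1 (z t)"
            by simp
          show ?thesis
            by (rule order_trans[OF L2_set_triangle_ineq], rule order_trans[OF add_right_mono[OF L2_set_triangle_ineq]])
               (use 1 F_L2[OF t, of n] r_L2[OF t, of n] in linarith)
        qed
      qed (use h iota0 k0 K0 \<Phi>0 rho0 in auto)
      then show ?thesis using that by blast
    qed
    have zb: "L2_set (z t) {..<n} \<le> 3 * (k * K * \<Phi> + 6 * T * (k * K * \<Phi> + T * (\<iota> + k * K * \<Phi>)) + 192 * T * sqrt (T * h) * \<rho>)"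
      if t: "t \<in> {0..T}" for t n
    proof (rule sbp.energy_estimate[OF h T z z'])
      show "continuous_on {0..T} (\<lambda>t. F t j)" for j
        unfolding F_def by (intro continuous_intros f_cont c''_cont)
      show "L2_set (z 0) {..<n} \<le> k * K * \<Phi>" for n
        using k_phi[OF cK(1)[OF T0], of n] by (simp add: z_def w(1) L2_set_def)
      show "L2_set (z' 0) {..<n} \<le> k * K * \<Phi>" for n
        using k_phi[OF cK(2)[OF T0], of n] by (simp add: z'_def w(2) L2_set_def)
      show "L2_set (z t) {..<n} \<le> Z" if "t \<in> {0..T}" for t n
        using Z that L2_set_le_hnorm[OF z_fin[OF that], of n] by force
    qed (use r_cont F_L2 r0 \<rho> t in auto)
    define E where "E = 3 * (k * K * \<Phi> + 6 * T * (k * K * \<Phi> + T * (\<iota> + k * K * \<Phi>)) + 192 * T * sqrt (T * h) * \<rho>) + k * K * \<Phi>"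
    have E0: "E \<ge> 0" using T h k0 K0 \<Phi>0 iota0 rho0 by (simp add: E_def)
    have eps: "hnorm h (\<epsilon> t) \<le> sqrt h * E" if t: "t \<in> {0..T}" for t
    proof -
      have "L2_set (\<epsilon> t) {..<n} \<le> E" for n
      proof -
        have "L2_set (\<epsilon> t) {..<n} = L2_set (\<lambda>j. z t j + k * c t * \<phi> j) {..<n}" by (simp add: z_def)
        also have "\<dots> \<le> E" unfolding E_def
          by (rule order_trans[OF L2_set_triangle_ineq add_mono[OF zb[OF t] k_phi[OF cK(1)[OF t]]]])
        finally show ?thesis .
      qed
      then have "hnorm 1 (\<epsilon> t) \<le> E" using hnorm_le_iff[of "\<epsilon> t" E] fin t E0 by auto
      then show ?thesis unfolding hnorm_scale[of h] using h by simp
    qed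
    have cont: "continuous_on {0..T} (\<lambda>t. \<epsilon> t j)" for j
      by (rule DERIV_continuous_on[where D="\<lambda>t. w t j"]) (auto intro: DERIV_subset[OF w(3)])
    \<comment> \<open>The factor sqrt h of the norm and sqrt (T h) from the Sobolev inequality
      combine to the full power of \<open>h\<close> in front of \<open>\<rho>\<close>.\<close>
    have E_le: "sqrt T * (sqrt h * E) \<le> C * (\<alpha> * K * h\<^sup>2 * sqrt h + h * \<rho> + sqrt h * \<iota>)"
    proof -
      define X where "X = \<alpha> * K * h\<^sup>2 * sqrt h"
      have X: "sqrt h * (k * K) = X" by (simp add: X_def k_def mult_ac)
      have sh: "sqrt h * sqrt (T * h) = sqrt T * h" using h T by (simp add: real_sqrt_mult)
      have "sqrt h * E = (4 + 18 * T + 18 * T\<^sup>2) * \<Phi> * (sqrt h * (k * K)) + 18 * T\<^sup>2 * (sqrt h * \<iota>)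
          + 576 * T * (sqrt h * sqrt (T * h)) * \<rho>"
        by (simp add: E_def algebra_simps power2_eq_square)
      also have "\<dots> = (4 + 18 * T + 18 * T\<^sup>2) * \<Phi> * X + 18 * T\<^sup>2 * (sqrt h * \<iota>) + 576 * T * sqrt T * (h * \<rho>)"
        unfolding X sh by simp
      also have "\<dots> \<le> ((4 + 18 * T + 18 * T\<^sup>2) * \<Phi> + 576 * T * sqrt T + 18 * T\<^sup>2) * (X + h * \<rho> + sqrt h * \<iota>)"
        using T \<Phi>0 h \<alpha> K0 rho0 iota0 by (intro weighted_sum_le_product) (auto simp: X_def)
      finally have "sqrt T * (sqrt h * E) \<le> sqrt T * (((4 + 18 * T + 18 * T\<^sup>2) * \<Phi> + 576 * T * sqrt T + 18 * T\<^sup>2) * (X + h * \<rho> + sqrt h * \<iota>))"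
        using T by (intro mult_left_mono) auto
      then show ?thesis by (simp add: C_def X_def mult.assoc)
    qed
    show ?thesis
      using hnorm_integral_bound[OF h T cont _ eps] fin E_le by auto
  qed
  show thesis by (rule that[OF C0 main])
qed

subsection \<open>Smooth solutions and finite speed of propagation\<close>

abbreviation quadrant :: "(real \<times> real) set" where
  "quadrant \<equiv> {0..} \<times> {0..}"

lemma at_within_halfline_ne_bot: "x \<ge> 0 \<Longrightarrow> at x within {0::real..} \<noteq> bot"
proof
  assume "x \<ge> 0" and bot: "at x within {0..} = bot"
  have "at_right x \<le> at x within {0..}" using \<open>x \<ge> 0\<close> by (intro at_le) auto
  then show False using bot trivial_limit_at_right_real[of x] by (simp add: bot_unique)
qed

lemma dpos_eqI: "(f has_real_derivative D) (at x within {0..}) \<Longrightarrow> x \<ge> 0 \<Longrightarrow> dpos f x = D"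
  unfolding dpos_def has_real_derivative_iff_has_vector_derivative
  by (rule vector_derivative_within[OF at_within_halfline_ne_bot])

lemma has_derivative_dpos:
  "f differentiable (at x within {0..}) \<Longrightarrow> (f has_real_derivative dpos f x) (at x within {0..})"
  unfolding dpos_def has_real_derivative_iff_has_vector_derivative
  by (simp add: vector_derivative_works)

lemma dx_apply: "dx V x t = dpos (\<lambda>y. V y t) x"
  by (simp add: dx_def)

lemma dt_apply: "dt V x t = dpos (\<lambda>s. V x s) t"
  by (simp add: dt_def)

lemma differentiable_sections:
  assumes "(\<lambda>z. V (fst z) (snd z)) differentiable (at (x, t) within quadrant)" "x \<ge> 0" "t \<ge> (0::real)"
  shows "(\<lambda>y. V y t :: real) differentiable (at x within {0..})" "(\<lambda>s. V x s) differentiable (at t within {0..})"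
proof -
  have "((\<lambda>z. V (fst z) (snd z)) \<circ> (\<lambda>y. (y, t))) differentiable (at x within {0..})"
  proof (rule differentiable_chain_within)
    show "(\<lambda>z. V (fst z) (snd z)) differentiable (at (x, t) within (\<lambda>y. (y, t)) ` {0..})"
      by (rule differentiable_within_subset[OF assms(1)]) (use assms in auto)
    show "(\<lambda>y. (y, t)) differentiable at x within {0..}" by (intro derivative_intros)
  qed
  then show "(\<lambda>y. V y t) differentiable (at x within {0..})" by (simp add: o_def)
  have "((\<lambda>z. V (fst z) (snd z)) \<circ> (\<lambda>s. (x, s))) differentiable (at t within {0..})"
  proof (rule differentiable_chain_within)
    show "(\<lambda>z. V (fst z) (snd z)) differentiable (at (x, t) within (\<lambda>s. (x, s)) ` {0..})"
      by (rule differentiable_within_subset[OF assms(1)]) (use assms in auto)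
    show "(\<lambda>s. (x, s)) differentiable at t within {0..}" by (intro derivative_intros)
  qed
  then show "(\<lambda>s. V x s) differentiable (at t within {0..})" by (simp add: o_def)
qed

lemma smooth_quadrantD:
  assumes "smooth_quadrant U" "x \<ge> 0" "t \<ge> 0"
  shows "(\<lambda>z. ((dx ^^ i) ((dt ^^ k) U)) (fst z) (snd z)) differentiable (at (x, t) within quadrant)"
  using assms unfolding smooth_quadrant_def differentiable_on_def by auto

lemma smooth_quadrant_continuous:
  "smooth_quadrant U \<Longrightarrow> continuous_on quadrant (\<lambda>z. ((dx ^^ i) ((dt ^^ k) U)) (fst z) (snd z))"
  unfolding smooth_quadrant_def by (blast intro: differentiable_imp_continuous_on)

lemma smooth_has_dx:
  assumes "smooth_quadrant U" "x \<ge> 0" "t \<ge> 0"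
  shows "((\<lambda>y. ((dx ^^ i) ((dt ^^ k) U)) y t) has_real_derivative ((dx ^^ Suc i) ((dt ^^ k) U)) x t) (at x within {0..})"
  using has_derivative_dpos[OF differentiable_sections(1)[OF smooth_quadrantD[OF assms, of i k] assms(2,3)]]
  by (simp add: dx_apply[of "(dx ^^ i) ((dt ^^ k) U)"])

lemma smooth_has_dt_0:
  assumes "smooth_quadrant U" "x \<ge> 0" "t \<ge> 0"
  shows "((\<lambda>s. ((dt ^^ k) U) x s) has_real_derivative ((dt ^^ Suc k) U) x t) (at t within {0..})"
  using has_derivative_dpos[OF differentiable_sections(2)[OF smooth_quadrantD[OF assms, of 0 k] assms(2,3)]]
  by (simp add: dt_apply[of "(dt ^^ k) U"])

lemma smooth_section_continuous:
  assumes "smooth_quadrant U" "x \<ge> 0"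
  shows "continuous_on {0..} (\<lambda>s. ((dx ^^ i) ((dt ^^ k) U)) x s)"
proof -
  have "continuous_on {0..} (\<lambda>s. (x, s))" by (intro continuous_intros)
  then show ?thesis
    using continuous_on_compose2[OF smooth_quadrant_continuous[OF assms(1), of i k], of "{0..}" "Pair x"] assms(2)
    by auto
qed

text \<open>Equality of mixed partial derivatives: \<open>\<partial>\<^sub>x\<^sup>i V\<close> is written as a time integral of \<open>\<partial>\<^sub>x\<^sup>i \<partial>\<^sub>t V\<close>
  and differentiated under the integral sign.\<close>

lemma smooth_has_dt:
  assumes U: "smooth_quadrant U" and "x \<ge> 0" "t \<ge> 0"
  shows "((\<lambda>s. ((dx ^^ i) ((dt ^^ k) U)) x s) has_real_derivative ((dx ^^ i) ((dt ^^ Suc k) U)) x t) (at t within {0..})"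
  using assms(2,3)
proof (induction i arbitrary: x t)
  case 0
  then show ?case using smooth_has_dt_0[OF U, of x t k] by simp
next
  case (Suc i)
  define V where "V = (dx ^^ i) ((dt ^^ k) U)"
  define W where "W = (dx ^^ i) ((dt ^^ Suc k) U)"
  define W1 where "W1 = (dx ^^ Suc i) ((dt ^^ Suc k) U)"
  have V_eq: "V y s = V y 0 + integral {0..s} (W y)" if "y \<ge> 0" "s \<ge> 0" for y s
  proof -
    have "(W y has_integral V y s - V y 0) {0..s}"
    proof (rule fundamental_theorem_of_calculus)
      show "(V y has_vector_derivative W y r) (at r within {0..s})" if "r \<in> {0..s}" for r
        using Suc.IH[OF \<open>y \<ge> 0\<close>, of r] that
        unfolding V_def W_def has_real_derivative_iff_has_vector_derivative
        by (auto intro: has_vector_derivative_within_subset)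
    qed (use that in auto)
    then show ?thesis by (simp add: integral_unique)
  qed
  have W1_cont: "continuous_on quadrant (\<lambda>z. W1 (fst z) (snd z))"
    unfolding W1_def by (rule smooth_quadrant_continuous[OF U])
  have dxV: "((dx ^^ Suc i) ((dt ^^ k) U)) x s = ((dx ^^ Suc i) ((dt ^^ k) U)) x 0 + integral {0..s} (W1 x)"
    if s: "s \<ge> 0" for s
  proof -
    have "((\<lambda>y. integral (cbox 0 s) (W y)) has_field_derivative integral (cbox 0 s) (W1 x)) (at x within {0..})"
    proof (rule leibniz_rule_field_derivative)
      show "((\<lambda>y. W y r) has_real_derivative W1 y r) (at y within {0..})" if "y \<in> {0..}" "r \<in> cbox 0 s" for y r
        unfolding W_def W1_def using that by (intro smooth_has_dx[OF U]) auto
      show "W y integrable_on cbox 0 s" if "y \<in> {0..}" for y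
        unfolding W_def cbox_interval using that
        by (intro integrable_continuous_interval continuous_on_subset[OF smooth_section_continuous[OF U]]) auto
      show "continuous_on ({0..} \<times> cbox 0 s) (\<lambda>(y, r). W1 y r)"
        unfolding case_prod_beta' by (rule continuous_on_subset[OF W1_cont]) auto
    qed (use Suc.prems in auto)
    then have "((\<lambda>y. V y 0 + integral {0..s} (W y)) has_real_derivative ((dx ^^ Suc i) ((dt ^^ k) U)) x 0 + integral {0..s} (W1 x)) (at x within {0..})"
      unfolding V_def cbox_interval using Suc.prems by (intro DERIV_add smooth_has_dx[OF U]) auto
    then have "((\<lambda>y. V y s) has_real_derivative ((dx ^^ Suc i) ((dt ^^ k) U)) x 0 + integral {0..s} (W1 x)) (at x within {0..})"
    proof (rule has_field_derivative_transform_within[where d=1])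
      show "V y 0 + integral {0..s} (W y) = V y s" if "y \<in> {0..}" for y
        using V_eq[of y s] that s by simp
    qed (use Suc.prems in auto)
    then have "dpos (\<lambda>y. V y s) x = ((dx ^^ Suc i) ((dt ^^ k) U)) x 0 + integral {0..s} (W1 x)"
      using Suc.prems by (intro dpos_eqI)
    moreover have "((dx ^^ Suc i) ((dt ^^ k) U)) x s = dpos (\<lambda>y. V y s) x"
      unfolding V_def funpow.simps o_apply by (rule dx_apply)
    ultimately show ?thesis by simp
  qed
  have W1x_cont: "continuous_on {0..t + 1} (W1 x)"
    unfolding W1_def using Suc.prems by (intro continuous_on_subset[OF smooth_section_continuous[OF U]]) auto
  have "((\<lambda>s. integral {0..s} (W1 x)) has_real_derivative W1 x t) (at t within {0..t + 1})"
    using Suc.prems by (intro integral_has_real_derivative[OF W1x_cont]) auto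
  then have "((\<lambda>s. ((dx ^^ Suc i) ((dt ^^ k) U)) x 0 + integral {0..s} (W1 x)) has_real_derivative W1 x t) (at t within {0..t + 1})"
    using DERIV_add[OF DERIV_const] by fastforce
  then have "((\<lambda>s. ((dx ^^ Suc i) ((dt ^^ k) U)) x s) has_real_derivative W1 x t) (at t within {0..t + 1})"
  proof (rule has_field_derivative_transform_within[where d=1])
    show "((dx ^^ Suc i) ((dt ^^ k) U)) x 0 + integral {0..s} (W1 x) = ((dx ^^ Suc i) ((dt ^^ k) U)) x s"
      if "s \<in> {0..t + 1}" for s
      using dxV[of s] that by simp
  qed (use Suc.prems in auto)
  moreover have "at t within {0..t + 1} = at t within {0..}"
    by (rule at_within_nhd[of t "{..<t + 1}"]) (use Suc.prems in auto)
  ultimately show ?case by (simp add: W1_def)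
qed

text \<open>Differentiability within the quadrant gives some linear map \<open>D\<close>. Its values
  on the coordinate vectors are identified by restriction to the coordinate half-lines, where
  one-sided derivatives are unique. The slopes \<sigma> = 1 and \<sigma> = -1 are the two
  characteristic directions.\<close>

lemma has_derivative_along_line:
  assumes V: "(\<lambda>z. V (fst z) (snd z)) differentiable (at (a + \<sigma> * s, s) within quadrant)"
    and Vx: "((\<lambda>y. V y s) has_real_derivative Dx) (at (a + \<sigma> * s) within {0..})"
    and Vt: "((\<lambda>r. V (a + \<sigma> * s) r) has_real_derivative Dt) (at s within {0..})"
    and line: "\<And>r. r \<in> {0..\<theta>} \<Longrightarrow> 0 \<le> a + \<sigma> * r" and s: "s \<in> {0..\<theta>}"
  shows "((\<lambda>r. V (a + \<sigma> * r) r) has_real_derivative \<sigma> * Dx + Dt) (at s within {0..\<theta>})"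
proof -
  define x where "x = a + \<sigma> * s"
  have x: "x \<ge> 0" "s \<ge> 0" using line[OF s] s by (auto simp: x_def)
  obtain D where D: "((\<lambda>z. V (fst z) (snd z)) has_derivative D) (at (x, s) within quadrant)"
    using V unfolding x_def differentiable_def by blast
  have lin: "linear D" using D has_derivative_linear by blast
  have through: "((\<lambda>r. V (fst (\<gamma> r)) (snd (\<gamma> r))) has_real_derivative D v) (at s0 within S)"
    if "(\<gamma> has_derivative (\<lambda>r. r *\<^sub>R v)) (at s0 within S)" "\<gamma> ` S \<subseteq> quadrant" "\<gamma> s0 = (x, s)"
    for \<gamma> :: "real \<Rightarrow> real \<times> real" and v s0 S
  proof -
    have "((\<lambda>z. V (fst z) (snd z)) has_derivative D) (at (\<gamma> s0) within \<gamma> ` S)"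
      using has_derivative_subset[OF D that(2)] that(3) by simp
    then have "((\<lambda>z. V (fst z) (snd z)) \<circ> \<gamma> has_derivative D \<circ> (\<lambda>r. r *\<^sub>R v)) (at s0 within S)"
      using that(1) by (intro diff_chain_within)
    moreover have "D \<circ> (\<lambda>r. r *\<^sub>R v) = (\<lambda>r. D v * r)"
      using linear_scale[OF lin] by (auto simp: fun_eq_iff mult.commute)
    ultimately show ?thesis by (simp add: has_field_derivative_def o_def)
  qed
  have "((\<lambda>y. V (fst (y, s)) (snd (y, s))) has_real_derivative D (1, 0)) (at x within {0..})"
    using x by (intro through) (auto intro!: derivative_eq_intros)
  then have Dx: "D (1, 0) = Dx"
    using dpos_eqI[of "\<lambda>y. V y s"] Vx x by (simp add: x_def) (metis dpos_eqI)
  have "((\<lambda>r. V (fst (x, r)) (snd (x, r))) has_real_derivative D (0, 1)) (at s within {0..})"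
    using x by (intro through) (auto intro!: derivative_eq_intros)
  then have Dt: "D (0, 1) = Dt"
    using Vt x by (simp add: x_def) (metis dpos_eqI)
  have "((\<lambda>r. V (fst (a + \<sigma> * r, r)) (snd (a + \<sigma> * r, r))) has_real_derivative D (\<sigma>, 1)) (at s within {0..\<theta>})"
    using line by (intro through) (auto intro!: derivative_eq_intros simp: x_def mult.commute)
  moreover have "D (\<sigma>, 1) = \<sigma> * Dx + Dt"
  proof -
    have "(\<sigma>, 1) = \<sigma> *\<^sub>R (1, 0) + (0, 1::real)" by simp
    then have "D (\<sigma>, 1) = \<sigma> *\<^sub>R D (1, 0) + D (0, 1)" by (simp only: linear_add[OF lin] linear_scale[OF lin])
    then show ?thesis by (simp add: Dx Dt)
  qed
  ultimately show ?thesis by simp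
qed

lemma constant_on_interval:
  fixes g :: "real \<Rightarrow> real"
  assumes "\<And>s. s \<in> {0..\<theta>} \<Longrightarrow> (g has_real_derivative 0) (at s within {0..\<theta>})" "\<theta> \<ge> 0"
  shows "g \<theta> = g 0"
proof -
  obtain c where "\<And>s. s \<in> {0..\<theta>} \<Longrightarrow> g s = c"
    using has_field_derivative_zero_constant[of "{0..\<theta>}" g] assms(1) by auto
  then show ?thesis using assms(2) by auto
qed

text \<open>Ahead of the characteristic \<open>x = X + t\<close> no data act: \<open>U\<^sub>t + U\<^sub>x\<close> is constant along incoming
  characteristics, hence zero, and then \<open>U\<close> is constant along outgoing ones.\<close>

lemma finite_propagation_speed:
  assumes data: "wave_data F f1 f2 g" and sol: "wave_solution F f1 f2 g U"
  obtains X where "X \<ge> 0" "\<And>x t. t \<ge> 0 \<Longrightarrow> x > X + t \<Longrightarrow> U x t = 0"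
proof -
  have U: "smooth_quadrant U" using sol by (simp add: wave_solution_def)
  have eqn: "dt (dt U) x t = dx (dx U) x t + F x t" if "x \<ge> 0" "t \<ge> 0" for x t
    using sol that by (simp add: wave_solution_def)
  have init: "U x 0 = f1 x" "dt U x 0 = f2 x" if "x \<ge> 0" for x
    using sol that by (auto simp: wave_solution_def)
  obtain X1 where X1: "\<And>x. x \<in> {0..} \<Longrightarrow> f1 x \<noteq> 0 \<Longrightarrow> \<bar>x\<bar> \<le> X1"
    using data unfolding wave_data_def compact_support_halfline_def bounded_iff by auto
  obtain X2 where X2: "\<And>x. x \<in> {0..} \<Longrightarrow> f2 x \<noteq> 0 \<Longrightarrow> \<bar>x\<bar> \<le> X2"
    using data unfolding wave_data_def compact_support_halfline_def bounded_iff by auto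
  obtain X3 where X3: "\<And>z. z \<in> {(x, t) \<in> quadrant. F x t \<noteq> 0} \<Longrightarrow> norm z \<le> X3"
    using data unfolding wave_data_def compact_support_quadrant_def bounded_iff by blast
  define X where "X = max 0 (max X1 (max X2 X3))"
  have f1: "f1 x = 0" if "x > X" for x using X1[of x] that by (force simp: X_def)
  have f2: "f2 x = 0" if "x > X" for x using X2[of x] that by (force simp: X_def)
  have F: "F x t = 0" if "x > X" "t \<ge> 0" for x t
  proof (rule ccontr)
    assume "F x t \<noteq> 0"
    then have "norm (x, t) \<le> X3" using that by (intro X3) (auto simp: X_def)
    moreover have "\<bar>x\<bar> \<le> norm (x, t)" using norm_fst_le[of x t] by simp
    ultimately show False using that by (auto simp: X_def)
  qed
  have X0: "X \<ge> 0" by (simp add: X_def)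
  have Udiff: "(\<lambda>z. V (fst z) (snd z)) differentiable (at (x, t) within quadrant)"
    if "V \<in> {U, dt U, dx U}" "x \<ge> 0" "t \<ge> 0" for V x t
    using smooth_quadrantD[OF U that(2,3), of 0 0] smooth_quadrantD[OF U that(2,3), of 0 1]
      smooth_quadrantD[OF U that(2,3), of 1 0] that(1) by auto
  have d: "((\<lambda>y. U y t) has_real_derivative dx U x t) (at x within {0..})"
    "((\<lambda>s. U x s) has_real_derivative dt U x t) (at t within {0..})"
    "((\<lambda>y. dx U y t) has_real_derivative dx (dx U) x t) (at x within {0..})"
    "((\<lambda>s. dx U x s) has_real_derivative dx (dt U) x t) (at t within {0..})"
    "((\<lambda>y. dt U y t) has_real_derivative dx (dt U) x t) (at x within {0..})"
    "((\<lambda>s. dt U x s) has_real_derivative dt (dt U) x t) (at t within {0..})"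
    if "x \<ge> 0" "t \<ge> 0" for x t
    using smooth_has_dx[OF U that, of 0 0] smooth_has_dt[OF U that, of 0 0]
      smooth_has_dx[OF U that, of 1 0] smooth_has_dt[OF U that, of 1 0]
      smooth_has_dx[OF U that, of 0 1] smooth_has_dt[OF U that, of 0 1] by simp_all
  have dx0: "dx U x 0 = 0" if x: "x > X" for x
  proof -
    have "((\<lambda>y. 0) has_real_derivative 0) (at x within {0..})" by simp
    then have "((\<lambda>y. U y 0) has_real_derivative 0) (at x within {0..})"
    proof (rule has_field_derivative_transform_within)
      show "0 = U y 0" if "y \<in> {0..}" "dist y x < x - X" for y
        using that init(1)[of y] f1[of y] by (auto simp: dist_real_def)
    qed (use x X0 in auto)
    then show ?thesis using dpos_eqI x X0 by (simp add: dx_apply)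
  qed
  have W0: "dt U x t + dx U x t = 0" if t: "t \<ge> 0" and xt: "x > X + t" for x t
  proof -
    define a where "a = x + t"
    define G where "G = (\<lambda>s. dt U (a + (- 1) * s) s + dx U (a + (- 1) * s) s)"
    have pos: "a + (- 1) * s > X" if "s \<in> {0..t}" for s using that xt by (simp add: a_def)
    have pos0: "0 \<le> a + (- 1) * s" if "s \<in> {0..t}" for s using pos[OF that] X0 by linarith
    have "(G has_real_derivative 0) (at s within {0..t})" if s: "s \<in> {0..t}" for s
    proof -
      define y where "y = a + (- 1) * s"
      have y: "y > X" "y \<ge> 0" "s \<ge> 0" using pos[OF s] pos0[OF s] s by (auto simp: y_def)
      \<comment> \<open>The mixed terms cancel because both partial orders have been identified with
        \<open>dx (dt U)\<close>; what remains is \<open>F\<close>, which vanishes here.\<close>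
      have "(G has_real_derivative ((- 1) * dx (dt U) y s + dt (dt U) y s) + ((- 1) * dx (dx U) y s + dx (dt U) y s)) (at s within {0..t})"
        unfolding G_def y_def
        by (intro DERIV_add has_derivative_along_line Udiff d pos0 s) (use y in \<open>auto simp: y_def\<close>)
      moreover have "((- 1) * dx (dt U) y s + dt (dt U) y s) + ((- 1) * dx (dx U) y s + dx (dt U) y s) = 0"
        using eqn[of y s] y F by simp
      ultimately show ?thesis by simp
    qed
    then have "G t = G 0" using t by (intro constant_on_interval)
    moreover have "a > X" using pos[of 0] t by simp
    ultimately show ?thesis using dx0[of a] init(2)[of a] f2[of a] X0 by (simp add: G_def a_def)
  qed
  have "U x t = 0" if t: "t \<ge> 0" and xt: "x > X + t" for x t
  proof -
    define a where "a = x - t"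
    have a: "a > X" using xt by (simp add: a_def)
    have "((\<lambda>r. U (a + 1 * r) r) has_real_derivative 0) (at s within {0..t})" if s: "s \<in> {0..t}" for s
    proof -
      have "((\<lambda>r. U (a + 1 * r) r) has_real_derivative 1 * dx U (a + 1 * s) s + dt U (a + 1 * s) s) (at s within {0..t})"
        by (intro has_derivative_along_line Udiff d s) (use s a X0 in auto)
      moreover have "dt U (a + 1 * s) s + dx U (a + 1 * s) s = 0" using s a by (intro W0) auto
      ultimately show ?thesis by (simp add: add.commute)
    qed
    then have "U (a + 1 * t) t = U (a + 1 * 0) 0" using t by (intro constant_on_interval) auto
    then show ?thesis using init(1)[of a] f1[of a] a X0 by (simp add: a_def)
  qed
  then show ?thesis using that X0 by blast
qed

subsection \<open>Truncation errors\<close>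

text \<open>The nodes are centred at \<open>a\<close>, in units of the mesh: 0 for the boundary
  rows, p for the interior stencil. The row \<open>[1]\<close> with a = - j evaluates a function at
  the node \<open>j\<close> while expanding about 0.\<close>

definition moment :: "real list \<Rightarrow> real \<Rightarrow> nat \<Rightarrow> real" where
  "moment r a i = (\<Sum>k<length r. r ! k * (real k - a) ^ i)"

definition abs_moment :: "real list \<Rightarrow> real \<Rightarrow> nat \<Rightarrow> real" where
  "abs_moment r a i = (\<Sum>k<length r. \<bar>r ! k\<bar> * \<bar>real k - a\<bar> ^ i)"

lemma abs_moment_nonneg: "abs_moment r a i \<ge> 0"
  unfolding abs_moment_def by (intro sum_nonneg) auto

text \<open>A stencil acts on the Taylor polynomial through its moments, so consistency becomes a
  finite list of rational identities. The factorial in the remainder is dropped.\<close>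

lemma stencil_taylor:
  fixes f :: "nat \<Rightarrow> real \<Rightarrow> real"
  assumes f: "\<And>i x. x \<in> {0..X} \<Longrightarrow> i \<le> n \<Longrightarrow> (f i has_real_derivative f (Suc i) x) (at x within {0..X})"
    and K: "\<And>x. x \<in> {0..X} \<Longrightarrow> \<bar>f (Suc n) x\<bar> \<le> K"
    and x0: "x0 \<in> {0..X}" and nodes: "\<And>k. k < length r \<Longrightarrow> x0 + (real k - a) * h \<in> {0..X}" and h: "h \<ge> 0"
  shows "\<bar>row_apply r (\<lambda>k. f 0 (x0 + (real k - a) * h)) - (\<Sum>i\<le>n. moment r a i / fact i * h ^ i * f i x0)\<bar>
    \<le> abs_moment r a (Suc n) * K * h ^ Suc n"
proof -
  have K0: "K \<ge> 0" using K[OF x0] by linarith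
  have poly: "(\<Sum>i\<le>n. moment r a i / fact i * h ^ i * f i x0)
      = (\<Sum>k<length r. r ! k * (\<Sum>i\<le>n. f i x0 * ((real k - a) * h) ^ i / fact i))"
    unfolding moment_def sum_distrib_left sum_distrib_right sum_divide_distrib
    by (subst sum.swap) (simp add: power_mult_distrib mult_ac)
  have "row_apply r (\<lambda>k. f 0 (x0 + (real k - a) * h)) - (\<Sum>i\<le>n. moment r a i / fact i * h ^ i * f i x0)
      = (\<Sum>k<length r. r ! k * (f 0 (x0 + (real k - a) * h) - (\<Sum>i\<le>n. f i x0 * ((real k - a) * h) ^ i / fact i)))"
    unfolding row_apply_def poly sum_subtractf[symmetric] right_diff_distrib ..
  also have "\<bar>\<dots>\<bar> \<le> (\<Sum>k<length r. \<bar>r ! k\<bar> * (K * (\<bar>real k - a\<bar> * h) ^ Suc n))"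
  proof (rule order_trans[OF sum_abs sum_mono])
    fix k assume "k \<in> {..<length r}"
    then have k: "x0 + (real k - a) * h \<in> {0..X}" using nodes by simp
    have "norm (f 0 (x0 + (real k - a) * h) - (\<Sum>i\<le>n. f i x0 * ((x0 + (real k - a) * h) - x0) ^ i / fact i))
        \<le> K * norm ((x0 + (real k - a) * h) - x0) ^ Suc n / fact n"
      by (rule field_Taylor[of "{0..X}"]) (use f K x0 k in auto)
    also have "\<dots> \<le> K * norm ((x0 + (real k - a) * h) - x0) ^ Suc n"
    proof -
      have "K * norm ((x0 + (real k - a) * h) - x0) ^ Suc n * 1 \<le> K * norm ((x0 + (real k - a) * h) - x0) ^ Suc n * fact n"
        using K0 by (intro mult_left_mono fact_ge_1) auto
      then show ?thesis by (simp add: divide_le_eq)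
    qed
    finally have "\<bar>f 0 (x0 + (real k - a) * h) - (\<Sum>i\<le>n. f i x0 * ((real k - a) * h) ^ i / fact i)\<bar>
        \<le> K * (\<bar>real k - a\<bar> * h) ^ Suc n"
      using h by (simp add: abs_mult)
    then show "\<bar>r ! k * (f 0 (x0 + (real k - a) * h) - (\<Sum>i\<le>n. f i x0 * ((real k - a) * h) ^ i / fact i))\<bar>
        \<le> \<bar>r ! k\<bar> * (K * (\<bar>real k - a\<bar> * h) ^ Suc n)"
      unfolding abs_mult by (intro mult_left_mono) auto
  qed
  also have "\<dots> = abs_moment r a (Suc n) * K * h ^ Suc n"
    unfolding abs_moment_def sum_distrib_right by (intro sum.cong refl) (simp only: power_mult_distrib mult_ac)
  finally show ?thesis .
qed

section \<open>Consistency of the boundary and interior stencils\<close>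

text \<open>The first unmatched moment of each boundary row: component \<open>j\<close> of the
  truncation error is \<open>sbp_tau p j\<close> times h^p times the spatial derivative of order p +
  2 at the boundary, up to O(h^(p+1)). Component 0 includes the penalty term. For p = 1 it is -1 +
  2/3.\<close>

definition sbp_tau :: "nat \<Rightarrow> nat \<Rightarrow> real" where
  "sbp_tau p j =
    (let c = (if p = 1 then [- (1/3)]
       else if p = 2 then [43/204, - (1/12), 5/516, 11/588]
       else [- (53845/163788), 3869/17580, - (30409/54220), 65723/321540, - (80821/472620), 9015/175204])
     in if j < length c then c ! j else 0)"

lemma sbp_tau_0: "j \<ge> num_bdry p \<Longrightarrow> sbp_tau p j = 0"
  by (simp add: sbp_tau_def num_bdry_def split: if_splits)

text \<open>The quadrature \<open>H\<close> has order \<open>2 p\<close>, so for \<open>p \<ge> 2\<close> the leading boundary truncation error has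
  vanishing weighted mean.\<close>

lemma sbp_tau_orthogonal: "p \<in> {2, 3} \<Longrightarrow> (\<Sum>j<6. sbp_weight p j * sbp_tau p j) = 0"
  by (elim insertE emptyE) (simp_all add: lessThan_nat_numeral sbp_weight_def H_weights_def sbp_tau_def Let_def)

text \<open>All moment conditions of the boundary closures at once, with \<open>f i\<close> standing
  for the derivative of order i at 0: orders up to p + 1 cancel, and order p + 2 leaves
  \<open>sbp_tau\<close>.\<close>

lemma boundary_polynomial_part:
  fixes f :: "nat \<Rightarrow> real"
  assumes "p \<in> {1, 2, 3}" "j < num_bdry p"
  shows "h\<^sup>2 * (\<Sum>i\<le>p. moment [1] (- real j) i / fact i * h ^ i * f (i + 2))
      - (\<Sum>i\<le>p+2. moment (D_rows p ! j) 0 i / fact i * h ^ i * f i)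
      - (if j = 0 then ((\<Sum>i\<le>p+2. moment (S_row p) 0 i / fact i * h ^ i * f i) - h * f 1) / sbp_weight p 0 else 0)
      = sbp_tau p j * h ^ (p + 2) * f (p + 2)"
proof -
  consider "p = 1" "j = 0" | "p = 2" "j = 0" | "p = 2" "j = 1" | "p = 2" "j = 2" | "p = 2" "j = 3"
    | "p = 3" "j = 0" | "p = 3" "j = 1" | "p = 3" "j = 2" | "p = 3" "j = 3" | "p = 3" "j = 4" | "p = 3" "j = 5"
    using assms by (auto simp: num_bdry_def less_Suc_eq eval_nat_numeral)
  then show ?thesis
    by cases
      (simp_all add: moment_def D_rows_def S_row_def sbp_weight_def H_weights_def sbp_tau_def Let_def
        lessThan_nat_numeral atMost_nat_numeral fact_numeral power2_eq_square,
       simp_all add: field_simps eval_nat_numeral)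
qed

lemma boundary_rows_length:
  assumes "j < num_bdry p"
  shows "length (D_rows p ! j) \<le> 9"
proof -
  have "\<forall>j<num_bdry p. length (D_rows p ! j) \<le> 9"
    by (simp add: num_bdry_def D_rows_def All_less_Suc eval_nat_numeral)
  then show ?thesis using assms by blast
qed

text \<open>One constant for all rows. For p = 1, 2 the six terms reach beyond the table
  \<open>D_rows p\<close>; the values there are unspecified but nonnegative, so each genuine row is
  still bounded by the sum.\<close>

definition boundary_constant :: "nat \<Rightarrow> real" where
  "boundary_constant p = (\<Sum>j<6. abs_moment [1] (- real j) (p + 1) + abs_moment (D_rows p ! j) 0 (p + 3)
     + abs_moment (S_row p) 0 (p + 3) / sbp_weight p 0)"

lemma boundary_constant_nonneg: "boundary_constant p \<ge> 0"
  unfolding boundary_constant_def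
  by (intro sum_nonneg add_nonneg_nonneg divide_nonneg_nonneg abs_moment_nonneg less_imp_le[OF sbp_weight_pos])

lemma boundary_stencil_error:
  fixes f :: "nat \<Rightarrow> real \<Rightarrow> real"
  assumes p: "p \<in> {1, 2, 3}" and j: "j < num_bdry p"
    and f: "\<And>i x. x \<in> {0..X} \<Longrightarrow> i \<le> p + 2 \<Longrightarrow> (f i has_real_derivative f (Suc i) x) (at x within {0..X})"
    and K: "\<And>x. x \<in> {0..X} \<Longrightarrow> \<bar>f (p + 3) x\<bar> \<le> K"
    and h: "h > 0" "8 * h \<le> X"
  shows "\<bar>h\<^sup>2 * f 2 (real j * h) - row_apply (D_rows p ! j) (\<lambda>k. f 0 (real k * h))
      - (if j = 0 then (row_apply (S_row p) (\<lambda>k. f 0 (real k * h)) - h * f 1 0) / sbp_weight p 0 else 0)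
      - sbp_tau p j * h ^ (p + 2) * f (p + 2) 0\<bar> \<le> boundary_constant p * K * h ^ (p + 3)"
proof -
  have X: "0 \<in> {0..X}" using h by auto
  have K0: "K \<ge> 0" using K[OF X] by linarith
  have node: "real k * h \<in> {0..X}" if "k \<le> 8" for k
  proof -
    have "real k * h \<le> 8 * h" using that h by (intro mult_right_mono) auto
    then have "real k * h \<le> X" using h by linarith
    then show ?thesis using h by simp
  qed
  have j6: "j < 6" using j by (simp add: num_bdry_def split: if_splits)
  define a1 where "a1 = abs_moment [1] (- real j) (p + 1)"
  define a2 where "a2 = abs_moment (D_rows p ! j) 0 (p + 3)"
  define a3 where "a3 = abs_moment (S_row p) 0 (p + 3) / sbp_weight p 0"
  define Y where "Y = K * h ^ (p + 3)"
  have Y0: "Y \<ge> 0" using K0 h by (simp add: Y_def)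
  define P1 where "P1 = (\<Sum>i\<le>p. moment [1] (- real j) i / fact i * h ^ i * f (i + 2) 0)"
  define P2 where "P2 = (\<Sum>i\<le>p+2. moment (D_rows p ! j) 0 i / fact i * h ^ i * f i 0)"
  define P3 where "P3 = (\<Sum>i\<le>p+2. moment (S_row p) 0 i / fact i * h ^ i * f i 0)"
  \<comment> \<open>The second derivative at node \<open>j\<close> is also expanded about 0, to
    order p only, because it is multiplied by h squared.\<close>
  have "\<bar>row_apply [1] (\<lambda>k. f (0 + 2) (0 + (real k - (- real j)) * h)) - P1\<bar> \<le> a1 * K * h ^ Suc p"
    unfolding P1_def a1_def Suc_eq_plus1[symmetric]
    by (rule stencil_taylor[where f = "\<lambda>i. f (i + 2)" and X = X])
       (use f K X h node[of j] j6 in \<open>auto simp: eval_nat_numeral\<close>)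
  then have "\<bar>f 2 (real j * h) - P1\<bar> \<le> a1 * K * h ^ Suc p" by (simp add: row_apply_def numeral_2_eq_2)
  then have "h\<^sup>2 * \<bar>f 2 (real j * h) - P1\<bar> \<le> h\<^sup>2 * (a1 * K * h ^ Suc p)" by (intro mult_left_mono) auto
  moreover have "h\<^sup>2 * (a1 * K * h ^ Suc p) = a1 * Y"
    by (simp add: Y_def power_add power2_eq_square power3_eq_cube)
  moreover have "\<bar>h\<^sup>2 * f 2 (real j * h) - h\<^sup>2 * P1\<bar> = h\<^sup>2 * \<bar>f 2 (real j * h) - P1\<bar>"
    by (simp add: abs_mult flip: right_diff_distrib)
  ultimately have 1: "\<bar>h\<^sup>2 * f 2 (real j * h) - h\<^sup>2 * P1\<bar> \<le> a1 * Y" by linarith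
  have "\<bar>row_apply (D_rows p ! j) (\<lambda>k. f 0 (0 + (real k - 0) * h)) - P2\<bar>
      \<le> abs_moment (D_rows p ! j) 0 (Suc (p + 2)) * K * h ^ Suc (p + 2)"
    unfolding P2_def
  proof (rule stencil_taylor[where X = X])
    show "0 + (real k - 0) * h \<in> {0..X}" if "k < length (D_rows p ! j)" for k
      using node[of k] that boundary_rows_length[OF j] by simp
  qed (use f K X h in \<open>auto simp: eval_nat_numeral\<close>)
  then have 2: "\<bar>row_apply (D_rows p ! j) (\<lambda>k. f 0 (real k * h)) - P2\<bar> \<le> a2 * Y"
    by (simp add: a2_def Y_def eval_nat_numeral mult_ac)
  have "\<bar>row_apply (S_row p) (\<lambda>k. f 0 (0 + (real k - 0) * h)) - P3\<bar>
      \<le> abs_moment (S_row p) 0 (Suc (p + 2)) * K * h ^ Suc (p + 2)"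
    unfolding P3_def
  proof (rule stencil_taylor[where X = X])
    show "0 + (real k - 0) * h \<in> {0..X}" if "k < length (S_row p)" for k
      using node[of k] that by (simp add: S_row_def split: if_splits)
  qed (use f K X h in \<open>auto simp: eval_nat_numeral\<close>)
  then have "\<bar>row_apply (S_row p) (\<lambda>k. f 0 (real k * h)) - P3\<bar> \<le> abs_moment (S_row p) 0 (p + 3) * Y"
    by (simp add: Y_def eval_nat_numeral mult_ac)
  then have "\<bar>row_apply (S_row p) (\<lambda>k. f 0 (real k * h)) - P3\<bar> / sbp_weight p 0 \<le> abs_moment (S_row p) 0 (p + 3) * Y / sbp_weight p 0"
    using sbp_weight_pos[of p 0] by (intro divide_right_mono) auto
  then have 3: "\<bar>(row_apply (S_row p) (\<lambda>k. f 0 (real k * h)) - h * f 1 0) / sbp_weight p 0 - (P3 - h * f 1 0) / sbp_weight p 0\<bar> \<le> a3 * Y"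
    using sbp_weight_pos[of p 0] by (simp add: a3_def abs_divide flip: diff_divide_distrib)
  have poly: "h\<^sup>2 * P1 - P2 - (if j = 0 then (P3 - h * f 1 0) / sbp_weight p 0 else 0) = sbp_tau p j * h ^ (p + 2) * f (p + 2) 0"
    unfolding P1_def P2_def P3_def by (rule boundary_polynomial_part[OF p j, of h "\<lambda>i. f i 0"])
  have "\<bar>h\<^sup>2 * f 2 (real j * h) - row_apply (D_rows p ! j) (\<lambda>k. f 0 (real k * h))
      - (if j = 0 then (row_apply (S_row p) (\<lambda>k. f 0 (real k * h)) - h * f 1 0) / sbp_weight p 0 else 0)
      - sbp_tau p j * h ^ (p + 2) * f (p + 2) 0\<bar> \<le> a1 * Y + a2 * Y + a3 * Y"
  proof -
    have "0 \<le> a3 * Y" using 3 by (rule order_trans[OF abs_ge_zero])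
    then have 4: "\<bar>(if j = 0 then (row_apply (S_row p) (\<lambda>k. f 0 (real k * h)) - h * f 1 0) / sbp_weight p 0 else 0)
        - (if j = 0 then (P3 - h * f 1 0) / sbp_weight p 0 else 0)\<bar> \<le> a3 * Y"
      using 3 by (cases "j = 0") (simp_all only: if_True if_False simp_thms diff_self abs_zero)
    have triangle: "\<bar>a - b - c - (a' - b' - c')\<bar> \<le> u + v + w"
      if "\<bar>a - a'\<bar> \<le> u" "\<bar>b - b'\<bar> \<le> v" "\<bar>c - c'\<bar> \<le> w" for a b c a' b' c' u v w :: real
      using that by linarith
    show ?thesis unfolding poly[symmetric] by (rule triangle[OF 1 2 4])
  qed
  also have "\<dots> = (a1 + a2 + a3) * Y" by (simp add: algebra_simps)
  also have "\<dots> \<le> boundary_constant p * Y"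
    unfolding boundary_constant_def a1_def a2_def a3_def using j6
    by (intro mult_right_mono Y0 member_le_sum[of j "{..<6}" "\<lambda>j. abs_moment [1] (- real j) (p + 1) + abs_moment (D_rows p ! j) 0 (p + 3)
     + abs_moment (S_row p) 0 (p + 3) / sbp_weight p 0"] add_nonneg_nonneg divide_nonneg_nonneg abs_moment_nonneg less_imp_le[OF sbp_weight_pos]) auto
  finally show ?thesis by (simp add: Y_def mult.assoc)
qed

text \<open>About the centre \<open>p\<close> the odd moments vanish by symmetry, and the even ones
  other than the second vanish up to order 2 p; hence exactness through order 2 p + 1.\<close>

lemma interior_polynomial_part:
  fixes f :: "nat \<Rightarrow> real"
  assumes "p \<in> {1, 2, 3}"
  shows "(\<Sum>i\<le>2*p+1. moment (sbp_stencil p) (real p) i / fact i * h ^ i * f i) = h\<^sup>2 * f 2"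
  using assms
  by (elim insertE emptyE)
     (simp_all add: moment_def sbp_stencil_def lessThan_nat_numeral atMost_nat_numeral fact_numeral)

lemma interior_stencil_error:
  fixes f :: "nat \<Rightarrow> real \<Rightarrow> real"
  assumes p: "p \<in> {1, 2, 3}" and j: "j \<ge> num_bdry p"
    and f: "\<And>i x. x \<in> {0..X} \<Longrightarrow> i \<le> 2 * p + 1 \<Longrightarrow> (f i has_real_derivative f (Suc i) x) (at x within {0..X})"
    and K: "\<And>x. x \<in> {0..X} \<Longrightarrow> \<bar>f (2 * p + 2) x\<bar> \<le> K"
    and h: "h > 0" "real (j + p) * h \<le> X"
  shows "\<bar>h\<^sup>2 * f 2 (real j * h) - row_apply (sbp_stencil p) (\<lambda>k. f 0 (real (j - p + k) * h))\<bar>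
      \<le> abs_moment (sbp_stencil p) (real p) (2 * p + 2) * K * h ^ (2 * p + 2)"
proof -
  have jp: "j \<ge> p" using p j by (auto simp: num_bdry_def)
  have node: "real j * h + (real k - real p) * h = real (j - p + k) * h" for k
    using jp by (simp add: of_nat_diff algebra_simps)
  have in_X: "real i * h \<in> {0..X}" if "i \<le> j + p" for i
  proof -
    have "real i * h \<le> real (j + p) * h" using that h by (intro mult_right_mono) auto
    then have "real i * h \<le> X" using h by linarith
    then show ?thesis using h by simp
  qed
  have len: "length (sbp_stencil p) = 2 * p + 1" using p by (auto simp: sbp_stencil_def)
  have "\<bar>row_apply (sbp_stencil p) (\<lambda>k. f 0 (real j * h + (real k - real p) * h)) -
      (\<Sum>i\<le>2*p+1. moment (sbp_stencil p) (real p) i / fact i * h ^ i * f i (real j * h))\<bar>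
      \<le> abs_moment (sbp_stencil p) (real p) (Suc (2*p+1)) * K * h ^ Suc (2*p+1)"
  proof (rule stencil_taylor[where X = X])
    show "real j * h + (real k - real p) * h \<in> {0..X}" if "k < length (sbp_stencil p)" for k
      unfolding node using that len jp by (intro in_X) auto
  qed (use f K h in_X[of j] in auto)
  then show ?thesis
    unfolding interior_polynomial_part[OF p] node by (simp add: abs_minus_commute)
qed

section \<open>The truncation error of the solution\<close>

lemma sbp_D_row:
  assumes "p \<in> {1, 2, 3}" "h > 0"
  shows "sbp_D p h v j = (if j < num_bdry p then row_apply (D_rows p ! j) v
     else row_apply (sbp_stencil p) (\<lambda>k. v (j - p + k))) / h\<^sup>2"
proof (cases "j < num_bdry p")
  case False
  then show ?thesis
    using sbp_D_scale[OF assms(2), of p v j] sbp_D_interior[OF assms(1), of j v] by simp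
qed (simp add: sbp_D_def)

lemma row_apply_diff: "row_apply r (\<lambda>k. u k - v k) = row_apply r u - row_apply r v"
  by (simp add: row_apply_def right_diff_distrib sum_subtractf)

lemma continuous_on_row_apply:
  "(\<And>k. continuous_on S (\<lambda>t. v t k)) \<Longrightarrow> continuous_on S (\<lambda>t. row_apply r (v t))"
  unfolding row_apply_def by (intro continuous_intros)

text \<open>The differential equation trades the time derivative and \<open>F\<close> for the second
  space derivative, and the boundary condition trades \<open>g\<close> for the first. The truncation
  error becomes a purely spatial defect at a fixed time.\<close>

lemma truncation_error_eq:
  assumes "wave_solution F f1 f2 g U" "t \<ge> 0" "h > 0"
  shows "truncation_error p F g U h t j = dx (dx U) (real j * h) t - sbp_D p h (\<lambda>i. U (real i * h) t) j
    - (if j = 0 then (sbp_S0 p h (\<lambda>i. U (real i * h) t) - dx U 0 t) / sbp_H p h 0 else 0)"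
  using assms by (simp add: truncation_error_def sat_rhs_def wave_solution_def)

lemma truncation_error_continuous:
  assumes p: "p \<in> {1, 2, 3}" and sol: "wave_solution F f1 f2 g U" and h: "h > 0"
  shows "continuous_on {0..T} (\<lambda>t. truncation_error p F g U h t j)"
proof -
  have U: "smooth_quadrant U" using sol by (simp add: wave_solution_def)
  have c: "continuous_on {0..T} (\<lambda>t. ((dx ^^ i) ((dt ^^ k) U)) x t)" if "x \<ge> 0" for i k x
    by (rule continuous_on_subset[OF smooth_section_continuous[OF U that]]) auto
  have c0: "continuous_on {0..T} (\<lambda>t. U (real i * h) t)" for i
    using c[of "real i * h" 0 0] h by simp
  have "continuous_on {0..T} (\<lambda>t. dx (dx U) (real j * h) t - sbp_D p h (\<lambda>i. U (real i * h) t) j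
    - (if j = 0 then (sbp_S0 p h (\<lambda>i. U (real i * h) t) - dx U 0 t) / sbp_H p h 0 else 0))"
  proof -
    have "continuous_on {0..T} (\<lambda>t. sbp_D p h (\<lambda>i. U (real i * h) t) j)"
      unfolding sbp_D_row[OF p h] using h
      by (cases "j < num_bdry p") (auto intro!: continuous_intros continuous_on_row_apply c0 simp del: of_nat_add)
    moreover have "continuous_on {0..T} (\<lambda>t. (sbp_S0 p h (\<lambda>i. U (real i * h) t) - dx U 0 t) / sbp_H p h 0)"
      unfolding sbp_S0_def using h sbp_weight_pos[of p 0] c[of 0 1 0]
      by (auto intro!: continuous_intros continuous_on_row_apply c0 simp: sbp_H_eq)
    moreover have "continuous_on {0..T} (\<lambda>t. dx (dx U) (real j * h) t)"
      using c[of "real j * h" 2 0] h by (simp add: numeral_2_eq_2)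
    ultimately show ?thesis by (cases "j = 0") (auto intro!: continuous_intros)
  qed
  then show ?thesis
    by (rule continuous_on_cong[THEN iffD1, rotated -1]) (use truncation_error_eq[OF sol _ h] in auto)
qed

lemma smooth_bounded:
  assumes "smooth_quadrant U"
  obtains K where "\<And>x t. x \<in> {0..X} \<Longrightarrow> t \<in> {0..T} \<Longrightarrow> \<bar>((dx ^^ i) ((dt ^^ k) U)) x t\<bar> \<le> K"
proof -
  have "continuous_on ({0..X} \<times> {0..T}) (\<lambda>z. ((dx ^^ i) ((dt ^^ k) U)) (fst z) (snd z))"
    by (rule continuous_on_subset[OF smooth_quadrant_continuous[OF assms]]) auto
  then have "bounded ((\<lambda>z. ((dx ^^ i) ((dt ^^ k) U)) (fst z) (snd z)) ` ({0..X} \<times> {0..T}))"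
    by (intro compact_imp_bounded compact_continuous_image compact_Times compact_Icc)
  then obtain K where "\<forall>x\<in>{0..X}. \<forall>t\<in>{0..T}. \<bar>((dx ^^ i) ((dt ^^ k) U)) x t\<bar> \<le> K"
    unfolding bounded_iff by auto
  then show ?thesis using that[of K] by blast
qed

lemma truncation_boundary:
  assumes p: "p \<in> {1, 2, 3}" and sol: "wave_solution F f1 f2 g U" and j: "j < num_bdry p"
    and t: "t \<ge> 0" and h: "h > 0" "8 * h \<le> X"
    and K: "\<And>x. x \<in> {0..X} \<Longrightarrow> \<bar>((dx ^^ (p + 3)) U) x t\<bar> \<le> K"
  shows "\<bar>truncation_error p F g U h t j - h ^ p * sbp_tau p j * ((dx ^^ (p + 2)) U) 0 t\<bar>
    \<le> boundary_constant p * K * h ^ (p + 1)"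
proof -
  have U: "smooth_quadrant U" using sol by (simp add: wave_solution_def)
  define f where "f = (\<lambda>i x. ((dx ^^ i) U) x t)"
  define L where "L = h\<^sup>2 * f 2 (real j * h) - row_apply (D_rows p ! j) (\<lambda>k. f 0 (real k * h))
      - (if j = 0 then (row_apply (S_row p) (\<lambda>k. f 0 (real k * h)) - h * f 1 0) / sbp_weight p 0 else 0)
      - sbp_tau p j * h ^ (p + 2) * f (p + 2) 0"
  have L: "\<bar>L\<bar> \<le> boundary_constant p * K * h ^ (p + 3)"
    unfolding L_def
  proof (rule boundary_stencil_error[OF p j _ _ h])
    show "(f i has_real_derivative f (Suc i) x) (at x within {0..X})" if "x \<in> {0..X}" for i x
      unfolding f_def using DERIV_subset[OF smooth_has_dx[OF U, of x t i 0], of "{0..X}"] that t by auto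
  qed (use K in \<open>simp add: f_def\<close>)
  have "truncation_error p F g U h t j - h ^ p * sbp_tau p j * ((dx ^^ (p + 2)) U) 0 t = L / h\<^sup>2"
    unfolding truncation_error_eq[OF sol t h(1)] sbp_D_row[OF p h(1)] sbp_S0_def sbp_H_eq L_def f_def
    using j h sbp_weight_pos[of p 0]
    by (simp add: numeral_2_eq_2[symmetric] power_add)
       (simp add: field_simps power2_eq_square eval_nat_numeral)
  then have "\<bar>truncation_error p F g U h t j - h ^ p * sbp_tau p j * ((dx ^^ (p + 2)) U) 0 t\<bar> = \<bar>L\<bar> / h\<^sup>2"
    using h by (simp add: abs_divide)
  also have "\<dots> \<le> boundary_constant p * K * h ^ (p + 3) / h\<^sup>2" using L by (intro divide_right_mono) auto
  also have "\<dots> = boundary_constant p * K * h ^ (p + 1)"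
    using h by (simp add: power_add power2_eq_square power3_eq_cube)
  finally show ?thesis .
qed

lemma truncation_interior:
  assumes p: "p \<in> {1, 2, 3}" and sol: "wave_solution F f1 f2 g U" and j: "j \<ge> num_bdry p"
    and t: "t \<ge> 0" and h: "h > 0" "real (j + p) * h \<le> X"
    and K: "\<And>x. x \<in> {0..X} \<Longrightarrow> \<bar>((dx ^^ (2 * p + 2)) U) x t\<bar> \<le> K"
  shows "\<bar>truncation_error p F g U h t j\<bar> \<le> abs_moment (sbp_stencil p) (real p) (2 * p + 2) * K * h ^ (2 * p)"
proof -
  have U: "smooth_quadrant U" using sol by (simp add: wave_solution_def)
  define f where "f = (\<lambda>i x. ((dx ^^ i) U) x t)"
  define L where "L = h\<^sup>2 * f 2 (real j * h) - row_apply (sbp_stencil p) (\<lambda>k. f 0 (real (j - p + k) * h))"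
  have L: "\<bar>L\<bar> \<le> abs_moment (sbp_stencil p) (real p) (2 * p + 2) * K * h ^ (2 * p + 2)"
    unfolding L_def
  proof (rule interior_stencil_error[OF p j _ _ h])
    show "(f i has_real_derivative f (Suc i) x) (at x within {0..X})" if "x \<in> {0..X}" for i x
      unfolding f_def using DERIV_subset[OF smooth_has_dx[OF U, of x t i 0], of "{0..X}"] that t by auto
  qed (use K in \<open>simp add: f_def\<close>)
  have "j \<noteq> 0" using p j by (auto simp: num_bdry_def)
  then have "truncation_error p F g U h t j = L / h\<^sup>2"
    unfolding truncation_error_eq[OF sol t h(1)] sbp_D_row[OF p h(1)] L_def f_def
    using j h by (simp add: numeral_2_eq_2[symmetric] diff_divide_distrib) (simp add: numeral_2_eq_2)
  then have "\<bar>truncation_error p F g U h t j\<bar> = \<bar>L\<bar> / h\<^sup>2" using h by (simp add: abs_divide)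
  also have "\<dots> \<le> abs_moment (sbp_stencil p) (real p) (2 * p + 2) * K * h ^ (2 * p + 2) / h\<^sup>2"
    using L by (intro divide_right_mono) auto
  also have "\<dots> = abs_moment (sbp_stencil p) (real p) (2 * p + 2) * K * h ^ (2 * p)"
    using h by (simp add: power_add power2_eq_square)
  finally show ?thesis .
qed

lemma dpos_eq_0:
  assumes "\<And>y. y > Y \<Longrightarrow> V y = 0" "x > Y" "x \<ge> 0"
  shows "dpos V x = 0"
proof (rule dpos_eqI)
  have "((\<lambda>y. 0) has_real_derivative 0) (at x within {0..})" by simp
  then show "(V has_real_derivative 0) (at x within {0..})"
    by (rule has_field_derivative_transform_within[where d="x - Y"]) (use assms in \<open>auto simp: dist_real_def\<close>)
qed fact

text \<open>Even the leftmost node \<open>j - p\<close> of the stencil lies ahead of the wave front.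
  Exact vanishing there keeps the interior forcing square summable on the infinite grid.\<close>

lemma truncation_far:
  assumes p: "p \<in> {1, 2, 3}" and sol: "wave_solution F f1 f2 g U" and j: "j \<ge> num_bdry p"
    and t: "t \<ge> 0" and h: "h > 0" and Y: "Y \<ge> 0"
    and far: "\<And>x. x > Y \<Longrightarrow> U x t = 0" and jY: "real (j - p) * h > Y"
  shows "truncation_error p F g U h t j = 0"
proof -
  have "j \<noteq> 0" using p j by (auto simp: num_bdry_def)
  have node: "real i * h > Y" if "i \<ge> j - p" for i
  proof -
    have "real (j - p) * h \<le> real i * h" using that h by (intro mult_right_mono) auto
    then show ?thesis using jY by linarith
  qed
  have "dx U x t = 0" if "x > Y" for x
    unfolding dx_apply by (rule dpos_eq_0[OF far that]) (use that Y in auto)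
  then have "dx (dx U) (real j * h) t = 0"
    unfolding dx_apply[of "dx U"] by (rule dpos_eq_0) (use node[of j] h in auto)
  then show ?thesis
    unfolding truncation_error_eq[OF sol t h] sbp_D_row[OF p h]
    using \<open>j \<noteq> 0\<close> j node far by (simp add: row_apply_def del: of_nat_add)
qed

text \<open>In a difference of two right-hand sides \<open>F\<close> and \<open>g\<close> cancel,
  and D together with the penalty term is exactly - \<open>H\<close> inverse times \<open>M\<close>.
  The whole error is thus an error part driven by the whole truncation error and can be bounded by
  the same theorem.\<close>

lemma error_part_grid_error:
  assumes p: "p \<in> {1, 2, 3}" and h: "h > 0" and sol: "wave_solution F f1 f2 g U"
    and u: "sbp_sat_solution p h F f1 f2 g u"
  shows "error_part p h (truncation_error p F g U h) (grid_error h U u)"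
proof -
  have U: "smooth_quadrant U" using sol by (simp add: wave_solution_def)
  obtain w where w: "\<And>j. u 0 j = f1 (real j * h)" "\<And>j. w 0 j = f2 (real j * h)"
    "\<And>t j. t \<ge> 0 \<Longrightarrow> ((\<lambda>s. u s j) has_real_derivative w t j) (at t within {0..})"
    "\<And>t j. t \<ge> 0 \<Longrightarrow> ((\<lambda>s. w s j) has_real_derivative sat_rhs p h F g t (u t) j) (at t within {0..})"
    using u unfolding sbp_sat_solution_def second_order_ivp_def by metis
  have D_diff: "sbp_D p h (\<lambda>i. a i - b i) j = sbp_D p h a j - sbp_D p h b j" for a b j
    unfolding sbp_D_row[OF p h] by (simp add: row_apply_diff diff_divide_distrib)
  have M_diff: "- (sbp_M p h (\<lambda>i. a i - b i) j / sbp_H p h j) = sat_rhs p h F g t a j - sat_rhs p h F g t b j" for a b j t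
  proof -
    have "sbp_H p h j \<noteq> 0" using h sbp_weight_pos[of p j] by (simp add: sbp_H_eq)
    then show ?thesis
      unfolding sbp_M_def sat_rhs_def D_diff sbp_S0_def row_apply_diff
      by (cases "j = 0") (simp_all add: diff_divide_distrib)
  qed
  show ?thesis
    unfolding error_part_def second_order_ivp_def
  proof (intro exI[of _ "\<lambda>t j. dt U (real j * h) t - w t j"] allI conjI impI)
    fix j
    have x: "real j * h \<ge> 0" using h by simp
    show "grid_error h U u 0 j = 0" "dt U (real j * h) 0 - w 0 j = 0"
      using sol x w(1,2) by (auto simp: grid_error_def wave_solution_def)
    fix t :: real assume t: "t \<ge> 0"
    show "((\<lambda>s. grid_error h U u s j) has_real_derivative dt U (real j * h) t - w t j) (at t within {0..})"
      unfolding grid_error_def using smooth_has_dt[OF U x t, of 0 0] by (intro DERIV_diff w(3)[OF t]) simp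
    have "((\<lambda>s. dt U (real j * h) s - w s j) has_real_derivative dt (dt U) (real j * h) t - sat_rhs p h F g t (u t) j) (at t within {0..})"
      using smooth_has_dt[OF U x t, of 0 1] by (intro DERIV_diff w(4)[OF t]) simp
    moreover have "dt (dt U) (real j * h) t - sat_rhs p h F g t (u t) j
        = - (sbp_M p h (grid_error h U u t) j / sbp_H p h j) + truncation_error p F g U h t j"
      unfolding grid_error_def M_diff[where t=t] truncation_error_def by simp
    ultimately show "((\<lambda>s. dt U (real j * h) s - w s j) has_real_derivative
        - (sbp_M p h (grid_error h U u t) j / sbp_H p h j) + truncation_error p F g U h t j) (at t within {0..})"
      by simp
  qed
qed

text \<open>The limit that defines the leading part exists with an O(h) rate by the boundary
  expansion, so the two readings of the boundary forcing differ by O(h^(p+1)) only.\<close>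

lemma leading_boundary_truncation_eq:
  assumes p: "p \<in> {1, 2, 3}" and sol: "wave_solution F f1 f2 g U" and t: "t \<ge> 0" and h: "h > 0"
  shows "leading_boundary_truncation p F g U h t j = h ^ p * sbp_tau p j * ((dx ^^ (p + 2)) U) 0 t"
proof (cases "j < num_bdry p")
  case True
  have U: "smooth_quadrant U" using sol by (simp add: wave_solution_def)
  define l where "l = sbp_tau p j * ((dx ^^ (p + 2)) U) 0 t"
  obtain K where K: "\<And>x s. x \<in> {0..8} \<Longrightarrow> s \<in> {0..t} \<Longrightarrow> \<bar>((dx ^^ (p + 3)) U) x s\<bar> \<le> K"
    using smooth_bounded[OF U, of 8 t "p + 3" 0] by auto
  have "((\<lambda>k. truncation_error p F g U k t j / k ^ p) \<longlongrightarrow> l) (at_right 0)"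
  proof (rule LIM_zero_cancel[OF Lim_null_comparison])
    show "\<forall>\<^sub>F k in at_right 0. norm (truncation_error p F g U k t j / k ^ p - l) \<le> boundary_constant p * K * k"
    proof (rule eventually_at_rightI[of 0 1])
      fix k :: real assume k: "k \<in> {0<..<1}"
      have "\<bar>truncation_error p F g U k t j - k ^ p * sbp_tau p j * ((dx ^^ (p + 2)) U) 0 t\<bar> \<le> boundary_constant p * K * k ^ (p + 1)"
        by (rule truncation_boundary[OF p sol True t, where X = 8]) (use k K t in auto)
      then have "\<bar>truncation_error p F g U k t j - k ^ p * sbp_tau p j * ((dx ^^ (p + 2)) U) 0 t\<bar> / k ^ p \<le> boundary_constant p * K * k ^ (p + 1) / k ^ p"
        using k by (intro divide_right_mono) auto
      moreover have "truncation_error p F g U k t j / k ^ p - l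
          = (truncation_error p F g U k t j - k ^ p * sbp_tau p j * ((dx ^^ (p + 2)) U) 0 t) / k ^ p"
        using k by (simp add: l_def field_simps)
      ultimately show "norm (truncation_error p F g U k t j / k ^ p - l) \<le> boundary_constant p * K * k"
        using k by (simp add: abs_divide)
    qed auto
    have "((\<lambda>k. boundary_constant p * K * k) \<longlongrightarrow> boundary_constant p * K * 0) (at_right 0)"
      by (intro tendsto_intros)
    then show "((\<lambda>k. boundary_constant p * K * k) \<longlongrightarrow> 0) (at_right 0)" by simp
  qed
  then have "Lim (at_right 0) (\<lambda>k. truncation_error p F g U k t j / k ^ p) = l"
    by (intro tendsto_Lim) auto
  then show ?thesis using True by (simp add: leading_boundary_truncation_def l_def)
qed (simp add: leading_boundary_truncation_def sbp_tau_0)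

section \<open>Convergence rates from the error bounds\<close>

theorem mainTheorem3:
  fixes p b q :: nat
    and F U :: "real \<Rightarrow> real \<Rightarrow> real"
    and f1 f2 g :: "real \<Rightarrow> real"
  assumes order: "(p, b, q) \<in> {(1, 2, 2), (2, 4, 4), (3, 5, 5)}"
    and data: "wave_data F f1 f2 g"
    and solution: "wave_solution F f1 f2 g U"
  shows "\<forall>t_f>0. \<exists>C. \<forall>\<^sub>F h in at_right 0.
    (\<forall>B \<epsilon>.
       B \<in> {boundary_truncation p F g U h, leading_boundary_truncation p F g U h} \<and>
       error_part p h B \<epsilon> \<and> (\<forall>t\<ge>0. finite_hnorm (\<epsilon> t)) \<longrightarrow>
       (\<lambda>t. (hnorm h (\<epsilon> t))\<^sup>2) integrable_on {0..t_f} \<and>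
       sqrt (integral {0..t_f} (\<lambda>t. (hnorm h (\<epsilon> t))\<^sup>2)) \<le> C * h ^ b) \<and>
    (\<forall>u.
       sbp_sat_solution p h F f1 f2 g u \<and> (\<forall>t\<ge>0. finite_hnorm (grid_error h U u t)) \<longrightarrow>
       (\<lambda>t. (hnorm h (grid_error h U u t))\<^sup>2) integrable_on {0..t_f} \<and>
       sqrt (integral {0..t_f} (\<lambda>t. (hnorm h (grid_error h U u t))\<^sup>2)) \<le> C * h ^ q)"
proof (intro allI impI)
  fix t_f :: real assume "t_f > 0"
  define T where "T = t_f"
  have T: "T > 0" using \<open>t_f > 0\<close> by (simp add: T_def)
  have p: "p \<in> {1, 2, 3}" and bq: "q = b" using order by auto
  have b: "p = 1 \<and> b = 2 \<or> p \<in> {2, 3} \<and> b = p + 2" using order by auto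
  have U: "smooth_quadrant U" using solution by (simp add: wave_solution_def)
  obtain X0 where X0: "X0 \<ge> 0" "\<And>x t. t \<ge> 0 \<Longrightarrow> x > X0 + t \<Longrightarrow> U x t = 0"
    using finite_propagation_speed[OF data solution] by blast
  \<comment> \<open>The margin 8 serves twice for h < 1: the nodes of the boundary rows, up to 8 h,
    lie in [0, X], and a stencil of width at most 6 h that leaves [0, X] lies entirely ahead of the
    front.\<close>
  define X where "X = X0 + T + 8"
  obtain K1 where K1: "\<And>x t. x \<in> {0..X} \<Longrightarrow> t \<in> {0..T} \<Longrightarrow> \<bar>((dx ^^ (p + 3)) U) x t\<bar> \<le> K1"
    using smooth_bounded[OF U, of X T "p + 3" 0] by auto
  obtain K2 where K2: "\<And>x t. x \<in> {0..X} \<Longrightarrow> t \<in> {0..T} \<Longrightarrow> \<bar>((dx ^^ (2 * p + 2)) U) x t\<bar> \<le> K2"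
    using smooth_bounded[OF U, of X T "2 * p + 2" 0] by auto
  \<comment> \<open>By equality of mixed partial derivatives, \<open>c (Suc k)\<close> is the time
    derivative of \<open>c k\<close>; so \<open>c 0\<close>, the amplitude of the leading boundary
    error, comes with the two derivatives that the corrector needs.\<close>
  define c where "c = (\<lambda>k t. ((dx ^^ (p + 2)) ((dt ^^ k) U)) 0 t)"
  have "\<exists>K. \<forall>t\<in>{0..T}. \<bar>c k t\<bar> \<le> K" for k
  proof -
    obtain K where "\<And>x t. x \<in> {0..X} \<Longrightarrow> t \<in> {0..T} \<Longrightarrow> \<bar>((dx ^^ (p + 2)) ((dt ^^ k) U)) x t\<bar> \<le> K"
      using smooth_bounded[OF U, of X T "p + 2" k] by blast
    then show ?thesis using X0(1) T by (intro exI[of _ K]) (simp add: c_def X_def)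
  qed
  then obtain Kc where Kc: "\<And>k t. t \<in> {0..T} \<Longrightarrow> \<bar>c k t\<bar> \<le> Kc k" by metis
  define K where "K = max 0 (max K1 (max K2 (max (Kc 0) (max (Kc 1) (Kc 2)))))"
  have K0: "K \<ge> 0" by (simp add: K_def)
  have K: "\<And>x t. x \<in> {0..X} \<Longrightarrow> t \<in> {0..T} \<Longrightarrow> \<bar>((dx ^^ (p + 3)) U) x t\<bar> \<le> K"
    "\<And>x t. x \<in> {0..X} \<Longrightarrow> t \<in> {0..T} \<Longrightarrow> \<bar>((dx ^^ (2 * p + 2)) U) x t\<bar> \<le> K"
    "\<And>t. t \<in> {0..T} \<Longrightarrow> \<bar>c 0 t\<bar> \<le> K" "\<And>t. t \<in> {0..T} \<Longrightarrow> \<bar>c 1 t\<bar> \<le> K" "\<And>t. t \<in> {0..T} \<Longrightarrow> \<bar>c 2 t\<bar> \<le> K"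
    using K1 K2 Kc unfolding K_def by (meson le_max_iff_disj)+
  have c': "(c k has_real_derivative c (Suc k) t) (at t within {0..T})" if "t \<in> {0..T}" for k t
    unfolding c_def using that DERIV_subset[OF smooth_has_dt[OF U, of 0 t "p + 2" k], of "{0..T}"] by auto
  have c_cont: "continuous_on {0..T} (c k)" for k by (rule DERIV_continuous_on[OF c'])

  \<comment> \<open>For p = 1 the weighted mean is -1/6, so nothing is corrected and the whole
    boundary error goes into the remainder.\<close>
  define \<tau> where "\<tau> = (\<lambda>j. if p = 1 then 0 else sbp_tau p j)"
  have tau0: "\<tau> j = 0" if "j \<ge> num_bdry p" for j using that by (simp add: \<tau>_def sbp_tau_0)
  have m6: "num_bdry p \<le> 6" by (simp add: num_bdry_def)
  have orth: "(\<Sum>j<6. sbp_weight p j * \<tau> j) = 0"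
    using sbp_tau_orthogonal[of p] p by (auto simp: \<tau>_def)
  have tau6: "\<tau> j = 0" if "j \<ge> 6" for j using that m6 by (intro tau0) linarith
  show "\<exists>C. \<forall>\<^sub>F h in at_right 0.
    (\<forall>B \<epsilon>.
       B \<in> {boundary_truncation p F g U h, leading_boundary_truncation p F g U h} \<and>
       error_part p h B \<epsilon> \<and> (\<forall>t\<ge>0. finite_hnorm (\<epsilon> t)) \<longrightarrow>
       (\<lambda>t. (hnorm h (\<epsilon> t))\<^sup>2) integrable_on {0..t_f} \<and>
       sqrt (integral {0..t_f} (\<lambda>t. (hnorm h (\<epsilon> t))\<^sup>2)) \<le> C * h ^ b) \<and>
    (\<forall>u.
       sbp_sat_solution p h F f1 f2 g u \<and> (\<forall>t\<ge>0. finite_hnorm (grid_error h U u t)) \<longrightarrow>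
       (\<lambda>t. (hnorm h (grid_error h U u t))\<^sup>2) integrable_on {0..t_f} \<and>
       sqrt (integral {0..t_f} (\<lambda>t. (hnorm h (grid_error h U u t))\<^sup>2)) \<le> C * h ^ q)"
  \<comment> \<open>The constant \<open>C\<close> is fixed before the mesh size and the forcing,
    hence uniform in both.\<close>
  proof (rule error_part_bound[OF p less_imp_le[OF T] tau6 orth], goal_cases)
    case 1
    then show ?case .
  next
    case (2 C)
    note C0 = 2(1) and C = 2(2)
  define A where "A = abs_moment (sbp_stencil p) (real p) (2 * p + 2)"
  have A0: "A \<ge> 0" by (simp add: A_def abs_moment_nonneg)
  define D where "D = C * K * (1 + (boundary_constant p + 1) + sqrt (X + 1) * A)"

  have main: "(\<lambda>t. (hnorm h (\<epsilon> t))\<^sup>2) integrable_on {0..T} \<and>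
      sqrt (integral {0..T} (\<lambda>t. (hnorm h (\<epsilon> t))\<^sup>2)) \<le> D * h ^ b"
    if h: "0 < h" "h < 1" and fin: "\<forall>t\<ge>0. finite_hnorm (\<epsilon> t)" and err: "error_part p h B \<epsilon>"
      and B: "B \<in> {boundary_truncation p F g U h, leading_boundary_truncation p F g U h, truncation_error p F g U h}"
    for h B \<epsilon>
  proof -
    have hX: "8 * h \<le> X" using h X0(1) T by (simp add: X_def)
    define r where "r = (\<lambda>t j. if j < num_bdry p then B t j - h ^ p * c 0 t * \<tau> j else 0)"
    define f where "f = (\<lambda>t j. if j < num_bdry p then 0 else B t j)"
    have B_cont: "continuous_on {0..T} (\<lambda>t. B t j)" for j
    proof -
      have te: "continuous_on {0..T} (\<lambda>t. truncation_error p F g U h t j)"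
        by (rule truncation_error_continuous[OF p solution h(1)])
      have "continuous_on {0..T} (\<lambda>t. h ^ p * sbp_tau p j * c 0 t)" by (intro continuous_intros c_cont)
      then have "continuous_on {0..T} (\<lambda>t. leading_boundary_truncation p F g U h t j)"
        by (rule continuous_on_cong[THEN iffD1, rotated -1])
           (use leading_boundary_truncation_eq[OF p solution _ h(1)] in \<open>auto simp: c_def\<close>)
      then show ?thesis using B te by (cases "j < num_bdry p") (auto simp: boundary_truncation_def)
    qed
    have tau_le: "\<bar>sbp_tau p j\<bar> \<le> 1" if "p = 1" for j
      using that by (simp add: sbp_tau_def Let_def)
    have B_near: "\<bar>B t j - h ^ p * c 0 t * sbp_tau p j\<bar> \<le> boundary_constant p * K * h ^ (p + 1)"
      if t: "t \<in> {0..T}" and j: "j < num_bdry p" for t j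
    proof -
      have "\<bar>truncation_error p F g U h t j - h ^ p * sbp_tau p j * ((dx ^^ (p + 2)) U) 0 t\<bar> \<le> boundary_constant p * K * h ^ (p + 1)"
        by (rule truncation_boundary[OF p solution j _ h(1) hX]) (use t K(1) in auto)
      moreover have "0 \<le> boundary_constant p * K * h ^ (p + 1)"
        using boundary_constant_nonneg[of p] K0 h by simp
      ultimately show ?thesis
        using B j t leading_boundary_truncation_eq[OF p solution _ h(1), of t j]
        by (auto simp: boundary_truncation_def c_def mult_ac)
    qed
    \<comment> \<open>The exponent b - 1 is 1 for p = 1, where the leading term is kept, and p + 1
      otherwise, where it has been removed.\<close>
    have r_le: "\<bar>r t j\<bar> \<le> (boundary_constant p + 1) * K * h ^ (b - 1)" if t: "t \<in> {0..T}" for t j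
    proof (cases "j < num_bdry p")
      case True
      show ?thesis
      proof (cases "p = 1")
        case p1: True
        then have b2: "b = 2" using b by auto
        have "\<bar>h * c 0 t * sbp_tau p j\<bar> \<le> h * K * 1"
          unfolding abs_mult using h K(3)[OF t] tau_le[OF p1, of j] K0 by (intro mult_mono) auto
        moreover have "\<bar>B t j - h * c 0 t * sbp_tau p j\<bar> \<le> boundary_constant p * K * h"
        proof -
          have "boundary_constant p * K * h ^ (p + 1) \<le> boundary_constant p * K * h ^ 1"
            using h boundary_constant_nonneg[of p] K0 by (intro mult_left_mono power_decreasing) auto
          then show ?thesis using B_near[OF t True] p1 by simp
        qed
        ultimately have "\<bar>B t j\<bar> \<le> (boundary_constant p + 1) * K * h" by (simp add: algebra_simps)
        then show ?thesis using True p1 b2 by (simp add: r_def \<tau>_def)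
      next
        case False
        then have "\<bar>r t j\<bar> \<le> boundary_constant p * K * h ^ (p + 1)"
          using B_near[OF t True] True by (simp add: r_def \<tau>_def)
        also have "\<dots> \<le> (boundary_constant p + 1) * K * h ^ (p + 1)"
          using K0 h by (intro mult_right_mono) auto
        also have "p + 1 = b - 1" using b False by auto
        finally show ?thesis .
      qed
    next
      case False
      then show ?thesis using K0 h boundary_constant_nonneg[of p] by (simp add: r_def)
    qed
    have f_pt: "\<bar>f t j\<bar> \<le> (if real j * h \<le> X then A * K * h ^ (2 * p) else 0)" if t: "t \<in> {0..T}" for t j
    proof (cases "j < num_bdry p \<or> B t j = 0")
      case True
      then show ?thesis using A0 K0 h by (auto simp: f_def)
    next
      case False
      then have j: "j \<ge> num_bdry p" "j \<ge> p" "B t j = truncation_error p F g U h t j" "f t j = B t j"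
        using B p by (auto simp: boundary_truncation_def leading_boundary_truncation_def f_def num_bdry_def)
      show ?thesis
      proof (cases "real (j + p) * h \<le> X")
        case True
        then have "\<bar>f t j\<bar> \<le> A * K * h ^ (2 * p)"
          unfolding j(3,4) A_def using t K(2) by (intro truncation_interior[OF p solution j(1) _ h(1)]) auto
        moreover have "real j * h \<le> X"
          using True h by (smt (verit) of_nat_add mult_right_mono of_nat_0_le_iff)
        ultimately show ?thesis by simp
      next
        case far: False
        have "real p * h \<le> 3 * 1" using p h by (intro mult_mono) auto
        then have "real (j - p) * h > X0 + T"
          using far j(2) by (simp add: X_def of_nat_diff algebra_simps)
        then have "truncation_error p F g U h t j = 0"
          using t X0 by (intro truncation_far[OF p solution j(1) _ h(1), of _ "X0 + T"]) auto
        then show ?thesis using False j by simp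
      qed
    qed
    \<comment> \<open>At most \<open>N\<close> grid points lie in [0, X]; the growth of sqrt N is
      compensated by the factor sqrt h of the norm.\<close>
    define N where "N = nat \<lfloor>X / h\<rfloor> + 1"
    have X0': "X \<ge> 0" using X0 T by (simp add: X_def)
    have N_le: "real N \<le> X / h + 1" using X0' h by (simp add: N_def)
    have f_L2: "L2_set (f t) {..<n} \<le> sqrt (X / h + 1) * (A * K * h ^ (2 * p))" if t: "t \<in> {0..T}" for t n
    proof -
      define a where "a = A * K * h ^ (2 * p)"
      have a0: "a \<ge> 0" using A0 K0 h by (simp add: a_def)
      have "(\<Sum>j<n. (f t j)\<^sup>2) \<le> (\<Sum>j<n. if j \<in> {..<N} then a\<^sup>2 else 0)"
      proof (rule sum_mono)
        fix j
        show "(f t j)\<^sup>2 \<le> (if j \<in> {..<N} then a\<^sup>2 else 0)"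
        proof (cases "real j * h \<le> X")
          case True
          then have "real j \<le> X / h" using h by (simp add: pos_le_divide_eq)
          then have "j < N" unfolding N_def by (simp add: le_nat_floor less_Suc_eq_le)
          moreover have "\<bar>f t j\<bar> \<le> a" using f_pt[OF t, of j] True by (simp add: a_def)
          ultimately show ?thesis using abs_le_square_iff[of "f t j" a] a0 by simp
        next
          case False
          then show ?thesis using f_pt[OF t, of j] by simp
        qed
      qed
      also have "\<dots> = (\<Sum>j\<in>{..<n} \<inter> {..<N}. a\<^sup>2)" by (rule sum.inter_restrict[symmetric]) simp
      also have "\<dots> \<le> (\<Sum>j\<in>{..<N}. a\<^sup>2)" by (rule sum_mono2) auto
      also have "\<dots> \<le> (X / h + 1) * a\<^sup>2" using N_le by (simp add: mult_right_mono)
      finally have "L2_set (f t) {..<n} \<le> sqrt ((X / h + 1) * a\<^sup>2)"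
        unfolding L2_set_def by (rule real_sqrt_le_mono)
      then show ?thesis using a0 by (simp add: real_sqrt_mult a_def)
    qed
    have est: "(\<lambda>t. (hnorm h (\<epsilon> t))\<^sup>2) integrable_on {0..T} \<and>
      sqrt (integral {0..T} (\<lambda>t. (hnorm h (\<epsilon> t))\<^sup>2)) \<le>
        C * (h ^ p * K * h\<^sup>2 * sqrt h + h * ((boundary_constant p + 1) * K * h ^ (b - 1))
          + sqrt h * (sqrt (X / h + 1) * (A * K * h ^ (2 * p))))"
    proof (rule C[where B = B and c = "c 0" and c' = "c 1" and c'' = "c 2" and r = r and f = f])
      show "B t j = h ^ p * c 0 t * \<tau> j + r t j + f t j" for t j
        by (simp add: r_def f_def tau0)
      show "(c 0 has_real_derivative c 1 t) (at t within {0..T})" if "t \<in> {0..T}" for t using c'[OF that, of 0] by simp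
      show "(c 1 has_real_derivative c 2 t) (at t within {0..T})" if "t \<in> {0..T}" for t
        using c'[OF that, of 1] by (simp add: numeral_2_eq_2)
      show "continuous_on {0..T} (\<lambda>t. r t j)" for j
        unfolding r_def by (cases "j < num_bdry p") (auto intro!: continuous_intros B_cont c_cont)
      show "continuous_on {0..T} (\<lambda>t. f t j)" for j
        unfolding f_def by (cases "j < num_bdry p") (auto intro!: continuous_intros B_cont)
      show "r t j = 0" if "j \<ge> 6" for t j using that m6 by (simp add: r_def)
    qed (use h fin err K c_cont r_le f_L2 in auto)
    \<comment> \<open>The corrector gives the exponent p + 5/2, the remainder b, and the interior 2
      p. All are at least b; for p = 3 the remainder alone determines the rate 5.\<close>
    have "h ^ p * K * h\<^sup>2 * sqrt h + h * ((boundary_constant p + 1) * K * h ^ (b - 1))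
          + sqrt h * (sqrt (X / h + 1) * (A * K * h ^ (2 * p)))
        \<le> K * h ^ b + (boundary_constant p + 1) * K * h ^ b + sqrt (X + 1) * (A * K * h ^ b)"
    proof (intro add_mono)
      have "h ^ (p + 2) * sqrt h \<le> h ^ b * 1"
        using h b by (intro mult_mono power_decreasing) auto
      then have "K * (h ^ (p + 2) * sqrt h) \<le> K * h ^ b" using K0 by (intro mult_left_mono) auto
      then show "h ^ p * K * h\<^sup>2 * sqrt h \<le> K * h ^ b" by (simp add: power_add power2_eq_square mult_ac)
      have hb: "h * h ^ (b - 1) = h ^ b" using b by (cases b) auto
      have eq: "h * ((boundary_constant p + 1) * K * h ^ (b - 1)) = (boundary_constant p + 1) * K * (h * h ^ (b - 1))"
        by (simp only: mult_ac)
      show "h * ((boundary_constant p + 1) * K * h ^ (b - 1)) \<le> (boundary_constant p + 1) * K * h ^ b"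
        by (rule eq_refl[OF eq[unfolded hb]])
      have "sqrt h * sqrt (X / h + 1) = sqrt (X + h)"
        using h by (simp add: real_sqrt_mult[symmetric] distrib_left)
      also have "\<dots> \<le> sqrt (X + 1)" using h by simp
      finally have "(sqrt h * sqrt (X / h + 1)) * (A * K * h ^ (2 * p)) \<le> sqrt (X + 1) * (A * K * h ^ b)"
        using h b A0 K0 X0' by (intro mult_mono mult_left_mono power_decreasing) auto
      then show "sqrt h * (sqrt (X / h + 1) * (A * K * h ^ (2 * p))) \<le> sqrt (X + 1) * (A * K * h ^ b)"
        by (simp add: mult.assoc)
    qed
    also have "\<dots> = K * (1 + (boundary_constant p + 1) + sqrt (X + 1) * A) * h ^ b" by (simp add: algebra_simps)
    finally have "C * (h ^ p * K * h\<^sup>2 * sqrt h + h * ((boundary_constant p + 1) * K * h ^ (b - 1))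
          + sqrt h * (sqrt (X / h + 1) * (A * K * h ^ (2 * p)))) \<le> D * h ^ b"
      unfolding D_def using C0 by (simp add: mult.assoc mult_left_mono)
    then show ?thesis using est by auto
  qed
    show ?case
  proof (intro exI[of _ D] eventually_at_rightI[of 0 1] conjI[of "\<forall>B \<epsilon>. _ B \<epsilon>"] allI impI)
    fix h :: real assume h: "h \<in> {0<..<1}"
    show "(\<lambda>t. (hnorm h (\<epsilon> t))\<^sup>2) integrable_on {0..t_f} \<and>
       sqrt (integral {0..t_f} (\<lambda>t. (hnorm h (\<epsilon> t))\<^sup>2)) \<le> D * h ^ b"
      if "B \<in> {boundary_truncation p F g U h, leading_boundary_truncation p F g U h} \<and>
       error_part p h B \<epsilon> \<and> (\<forall>t\<ge>0. finite_hnorm (\<epsilon> t))" for B \<epsilon>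
      using main[of h \<epsilon> B] that h unfolding T_def by auto
    show "(\<lambda>t. (hnorm h (grid_error h U u t))\<^sup>2) integrable_on {0..t_f} \<and>
       sqrt (integral {0..t_f} (\<lambda>t. (hnorm h (grid_error h U u t))\<^sup>2)) \<le> D * h ^ q"
      if "sbp_sat_solution p h F f1 f2 g u \<and> (\<forall>t\<ge>0. finite_hnorm (grid_error h U u t))" for u
      using main[of h "grid_error h U u" "truncation_error p F g U h"] that h
        error_part_grid_error[OF p _ solution, of h u] unfolding T_def bq by auto
  qed auto
  qed
qed

end
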